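(* Let $f:I_1\times I_2\to\mathcal{Z}$ be a regular umbilic-free Legendre map parametrised by curvature line coordinates $(u,v)$. If $f$ is Lie applicable and has exactly one family of spherical curvature lines, then all members of this family are Lie sphere transforms of a certain constrained elastic curve. That is, if the $u$-parameter lines are this family, there exist a spacelike line $L_0\le\mathbb{R}^{4,2}$ and a Legendre curve $C:I_1\to\mathcal{Z}$ in $L_0^\perp\cong\mathbb{R}^{3,2}$ which projects to a constrained elastic curve in some 2-dimensional space form, such that for each $v\in I_2$ there is a Lie sphere transformation $B_v\in\mathrm{O}(4,2)$ with $f(u,v)=B_vC(u)$ for all $u\in I_1$.
   Context: Let $\mathbb{R}^{4,2}$ be $\mathbb{R}^6$ with a symmetric bilinear form $(\cdot,\cdot)$ of signature $(4,2)$, $\mathcal{L}$ its light cone, $\mathcal{Z}$ the Grassmannian of totally isotropic 2-planes, and $\wedge^2\mathbb{R}^{4,2}\cong\mathfrak{o}(4,2)$ via $(a\wedge b)c=(a,c)b-(b,c)a$. $I_1,I_2$ are open intervals, $\Sigma=I_1\times I_2$. A smooth map $f:\Sigma\to\mathcal{Z}$ is identified with a rank 2 null subbundle of $\Sigma\times\mathbb{R}^{4,2}$; $f^{(1)}$ is the set of sections of $f$ and derivatives of sections of $f$. $f$ is a Legendre map if $f^{(1)}\le f^\perp$ and, for any $x$, if $X\in T_x\Sigma$ satisfies $d\sigma(X)\in f$ for all $\sigma\in\Gamma f$, then $X=0$. A Legendre curve in $L_0^\perp$ satisfies the same conditions for maps from an interval into the isotropic 2-planes of $L_0^\perp\cong\mathbb{R}^{3,2}$.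 $f$ is umbilic-free if there are rank 1 subbundles (curvature sphere congruences) $s_1,s_2\le f$ with $s_1\cap s_2=\{0\}$ and rank 1 curvature subbundles $T_1,T_2$ with $d_X\sigma_i\in\Gamma f$ for $\sigma_i\in\Gamma s_i$, $X\in\Gamma T_i$; leaves of $T_1,T_2$ are the curvature lines, and $(u,v)$ are curvature line coordinates if $\partial_u\in\Gamma T_1$, $\partial_v\in\Gamma T_2$. $f$ is regular if $s_1,s_2:\Sigma\to\mathbb{P}(\mathcal{L})$ are immersions. The leaves of $T_i$ are spherical curvature lines if some spacelike rank 1 subbundle of $f^\perp$ is constant along the leaves of $T_i$ (the Lie-invariant form of: in any conformal Riemannian subgeometry they lie on spheres meeting the surface transversally). $f$ is Lie applicable if there is $\eta\in\Omega^1(f\wedge f^\perp)$ with $d\eta=[\eta\wedge\eta]=0$ such that $\mathcal{Q}^\eta(X,Y)=\mathrm{tr}(f\to f:\sigma\mapsto\eta(X)d_Y\sigma)$ is non-zero. 2-dimensional space forms: in $L_0^\perp\cong\mathbb{R}^{3,2}$ choose $\mathfrak{p}$ with $\chi:=-(\mathfrak{p},\mathfrak{p})=\pm1$ and non-zero $\mathfrak{q}\perp\mathfrak{p}$, and set $\mathfrak{Q}^2=\{y\in\mathcal{L}\cap L_0^\perp:(y,\mathfrak{q})=-1,(y,\mathfrak{p})=0\}$, $\mathfrak{P}^2=\{y\in\mathcal{L}\cap L_0^\perp:(y,\mathfrak{p})=-1,(y,\mathfrak{q})=0\}$, $\kappa=-(\mathfrak{q},\mathfrak{q})$. $C$ projects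 to $\mathfrak{f}:=C\cap\mathfrak{Q}^2$; with $\mathfrak{t}:=C\cap\mathfrak{P}^2$ its curvature $k$ is given by $d\mathfrak{t}=-k\,d\mathfrak{f}$. $\mathfrak{f}$ is constrained elastic if $k''+\chi\tfrac{k^3}{2}+(\mu+\kappa)k+\lambda=0$ for some constants $\mu,\lambda\in\mathbb{R}$, with $'$ the derivative with respect to arclength of $\mathfrak{f}$. *)

theory Defs
  imports "HOL-Analysis.Analysis"
begin

section \<open>Smooth maps, subbundles and sections\<close>

text \<open>All domains \<open>M\<close> below are open subsets of a Euclidean space (an interval or
  \<open>I1 \<times> I2\<close>); derivatives at points of \<open>M\<close> then only depend on the values on \<open>M\<close>.\<close>

abbreviation dder :: "('a::euclidean_space \<Rightarrow> 'b::real_normed_vector) \<Rightarrow> 'a \<Rightarrow> 'a \<Rightarrow> 'b" where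
  "dder \<sigma> x X \<equiv> frechet_derivative \<sigma> (at x) X"

primrec Ck_on :: "nat \<Rightarrow> 'a::euclidean_space set \<Rightarrow> ('a \<Rightarrow> 'b::real_normed_vector) \<Rightarrow> bool" where
  "Ck_on 0 M \<sigma> \<longleftrightarrow> continuous_on M \<sigma>"
| "Ck_on (Suc k) M \<sigma> \<longleftrightarrow> \<sigma> differentiable_on M \<and> (\<forall>X. Ck_on k M (\<lambda>x. dder \<sigma> x X))"

definition smooth_on :: "'a::euclidean_space set \<Rightarrow> ('a \<Rightarrow> 'b::real_normed_vector) \<Rightarrow> bool" where
  "smooth_on M \<sigma> \<longleftrightarrow> (\<forall>k. Ck_on k M \<sigma>)"

definition open_interval :: "real set \<Rightarrow> bool" where
  "open_interval I \<longleftrightarrow> open I \<and> is_interval I \<and> I \<noteq> {}"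

text \<open>Rank \<open>k\<close> smooth subbundle of the trivial bundle over \<open>M\<close> with fibre \<open>'b\<close>, given by its
  fibres: locally spanned by a smooth frame. Equivalently, a smooth map from \<open>M\<close> to the
  Grassmannian of \<open>k\<close>-planes.\<close>

definition subbundle_on ::
    "'a::euclidean_space set \<Rightarrow> nat \<Rightarrow> ('a \<Rightarrow> 'b::euclidean_space set) \<Rightarrow> bool" where
  "subbundle_on M k V \<longleftrightarrow>
     (\<forall>x\<in>M. subspace (V x) \<and> dim (V x) = k) \<and>
     (\<forall>x\<in>M. \<exists>U F. open U \<and> x \<in> U \<and> U \<subseteq> M \<and> (\<forall>i<k. smooth_on U (F i)) \<and>
        (\<forall>y\<in>U. V y = span ((\<lambda>i. F i y) ` {..<k})))"

definition sections ::
    "'a::euclidean_space set \<Rightarrow> ('a \<Rightarrow> 'b::euclidean_space set) \<Rightarrow> ('a \<Rightarrow> 'b) set" where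
  "sections M V = {\<sigma>. smooth_on M \<sigma> \<and> (\<forall>x\<in>M. \<sigma> x \<in> V x)}"

text \<open>The derivative at \<open>x\<close> of a map \<open>V\<close> into a Grassmannian sends \<open>X\<close> to the homomorphism
  \<open>\<sigma> x \<mapsto> d\<sigma>(X) mod V x\<close>; the map is an immersion iff this is injective in \<open>X\<close>. For rank 1
  subbundles this is the immersion condition for a map into projective space.\<close>

definition immersed_on ::
    "'a::euclidean_space set \<Rightarrow> ('a \<Rightarrow> 'b::euclidean_space set) \<Rightarrow> bool" where
  "immersed_on M V \<longleftrightarrow>
     (\<forall>x\<in>M. \<forall>X. (\<forall>\<sigma>\<in>sections M V. dder \<sigma> x X \<in> V x) \<longrightarrow> X = 0)"


section \<open>Lie sphere geometry\<close>

type_synonym R42 = "real^6"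

text \<open>The form of signature (4,2). The index type \<open>6\<close> has the elements \<open>1, \<dots>, 5\<close> and \<open>6 = 0\<close>.\<close>

definition lform :: "R42 \<Rightarrow> R42 \<Rightarrow> real" where
  "lform x y = x$1 * y$1 + x$2 * y$2 + x$3 * y$3 + x$4 * y$4 - x$5 * y$5 - x$6 * y$6"

definition lperp :: "R42 set \<Rightarrow> R42 set" where
  "lperp V = {y. \<forall>x\<in>V. lform x y = 0}"

definition light_cone :: "R42 set" where
  "light_cone = {y. lform y y = 0}"

definition null_planes :: "R42 set set" where
  "null_planes = {V. subspace V \<and> dim V = 2 \<and> (\<forall>a\<in>V. \<forall>b\<in>V. lform a b = 0)}"

definition spacelike :: "R42 set \<Rightarrow> bool" where
  "spacelike V \<longleftrightarrow> (\<forall>x\<in>V. x \<noteq> 0 \<longrightarrow> lform x x > 0)"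

definition lie_sphere_transformation :: "real^6^6 \<Rightarrow> bool" where
  "lie_sphere_transformation B \<longleftrightarrow> (\<forall>x y. lform (B *v x) (B *v y) = lform x y)"

definition first_derived :: "'a::euclidean_space set \<Rightarrow> ('a \<Rightarrow> R42 set) \<Rightarrow> 'a \<Rightarrow> R42 set" where
  "first_derived M f x =
     {\<sigma> x | \<sigma>. \<sigma> \<in> sections M f} \<union> {dder \<sigma> x X | \<sigma> X. \<sigma> \<in> sections M f}"

text \<open>For \<open>M\<close> an open subset of the plane this is a Legendre map; for \<open>M\<close> an open interval
  it is the notion of Legendre curve.\<close>

definition legendre_on :: "'a::euclidean_space set \<Rightarrow> ('a \<Rightarrow> R42 set) \<Rightarrow> bool" where
  "legendre_on M f \<longleftrightarrow>
     subbundle_on M 2 f \<and> (\<forall>x\<in>M. f x \<in> null_planes) \<and>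
     (\<forall>x\<in>M. first_derived M f x \<subseteq> lperp (f x)) \<and>
     immersed_on M f"

text \<open>\<open>s1\<close>, \<open>s2\<close> are curvature sphere congruences of \<open>f\<close> with corresponding curvature
  subbundles \<open>T1\<close>, \<open>T2\<close> of the tangent bundle; \<open>f\<close> is umbilic-free iff such data exist.\<close>

definition curvature_spheres_on ::
    "'a::euclidean_space set \<Rightarrow> ('a \<Rightarrow> R42 set) \<Rightarrow> ('a \<Rightarrow> R42 set) \<Rightarrow> ('a \<Rightarrow> R42 set) \<Rightarrow>
     ('a \<Rightarrow> 'a set) \<Rightarrow> ('a \<Rightarrow> 'a set) \<Rightarrow> bool" where
  "curvature_spheres_on M f s1 s2 T1 T2 \<longleftrightarrow>
     subbundle_on M 1 s1 \<and> subbundle_on M 1 s2 \<and>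
     (\<forall>x\<in>M. s1 x \<subseteq> f x \<and> s2 x \<subseteq> f x \<and> s1 x \<inter> s2 x = {0}) \<and>
     subbundle_on M 1 T1 \<and> subbundle_on M 1 T2 \<and>
     (\<forall>\<sigma>\<in>sections M s1. \<forall>X\<in>sections M T1. (\<lambda>x. dder \<sigma> x (X x)) \<in> sections M f) \<and>
     (\<forall>\<sigma>\<in>sections M s2. \<forall>X\<in>sections M T2. (\<lambda>x. dder \<sigma> x (X x)) \<in> sections M f)"

text \<open>Two points lie on the same leaf of \<open>T\<close> iff a curve tangent to \<open>T\<close> joins them.\<close>

definition constant_along_leaves ::
    "'a::euclidean_space set \<Rightarrow> ('a \<Rightarrow> 'a set) \<Rightarrow> ('a \<Rightarrow> 'b set) \<Rightarrow> bool" where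
  "constant_along_leaves M T L \<longleftrightarrow>
     (\<forall>J \<gamma>. open_interval J \<and> smooth_on J \<gamma> \<and> \<gamma> ` J \<subseteq> M \<and>
        (\<forall>t\<in>J. vector_derivative \<gamma> (at t) \<in> T (\<gamma> t)) \<longrightarrow>
        (\<forall>s\<in>J. \<forall>t\<in>J. L (\<gamma> s) = L (\<gamma> t)))"

definition spherical_curvature_lines ::
    "'a::euclidean_space set \<Rightarrow> ('a \<Rightarrow> R42 set) \<Rightarrow> ('a \<Rightarrow> 'a set) \<Rightarrow> bool" where
  "spherical_curvature_lines M f T \<longleftrightarrow>
     (\<exists>L. subbundle_on M 1 L \<and> (\<forall>x\<in>M. L x \<subseteq> lperp (f x) \<and> spacelike (L x)) \<and>
          constant_along_leaves M T L)"


section \<open>Lie applicability\<close>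

text \<open>The element \<open>a \<and> b\<close> as a matrix in \<open>o(4,2)\<close>, acting by \<open>(a \<and> b) c = (a,c) b - (b,c) a\<close>.\<close>

definition wedge :: "R42 \<Rightarrow> R42 \<Rightarrow> real^6^6" where
  "wedge a b = matrix (\<lambda>c. lform a c *\<^sub>R b - lform b c *\<^sub>R a)"

definition wedge_space :: "R42 set \<Rightarrow> R42 set \<Rightarrow> (real^6^6) set" where
  "wedge_space V W = span {wedge a b | a b. a \<in> V \<and> b \<in> W}"

definition one_form_on ::
    "'a::euclidean_space set \<Rightarrow> ('a \<Rightarrow> (real^6^6) set) \<Rightarrow> ('a \<Rightarrow> 'a \<Rightarrow> real^6^6) \<Rightarrow> bool" where
  "one_form_on M E \<eta> \<longleftrightarrow>
     (\<forall>x\<in>M. linear (\<eta> x)) \<and> (\<forall>X. smooth_on M (\<lambda>x. \<eta> x X)) \<and> (\<forall>x\<in>M. \<forall>X. \<eta> x X \<in> E x)"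

text \<open>\<open>d\<eta>(X,Y)\<close> for constant vector fields \<open>X\<close>, \<open>Y\<close> (so that the bracket term vanishes), and
  \<open>[\<eta> \<and> \<eta>](X,Y) = [\<eta>(X),\<eta>(Y)] - [\<eta>(Y),\<eta>(X)]\<close>.\<close>

definition ext_deriv ::
    "('a::euclidean_space \<Rightarrow> 'a \<Rightarrow> real^6^6) \<Rightarrow> 'a \<Rightarrow> 'a \<Rightarrow> 'a \<Rightarrow> real^6^6" where
  "ext_deriv \<eta> x X Y = dder (\<lambda>y. \<eta> y Y) x X - dder (\<lambda>y. \<eta> y X) x Y"

definition commutator :: "real^6^6 \<Rightarrow> real^6^6 \<Rightarrow> real^6^6" where
  "commutator A B = A ** B - B ** A"

definition bracket_wedge ::
    "('a \<Rightarrow> 'a \<Rightarrow> real^6^6) \<Rightarrow> 'a \<Rightarrow> 'a \<Rightarrow> 'a \<Rightarrow> real^6^6" where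
  "bracket_wedge \<eta> x X Y = commutator (\<eta> x X) (\<eta> x Y) - commutator (\<eta> x Y) (\<eta> x X)"

text \<open>Trace of a linear endomorphism \<open>T\<close> of a subspace \<open>V\<close>; it does not depend on the basis.\<close>

definition trace_on :: "'b::euclidean_space set \<Rightarrow> ('b \<Rightarrow> 'b) \<Rightarrow> real" where
  "trace_on V T =
     (let E = (SOME E. independent E \<and> span E = V) in \<Sum>e\<in>E. representation E (T e) e)"

text \<open>If \<open>f\<close> is Legendre and \<open>\<eta>\<close> takes values in \<open>f \<and> lperp f\<close>, then \<open>\<eta>(X) d\<^sub>Y\<sigma>\<close> at \<open>x\<close> lies in
  \<open>f x\<close> and depends only on \<open>\<sigma> x\<close>, because \<open>\<eta>(X)\<close> annihilates \<open>f x\<close>; hence the description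
  is definite.\<close>

definition quad_diff ::
    "'a::euclidean_space set \<Rightarrow> ('a \<Rightarrow> R42 set) \<Rightarrow> ('a \<Rightarrow> 'a \<Rightarrow> real^6^6) \<Rightarrow>
     'a \<Rightarrow> 'a \<Rightarrow> 'a \<Rightarrow> real" where
  "quad_diff M f \<eta> x X Y =
     trace_on (f x) (\<lambda>w. THE z. \<exists>\<sigma>\<in>sections M f. \<sigma> x = w \<and> z = \<eta> x X *v dder \<sigma> x Y)"

text \<open>The tensor \<open>quad_diff\<close> is non-zero in the sense of not vanishing identically.\<close>

definition lie_applicable_on :: "'a::euclidean_space set \<Rightarrow> ('a \<Rightarrow> R42 set) \<Rightarrow> bool" where
  "lie_applicable_on M f \<longleftrightarrow>
     (\<exists>\<eta>. one_form_on M (\<lambda>x. wedge_space (f x) (lperp (f x))) \<eta> \<and>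
        (\<forall>x\<in>M. \<forall>X Y. ext_deriv \<eta> x X Y = 0 \<and> bracket_wedge \<eta> x X Y = 0) \<and>
        (\<exists>x\<in>M. \<exists>X Y. quad_diff M f \<eta> x X Y \<noteq> 0))"


section \<open>Two-dimensional space forms and constrained elastic curves\<close>

definition space_form_vectors :: "R42 set \<Rightarrow> R42 \<Rightarrow> R42 \<Rightarrow> bool" where
  "space_form_vectors L0 p q \<longleftrightarrow>
     p \<in> lperp L0 \<and> q \<in> lperp L0 \<and> \<bar>lform p p\<bar> = 1 \<and> q \<noteq> 0 \<and> lform p q = 0"

definition point_form :: "R42 set \<Rightarrow> R42 \<Rightarrow> R42 \<Rightarrow> R42 set" where
  "point_form L0 p q = {y \<in> light_cone \<inter> lperp L0. lform y q = -1 \<and> lform y p = 0}"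

definition line_form :: "R42 set \<Rightarrow> R42 \<Rightarrow> R42 \<Rightarrow> R42 set" where
  "line_form L0 p q = {y \<in> light_cone \<inter> lperp L0. lform y p = -1 \<and> lform y q = 0}"

text \<open>\<open>C\<close> projects to the regular curve \<open>\<ff>\<close> in the space form, with tangent line
  congruence \<open>\<tt>\<close> and curvature \<open>k\<close>.\<close>

definition projects_to ::
    "real set \<Rightarrow> R42 set \<Rightarrow> R42 \<Rightarrow> R42 \<Rightarrow> (real \<Rightarrow> R42 set) \<Rightarrow>
     (real \<Rightarrow> R42) \<Rightarrow> (real \<Rightarrow> R42) \<Rightarrow> (real \<Rightarrow> real) \<Rightarrow> bool" where
  "projects_to I L0 p q C \<ff> \<tt> k \<longleftrightarrow>
     smooth_on I \<ff> \<and> smooth_on I \<tt> \<and> smooth_on I k \<and>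
     (\<forall>u\<in>I. C u \<inter> point_form L0 p q = {\<ff> u} \<and> C u \<inter> line_form L0 p q = {\<tt> u} \<and>
        lform (vector_derivative \<ff> (at u)) (vector_derivative \<ff> (at u)) > 0 \<and>
        vector_derivative \<tt> (at u) = - k u *\<^sub>R vector_derivative \<ff> (at u))"

definition arclength_deriv :: "(real \<Rightarrow> R42) \<Rightarrow> (real \<Rightarrow> real) \<Rightarrow> real \<Rightarrow> real" where
  "arclength_deriv \<ff> g u =
     deriv g u / sqrt (lform (vector_derivative \<ff> (at u)) (vector_derivative \<ff> (at u)))"

definition constrained_elastic_on ::
    "real set \<Rightarrow> R42 \<Rightarrow> R42 \<Rightarrow> (real \<Rightarrow> R42) \<Rightarrow> (real \<Rightarrow> real) \<Rightarrow> bool" where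
  "constrained_elastic_on I p q \<ff> k \<longleftrightarrow>
     (let chi = - lform p p; kappa = - lform q q in
      \<exists>\<mu> c. \<forall>u\<in>I. arclength_deriv \<ff> (arclength_deriv \<ff> k) u
        + chi * (k u ^ 3 / 2) + (\<mu> + kappa) * k u + c = 0)"

end

theory Submission
  imports Defs
begin

text \<open>Let \<open>l\<close> be the unit spacelike vector perpendicular to \<open>f\<close> that is constant along the \<open>u\<close>-lines,
  and let \<open>c\<close> span the curvature sphere congruence \<open>s1\<close>, scaled such that its second derivative along
  the \<open>u\<close>-lines is a unit vector. The derivative of \<open>f\<close> in direction \<open>v\<close> stays in the span of \<open>f\<close> and
  \<open>l\<close>. Hence the connection that the trivial connection induces on the orthogonal complement of \<open>l\<close>
  preserves \<open>f\<close> along the \<open>v\<close>-lines; as \<open>l\<close> does not depend on \<open>u\<close>, neither does its parallel transport,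
  which therefore maps one \<open>u\<close>-line to another. Concretely, the adapted frame of the curve
  \<open>f(-, v)\<close> satisfies \<open>F\<^sub>v = - (F, l\<^sub>v) l\<close>, and the map that sends the frame at \<open>(u, v)\<close> to the frame at
  \<open>(u, w)\<close> is an isometry independent of \<open>u\<close> (\<open>transport_u_independent\<close>, \<open>congruent_curvature_lines\<close>).
  This avoids solving a differential equation, and does not use Lie applicability.

  Lie applicability enters through the components of \<open>\<eta>\<close> in the frame. Closedness reduces \<open>\<eta>\<close> to two
  functions \<open>Z\<close>, \<open>xi\<close> of \<open>u\<close> alone (and a gauge term), and yields the equation
  \<open>2 Z N''' + 3 Z' N'' + (Z'' - 2 xi) N' - xi' N = 0\<close> for \<open>N = (c, l\<^sub>v)\<close> (\<open>third_order_equation\<close>). The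
  quadratic differential vanishes if \<open>Z\<close> does (\<open>quad_diff_zero\<close>), so \<open>Z\<close> is not identically zero.

  Now fix one curve. Transporting \<open>l\<^sub>v\<close> to it gives vectors \<open>mhat v\<close>, all of whose pairings with \<open>c\<close> solve
  this equation. If they lie in a plane, the \<open>v\<close>-lines are spherical too (\<open>v_independent_normal\<close>), which
  is excluded; so they span the whole three-dimensional solution space. The equation is the symmetric
  square of a second order one: it has a quadratic first integral of indefinite signature. Constancy of
  its Gram determinant shows that \<open>Z\<close> has no zeros (\<open>conic_basis\<close>), and the solutions corresponding to
  isotropic vectors behave like squares, so that the curve runs in a conic \<open>X1\<^sup>2 = X0 X2\<close>. As \<open>s2\<close> is
  immersed, some arc of the conic is avoided (\<open>positive_conic_triple\<close>): there are constant vectors with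
  positive functions \<open>P1\<close>, \<open>J\<close>, \<open>P2\<close> such that \<open>J\<^sup>2 = P1 P2\<close>, and all
  \<open>p1 + 2 s j + s\<^sup>2 p2\<close> with \<open>s \<ge> 0\<close> have positive functions again. Their norm is a quartic polynomial
  in \<open>s\<close>, positive at the values of \<open>s\<close> that correspond to points of the curve, so one of these vectors
  is not null and can serve as \<open>\<pp>\<close>. With \<open>\<qq>\<close> the part of \<open>j\<close> perpendicular to it, \<open>(c, \<qq>) / (c, \<pp>)\<close> is
  the curvature \<open>k\<close> of the projection, and the third vector \<open>E\<close> satisfies \<open>(E, \<ff>) = k\<close>; differentiating this
  twice along arclength is the equation of constrained elastic curves (\<open>elastic_projection\<close>).\<close>

section \<open>Calculus of smooth maps\<close>

lemma Ck_on_Suc_open: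
  assumes "open M"
  shows "Ck_on (Suc k) M F \<longleftrightarrow>
    (\<forall>x\<in>M. F differentiable (at x)) \<and> (\<forall>X. Ck_on k M (\<lambda>x. dder F x X))"
  using assms by (auto simp: differentiable_on_eq_differentiable_at)

lemma Ck_on_cong:
  assumes "open M" "\<And>x. x \<in> M \<Longrightarrow> F x = G x" "Ck_on k M F"
  shows "Ck_on k M G"
  using assms(2,3)
proof (induction k arbitrary: F G)
  case 0
  then show ?case by (simp cong: continuous_on_cong)
next
  case (Suc k)
  have diff: "F differentiable (at x)" if "x \<in> M" for x
    using Suc.prems(2) that assms(1) by (simp add: Ck_on_Suc_open del: Ck_on.simps)
  have G: "(G has_derivative frechet_derivative F (at x)) (at x)" if "x \<in> M" for x
    using has_derivative_transform_within_open[OF _ assms(1) that, of F]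
      diff[OF that] Suc.prems(1) by (simp add: frechet_derivative_works)
  have eq: "frechet_derivative F (at x) = frechet_derivative G (at x)" if "x \<in> M" for x
    using frechet_derivative_at[OF G[OF that]] .
  have "Ck_on k M (\<lambda>x. dder G x X)" for X
    by (rule Suc.IH[of "\<lambda>x. dder F x X"])
      (use Suc.prems(2) eq in auto)
  with G show ?case
    using assms(1) by (auto simp: Ck_on_Suc_open differentiable_def simp del: Ck_on.simps)
qed

text \<open>A map with derivative \<open>F'\<close> on an open set is as smooth as its derivative permits; only the
  values of \<open>F'\<close> on the set matter.\<close>

lemma Ck_on_SucI:
  assumes "open M" "\<And>x. x \<in> M \<Longrightarrow> (F has_derivative F' x) (at x)"
    "\<And>X. Ck_on k M (\<lambda>x. F' x X)"
  shows "Ck_on (Suc k) M F"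
proof -
  have eq: "frechet_derivative F (at x) = F' x" if "x \<in> M" for x
    using frechet_derivative_at[OF assms(2)[OF that]] by simp
  have "Ck_on k M (\<lambda>x. dder F x X)" for X
    by (rule Ck_on_cong[OF assms(1) _ assms(3)[of X]]) (simp add: eq)
  then show ?thesis
    using assms(1,2) by (auto simp: Ck_on_Suc_open differentiable_def simp del: Ck_on.simps)
qed

lemma Ck_on_SucD: "Ck_on (Suc k) M F \<Longrightarrow> Ck_on k M F"
proof (induction k arbitrary: F)
  case 0
  then show ?case by (simp add: differentiable_imp_continuous_on)
next
  case (Suc k)
  then show ?case by (metis Ck_on.simps(2))
qed

lemma Ck_on_has_derivative:
  assumes "open M" "Ck_on (Suc k) M F" "x \<in> M"
  shows "(F has_derivative frechet_derivative F (at x)) (at x)"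
  using assms by (simp add: Ck_on_Suc_open frechet_derivative_works del: Ck_on.simps)

lemma Ck_on_const: "open M \<Longrightarrow> Ck_on k M (\<lambda>x. a)"
  by (induction k arbitrary: a) auto

lemma Ck_on_add:
  assumes "open M" "Ck_on k M F" "Ck_on k M G"
  shows "Ck_on k M (\<lambda>x. F x + G x)"
  using assms(2,3)
proof (induction k arbitrary: F G)
  case 0
  then show ?case by (simp add: continuous_on_add)
next
  case (Suc k)
  show ?case
    by (rule Ck_on_SucI[OF assms(1)
          has_derivative_add[OF Ck_on_has_derivative[OF assms(1) Suc.prems(1)]
            Ck_on_has_derivative[OF assms(1) Suc.prems(2)]]])
       (use Suc in auto)
qed

lemma Ck_on_bounded_linear:
  assumes "open M" "bounded_linear L" "Ck_on k M F"
  shows "Ck_on k M (\<lambda>x. L (F x))"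
  using assms(3)
proof (induction k arbitrary: F)
  case 0
  then show ?case
    using assms(2) by (simp add: bounded_linear.continuous_on)
next
  case (Suc k)
  show ?case
    by (rule Ck_on_SucI[OF assms(1)
          bounded_linear.has_derivative[OF assms(2) Ck_on_has_derivative[OF assms(1) Suc.prems]]])
       (use Suc in auto)
qed

lemma Ck_on_bilinear:
  assumes "open M" "bounded_bilinear B" "Ck_on k M F" "Ck_on k M G"
  shows "Ck_on k M (\<lambda>x. B (F x) (G x))"
  using assms(3,4)
proof (induction k arbitrary: F G)
  case 0
  then show ?case using assms(2) by (simp add: bounded_bilinear.continuous_on)
next
  case (Suc k)
  have "Ck_on k M (\<lambda>x. B (F x) (dder G x X) + B (dder F x X) (G x))" for X
    by (intro Ck_on_add assms(1) Suc.IH) (use Suc.prems Ck_on_SucD in auto)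
  then show ?case
    by (intro Ck_on_SucI[OF assms(1)
          bounded_bilinear.FDERIV[OF assms(2) Ck_on_has_derivative[OF assms(1) Suc.prems(1)]
            Ck_on_has_derivative[OF assms(1) Suc.prems(2)]]])
qed

lemma Ck_on_inverse:
  fixes F :: "'a::euclidean_space \<Rightarrow> real"
  assumes "open M" "Ck_on k M F" "\<And>x. x \<in> M \<Longrightarrow> F x \<noteq> 0"
  shows "Ck_on k M (\<lambda>x. inverse (F x))"
  using assms(2)
proof (induction k)
  case 0
  then show ?case using assms(3) by (simp add: continuous_on_inverse)
next
  case (Suc k)
  note mult = Ck_on_bilinear[OF assms(1) bounded_bilinear_mult]
  have IH: "Ck_on k M (\<lambda>x. inverse (F x))"
    using Suc Ck_on_SucD by blast
  have "Ck_on k M (\<lambda>x. - (inverse (F x) * dder F x X * inverse (F x)))" for X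
    using Ck_on_bounded_linear[OF assms(1) bounded_linear_minus[OF bounded_linear_ident]
        mult[OF mult[OF IH] IH], of "\<lambda>x. dder F x X"] Suc.prems by auto
  then show ?case
    using Ck_on_SucI[OF assms(1) Deriv.has_derivative_inverse[OF assms(3)
        Ck_on_has_derivative[OF assms(1) Suc.prems]]] by blast
qed

lemma Ck_on_sqrt:
  fixes F :: "'a::euclidean_space \<Rightarrow> real"
  assumes "open M" "Ck_on k M F" "\<And>x. x \<in> M \<Longrightarrow> F x > 0"
  shows "Ck_on k M (\<lambda>x. sqrt (F x))"
  using assms(2)
proof (induction k)
  case 0
  then show ?case by (simp add: continuous_on_real_sqrt)
next
  case (Suc k)
  note mult = Ck_on_bilinear[OF assms(1) bounded_bilinear_mult]
  have IH: "Ck_on k M (\<lambda>x. sqrt (F x))"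
    using Suc Ck_on_SucD by blast
  have inv: "Ck_on k M (\<lambda>x. inverse (sqrt (F x)))"
    by (rule Ck_on_inverse[OF assms(1) IH]) (use assms(3) in force)
  have D: "Ck_on k M (\<lambda>x. dder F x X)" for X
    using Suc.prems by simp
  have "Ck_on k M (\<lambda>x. dder F x X * (inverse (sqrt (F x)) / 2))" for X
    by (rule mult[OF D Ck_on_bounded_linear[OF assms(1) bounded_linear_divide inv]])
  moreover have "((\<lambda>x. sqrt (F x)) has_derivative
      (\<lambda>X. dder F x X * (inverse (sqrt (F x)) / 2))) (at x)" if "x \<in> M" for x
    by (rule has_derivative_real_sqrt[OF assms(3)[OF that]
        Ck_on_has_derivative[OF assms(1) Suc.prems that]])
  ultimately show ?case by (rule Ck_on_SucI[OF assms(1), rotated])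
qed

lemma Ck_on_affine:
  assumes "open M" "open N" "bounded_linear L" "\<And>u. u \<in> N \<Longrightarrow> a + L u \<in> M" "Ck_on k M F"
  shows "Ck_on k N (\<lambda>u. F (a + L u))"
  using assms(5)
proof (induction k arbitrary: F)
  case 0
  have "continuous_on N (\<lambda>u. a + L u)"
    using assms(3) by (intro continuous_intros linear_continuous_on)
  with 0 assms(4) show ?case
    by (auto intro: continuous_on_compose2)
next
  case (Suc k)
  have "((\<lambda>u. F (a + L u)) has_derivative (\<lambda>X. dder F (a + L u) (L X))) (at u)"
    if "u \<in> N" for u
  proof -
    have "((\<lambda>u. a + L u) has_derivative L) (at u)"
      using has_derivative_add[OF has_derivative_const bounded_linear_imp_has_derivative[OF assms(3)]]
      by auto
    from diff_chain_at[OF this Ck_on_has_derivative[OF assms(1) Suc.prems assms(4)[OF that]]]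
    show ?thesis by (simp add: o_def)
  qed
  then show ?case
    by (rule Ck_on_SucI[OF assms(2)]) (use Suc in auto)
qed

lemma Ck_on_local:
  assumes "open M" "\<And>x. x \<in> M \<Longrightarrow> \<exists>U. open U \<and> x \<in> U \<and> Ck_on k U F"
  shows "Ck_on k M F"
  using assms(2)
proof (induction k arbitrary: F)
  case 0
  have "isCont F x" if "x \<in> M" for x
    using 0[OF that] by (auto simp: continuous_on_eq_continuous_at)
  then show ?case using assms(1) by (simp add: continuous_on_eq_continuous_at)
next
  case (Suc k)
  have "F differentiable (at x)" if "x \<in> M" for x
    using Suc.prems[OF that] by (auto simp: Ck_on_Suc_open simp del: Ck_on.simps)
  moreover have "Ck_on k M (\<lambda>x. dder F x X)" for X
    by (rule Suc.IH) (use Suc.prems in fastforce)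
  ultimately show ?case using assms(1) by (simp add: Ck_on_Suc_open del: Ck_on.simps)
qed

lemma Ck_on_subset:
  assumes "open M" "U \<subseteq> M" "open U" "Ck_on k M F"
  shows "Ck_on k U F"
  using Ck_on_affine[OF assms(1,3) bounded_linear_ident, of 0 k F] assms by auto

named_theorems smooth_intros

lemma smooth_on_cong:
  "open M \<Longrightarrow> (\<And>x. x \<in> M \<Longrightarrow> F x = G x) \<Longrightarrow> smooth_on M F \<Longrightarrow> smooth_on M G"
  by (auto simp: smooth_on_def intro: Ck_on_cong[of M F G])

lemma smooth_on_const [smooth_intros]: "open M \<Longrightarrow> smooth_on M (\<lambda>x. a)"
  by (simp add: smooth_on_def Ck_on_const)

lemma smooth_on_add [smooth_intros]:
  "open M \<Longrightarrow> smooth_on M F \<Longrightarrow> smooth_on M G \<Longrightarrow> smooth_on M (\<lambda>x. F x + G x)"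
  by (simp add: smooth_on_def Ck_on_add)

lemma smooth_on_bounded_linear:
  "open M \<Longrightarrow> bounded_linear L \<Longrightarrow> smooth_on M F \<Longrightarrow> smooth_on M (\<lambda>x. L (F x))"
  by (simp add: smooth_on_def Ck_on_bounded_linear)

lemma smooth_on_bilinear:
  "open M \<Longrightarrow> bounded_bilinear B \<Longrightarrow> smooth_on M F \<Longrightarrow> smooth_on M G \<Longrightarrow>
    smooth_on M (\<lambda>x. B (F x) (G x))"
  by (simp add: smooth_on_def Ck_on_bilinear)

lemma smooth_on_minus [smooth_intros]:
  "open M \<Longrightarrow> smooth_on M F \<Longrightarrow> smooth_on M (\<lambda>x. - F x)"
  by (rule smooth_on_bounded_linear[OF _ bounded_linear_minus[OF bounded_linear_ident]])

lemma smooth_on_diff [smooth_intros]: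
  "open M \<Longrightarrow> smooth_on M F \<Longrightarrow> smooth_on M G \<Longrightarrow> smooth_on M (\<lambda>x. F x - G x)"
  using smooth_on_add[OF _ _ smooth_on_minus, of M F G] by simp

lemma smooth_on_scaleR [smooth_intros]:
  "open M \<Longrightarrow> smooth_on M F \<Longrightarrow> smooth_on M G \<Longrightarrow> smooth_on M (\<lambda>x. F x *\<^sub>R G x)"
  by (rule smooth_on_bilinear[OF _ bounded_bilinear_scaleR])

lemma smooth_on_mult [smooth_intros]:
  fixes F G :: "'a::euclidean_space \<Rightarrow> real"
  shows "open M \<Longrightarrow> smooth_on M F \<Longrightarrow> smooth_on M G \<Longrightarrow> smooth_on M (\<lambda>x. F x * G x)"
  by (rule smooth_on_bilinear[OF _ bounded_bilinear_mult])

lemma smooth_on_inner [smooth_intros]: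
  fixes F G :: "'a::euclidean_space \<Rightarrow> 'b::euclidean_space"
  shows "open M \<Longrightarrow> smooth_on M F \<Longrightarrow> smooth_on M G \<Longrightarrow> smooth_on M (\<lambda>x. F x \<bullet> G x)"
  by (rule smooth_on_bilinear[OF _ bounded_bilinear_inner])

lemma smooth_on_power2 [smooth_intros]:
  fixes F :: "'a::euclidean_space \<Rightarrow> real"
  shows "open M \<Longrightarrow> smooth_on M F \<Longrightarrow> smooth_on M (\<lambda>x. (F x)\<^sup>2)"
  unfolding power2_eq_square by (rule smooth_on_mult)

lemma smooth_on_inverse [smooth_intros]:
  fixes F :: "'a::euclidean_space \<Rightarrow> real"
  shows "open M \<Longrightarrow> smooth_on M F \<Longrightarrow> (\<And>x. x \<in> M \<Longrightarrow> F x \<noteq> 0) \<Longrightarrow> smooth_on M (\<lambda>x. inverse (F x))"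
  by (simp add: smooth_on_def Ck_on_inverse)

lemma smooth_on_divide [smooth_intros]:
  fixes F G :: "'a::euclidean_space \<Rightarrow> real"
  shows "open M \<Longrightarrow> smooth_on M F \<Longrightarrow> smooth_on M G \<Longrightarrow> (\<And>x. x \<in> M \<Longrightarrow> G x \<noteq> 0) \<Longrightarrow>
    smooth_on M (\<lambda>x. F x / G x)"
  unfolding divide_inverse by (intro smooth_on_mult smooth_on_inverse)

lemma smooth_on_sqrt [smooth_intros]:
  fixes F :: "'a::euclidean_space \<Rightarrow> real"
  shows "open M \<Longrightarrow> smooth_on M F \<Longrightarrow> (\<And>x. x \<in> M \<Longrightarrow> F x > 0) \<Longrightarrow> smooth_on M (\<lambda>x. sqrt (F x))"
  unfolding smooth_on_def using Ck_on_sqrt[of M _ F] by (intro allI) auto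

lemma smooth_on_dder [smooth_intros]: "smooth_on M F \<Longrightarrow> smooth_on M (\<lambda>x. dder F x X)"
  unfolding smooth_on_def
proof
  fix k assume "\<forall>k. Ck_on k M F"
  then have "Ck_on (Suc k) M F" by blast
  then show "Ck_on k M (\<lambda>x. dder F x X)" by simp
qed

lemma smooth_on_affine:
  "open M \<Longrightarrow> open N \<Longrightarrow> bounded_linear L \<Longrightarrow> (\<And>u. u \<in> N \<Longrightarrow> a + L u \<in> M) \<Longrightarrow> smooth_on M F \<Longrightarrow>
    smooth_on N (\<lambda>u. F (a + L u))"
  by (simp add: smooth_on_def Ck_on_affine)

lemma smooth_on_local:
  "open M \<Longrightarrow> (\<And>x. x \<in> M \<Longrightarrow> \<exists>U. open U \<and> x \<in> U \<and> smooth_on U F) \<Longrightarrow> smooth_on M F"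
  unfolding smooth_on_def by (intro allI Ck_on_local) blast+

lemma smooth_on_subset:
  "open M \<Longrightarrow> U \<subseteq> M \<Longrightarrow> open U \<Longrightarrow> smooth_on M F \<Longrightarrow> smooth_on U F"
  by (simp add: smooth_on_def Ck_on_subset[of M])

lemma smooth_on_linear: "open M \<Longrightarrow> bounded_linear L \<Longrightarrow> smooth_on M (\<lambda>x. a + L x)"
proof -
  assume M: "open M" and L: "bounded_linear L"
  have id: "Ck_on k M (\<lambda>x. x)" for k
    using Ck_on_SucI[OF M has_derivative_ident, of "k"] Ck_on_const[OF M] Ck_on_SucD by blast
  then show ?thesis
    using Ck_on_bounded_linear[OF M L id] by (simp add: smooth_on_def Ck_on_add Ck_on_const M)
qed

lemma smooth_on_imp_has_derivative:
  "open M \<Longrightarrow> smooth_on M F \<Longrightarrow> x \<in> M \<Longrightarrow> (F has_derivative frechet_derivative F (at x)) (at x)"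
  using Ck_on_has_derivative[of M 0 F x] by (auto simp: smooth_on_def simp del: Ck_on.simps)

lemma smooth_on_imp_continuous_on: "smooth_on M F \<Longrightarrow> continuous_on M F"
proof -
  assume "smooth_on M F"
  then have "Ck_on 0 M F" unfolding smooth_on_def by blast
  then show ?thesis by simp
qed

subsection \<open>Directional derivatives\<close>

lemma dder_eqI: "(F has_derivative F') (at x) \<Longrightarrow> dder F x X = F' X"
  by (simp add: frechet_derivative_at[of F F' x, symmetric])

lemma dder_cong:
  assumes "open M" "x \<in> M" "\<And>y. y \<in> M \<Longrightarrow> F y = G y" "smooth_on M F"
  shows "dder F x X = dder G x X"
proof -
  have "F differentiable at x"
    using smooth_on_imp_has_derivative[OF assms(1,4,2)] by (auto simp: differentiable_def)
  from frechet_derivative_transform_within_open[OF this assms(1,2)] assms(3) show ?thesis by simp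
qed

lemma dder_linear:
  assumes "open M" "smooth_on M F" "x \<in> M"
  shows "linear (\<lambda>X. dder F x X)"
  using smooth_on_imp_has_derivative[OF assms] has_derivative_linear by blast

lemma dder_zero_on:
  assumes "open M" "x \<in> M" "\<And>y. y \<in> M \<Longrightarrow> F y = a"
  shows "dder F x X = 0"
  using dder_cong[OF assms(1,2), of "\<lambda>_. a" F X] assms(3) smooth_on_const[OF assms(1), of a] by simp

lemma dder_bilinear:
  assumes "open M" "bounded_bilinear B" "smooth_on M F" "smooth_on M G" "x \<in> M"
  shows "dder (\<lambda>x. B (F x) (G x)) x X = B (dder F x X) (G x) + B (F x) (dder G x X)"
  using dder_eqI[OF bounded_bilinear.FDERIV[OF assms(2)
      smooth_on_imp_has_derivative[OF assms(1,3,5)] smooth_on_imp_has_derivative[OF assms(1,4,5)]]]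
  by (simp add: add.commute)

lemma dder_bounded_linear:
  assumes "open M" "bounded_linear L" "smooth_on M F" "x \<in> M"
  shows "dder (\<lambda>x. L (F x)) x X = L (dder F x X)"
  using dder_eqI[OF bounded_linear.has_derivative[OF assms(2)
      smooth_on_imp_has_derivative[OF assms(1,3,4)]]]
  by simp

lemma dder_add:
  assumes "open M" "smooth_on M F" "smooth_on M G" "x \<in> M"
  shows "dder (\<lambda>x. F x + G x) x X = dder F x X + dder G x X"
  using dder_eqI[OF has_derivative_add[OF
      smooth_on_imp_has_derivative[OF assms(1,2,4)] smooth_on_imp_has_derivative[OF assms(1,3,4)]]]
  by simp

lemma dder_diff:
  assumes "open M" "smooth_on M F" "smooth_on M G" "x \<in> M"
  shows "dder (\<lambda>x. F x - G x) x X = dder F x X - dder G x X"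
  using dder_eqI[OF has_derivative_diff[OF
      smooth_on_imp_has_derivative[OF assms(1,2,4)] smooth_on_imp_has_derivative[OF assms(1,3,4)]]]
  by simp

lemma dder_minus:
  assumes "open M" "smooth_on M F" "x \<in> M"
  shows "dder (\<lambda>x. - F x) x X = - dder F x X"
  using dder_bounded_linear[OF assms(1) bounded_linear_minus[OF bounded_linear_ident] assms(2,3)] .

lemma dder_scaleR:
  assumes "open M" "smooth_on M F" "smooth_on M G" "x \<in> M"
  shows "dder (\<lambda>x. F x *\<^sub>R G x) x X = dder F x X *\<^sub>R G x + F x *\<^sub>R dder G x X"
  using dder_bilinear[OF assms(1) bounded_bilinear_scaleR assms(2-4)] .

lemma dder_mult:
  fixes F G :: "'a::euclidean_space \<Rightarrow> real"
  assumes "open M" "smooth_on M F" "smooth_on M G" "x \<in> M"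
  shows "dder (\<lambda>x. F x * G x) x X = dder F x X * G x + F x * dder G x X"
  using dder_bilinear[OF assms(1) bounded_bilinear_mult assms(2-4)] .

lemma dder_affine:
  assumes "open M" "smooth_on M F" "bounded_linear L" "a + L u \<in> M"
  shows "((\<lambda>u. F (a + L u)) has_derivative (\<lambda>X. dder F (a + L u) (L X))) (at u)"
proof -
  have "((\<lambda>u. a + L u) has_derivative L) (at u)"
    using has_derivative_add[OF has_derivative_const bounded_linear_imp_has_derivative[OF assms(3)]]
    by auto
  from diff_chain_at[OF this smooth_on_imp_has_derivative[OF assms(1,2,4)]]
  show ?thesis by (simp add: o_def)
qed

subsection \<open>Partial derivatives in the plane\<close>

text \<open>The partial derivatives in the coordinates \<open>(u, v)\<close>.\<close>

abbreviation pdu :: "(real \<times> real \<Rightarrow> 'b::real_normed_vector) \<Rightarrow> real \<times> real \<Rightarrow> 'b" where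
  "pdu F \<equiv> \<lambda>x. dder F x (1, 0)"

abbreviation pdv :: "(real \<times> real \<Rightarrow> 'b::real_normed_vector) \<Rightarrow> real \<times> real \<Rightarrow> 'b" where
  "pdv F \<equiv> \<lambda>x. dder F x (0, 1)"

lemma dder_eq_pd:
  assumes "open M" "smooth_on M F" "x \<in> M"
  shows "dder F x X = fst X *\<^sub>R pdu F x + snd X *\<^sub>R pdv F x"
proof -
  have X: "X = fst X *\<^sub>R (1, 0) + snd X *\<^sub>R (0, 1)" by (cases X) simp
  show ?thesis
    using dder_linear[OF assms]
    by (subst X) (simp only: linear_add linear_scale)
qed

lemma smooth_on_slice_u:
  fixes N :: "real set" and v :: real
  assumes "open M" "open N" "\<And>u. u \<in> N \<Longrightarrow> (u, v) \<in> M" "smooth_on M F"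
  shows "smooth_on N (\<lambda>u. F (u, v))"
proof -
  have "bounded_linear (\<lambda>u::real. (u, 0::real))"
    by (intro bounded_linear_Pair bounded_linear_ident bounded_linear_zero)
  from smooth_on_affine[OF assms(1,2) this, of "(0, v)" F] assms show ?thesis by simp
qed

lemma slice_u_vector_derivative:
  assumes "open M" "smooth_on M F" "(u, v) \<in> M"
  shows "((\<lambda>u. F (u, v)) has_vector_derivative pdu F (u, v)) (at u)"
proof -
  have scale: "dder F (u, v) (X, 0) = X *\<^sub>R pdu F (u, v)" for X
    using linear_scale[OF dder_linear[OF assms], of X "(1, 0)"] by simp
  have "bounded_linear (\<lambda>u::real. (u, 0::real))"
    by (intro bounded_linear_Pair bounded_linear_ident bounded_linear_zero)
  from dder_affine[OF assms(1,2) this, of "(0, v)" u] assms(3) 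
  have "((\<lambda>u. F (u, v)) has_derivative (\<lambda>X. dder F (u, v) (X, 0))) (at u)" by simp
  then show ?thesis
    unfolding has_vector_derivative_def
    by (rule has_derivative_eq_rhs) (rule ext, rule scale)
qed

lemma slice_v_vector_derivative:
  assumes "open M" "smooth_on M F" "(u, v) \<in> M"
  shows "((\<lambda>v. F (u, v)) has_vector_derivative pdv F (u, v)) (at v)"
proof -
  have scale: "dder F (u, v) (0, X) = X *\<^sub>R pdv F (u, v)" for X
    using linear_scale[OF dder_linear[OF assms], of X "(0, 1)"] by simp
  have "bounded_linear (\<lambda>u::real. (0::real, u))"
    by (intro bounded_linear_Pair bounded_linear_ident bounded_linear_zero)
  from dder_affine[OF assms(1,2) this, of "(u, 0)" v] assms(3) 
  have "((\<lambda>v. F (u, v)) has_derivative (\<lambda>X. dder F (u, v) (0, X))) (at v)" by simp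
  then show ?thesis
    unfolding has_vector_derivative_def
    by (rule has_derivative_eq_rhs) (rule ext, rule scale)
qed

text \<open>Over the box with corners \<open>(a, b)\<close> and \<open>(a + h, b + h)\<close> the second difference of \<open>F\<close> is
  \<open>h\<^sup>2\<close> times a value of either mixed derivative.\<close>

lemma second_difference_vu:
  fixes F :: "real \<times> real \<Rightarrow> real"
  assumes M: "open M" "smooth_on M F" and h: "h > 0"
    and box: "{a..a + h} \<times> {b..b + h} \<subseteq> M"
  obtains y where "y \<in> {a..a + h} \<times> {b..b + h}"
    "F (a + h, b + h) - F (a, b + h) - (F (a + h, b) - F (a, b)) = h\<^sup>2 * pdv (pdu F) y"
proof -
  have du: "((\<lambda>u. F (u, v)) has_real_derivative pdu F (u, v)) (at u)"
    if "(u, v) \<in> M" for u v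
    using slice_u_vector_derivative[OF M that] by (simp add: has_real_derivative_iff_has_vector_derivative)
  have dv: "((\<lambda>v. pdu F (u, v)) has_real_derivative pdv (pdu F) (u, v)) (at v)"
    if "(u, v) \<in> M" for u v
    using slice_v_vector_derivative[OF M(1) smooth_on_dder[OF M(2)] that, of "(1, 0)"]
    by (simp add: has_real_derivative_iff_has_vector_derivative)
  have "((\<lambda>u. F (u, b + h) - F (u, b)) has_real_derivative pdu F (u, b + h) - pdu F (u, b)) (at u)"
    if "a \<le> u" "u \<le> a + h" for u
    by (intro DERIV_diff du) (use that box h in auto)
  from MVT2[OF _ this] h obtain \<xi> where \<xi>: "a < \<xi>" "\<xi> < a + h"
    "F (a + h, b + h) - F (a + h, b) - (F (a, b + h) - F (a, b))
       = h * (pdu F (\<xi>, b + h) - pdu F (\<xi>, b))"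
    by (metis add_diff_cancel_left' less_add_same_cancel1)
  have "((\<lambda>v. pdu F (\<xi>, v)) has_real_derivative pdv (pdu F) (\<xi>, v)) (at v)"
    if "b \<le> v" "v \<le> b + h" for v
    by (rule dv) (use that \<xi> box in auto)
  from MVT2[OF _ this] h obtain \<eta> where \<eta>: "b < \<eta>" "\<eta> < b + h"
    "pdu F (\<xi>, b + h) - pdu F (\<xi>, b) = h * pdv (pdu F) (\<xi>, \<eta>)"
    by (metis add_diff_cancel_left' less_add_same_cancel1)
  show ?thesis
    by (rule that[of "(\<xi>, \<eta>)"]) (use \<xi> \<eta> in \<open>auto simp: power2_eq_square\<close>)
qed

lemma second_difference_uv:
  fixes F :: "real \<times> real \<Rightarrow> real"
  assumes M: "open M" "smooth_on M F" and h: "h > 0"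
    and box: "{a..a + h} \<times> {b..b + h} \<subseteq> M"
  obtains y where "y \<in> {a..a + h} \<times> {b..b + h}"
    "F (a + h, b + h) - F (a, b + h) - (F (a + h, b) - F (a, b)) = h\<^sup>2 * pdu (pdv F) y"
proof -
  have dv: "((\<lambda>v. F (u, v)) has_real_derivative pdv F (u, v)) (at v)"
    if "(u, v) \<in> M" for u v
    using slice_v_vector_derivative[OF M that] by (simp add: has_real_derivative_iff_has_vector_derivative)
  have du: "((\<lambda>u. pdv F (u, v)) has_real_derivative pdu (pdv F) (u, v)) (at u)"
    if "(u, v) \<in> M" for u v
    using slice_u_vector_derivative[OF M(1) smooth_on_dder[OF M(2)] that, of "(0, 1)"]
    by (simp add: has_real_derivative_iff_has_vector_derivative)
  have "((\<lambda>v. F (a + h, v) - F (a, v)) has_real_derivative pdv F (a + h, v) - pdv F (a, v)) (at v)"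
    if "b \<le> v" "v \<le> b + h" for v
    by (intro DERIV_diff dv) (use that box h in auto)
  from MVT2[OF _ this] h obtain \<eta> where \<eta>: "b < \<eta>" "\<eta> < b + h"
    "F (a + h, b + h) - F (a, b + h) - (F (a + h, b) - F (a, b))
       = h * (pdv F (a + h, \<eta>) - pdv F (a, \<eta>))"
    by (metis add_diff_cancel_left' less_add_same_cancel1)
  have "((\<lambda>u. pdv F (u, \<eta>)) has_real_derivative pdu (pdv F) (u, \<eta>)) (at u)"
    if "a \<le> u" "u \<le> a + h" for u
    by (rule du) (use that \<eta> box in auto)
  from MVT2[OF _ this] h obtain \<xi> where \<xi>: "a < \<xi>" "\<xi> < a + h"
    "pdv F (a + h, \<eta>) - pdv F (a, \<eta>) = h * pdu (pdv F) (\<xi>, \<eta>)"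
    by (metis add_diff_cancel_left' less_add_same_cancel1)
  show ?thesis
    by (rule that[of "(\<xi>, \<eta>)"]) (use \<xi> \<eta> in \<open>auto simp: power2_eq_square\<close>)
qed

text \<open>Both mixed derivatives are limits of the second differences of the boxes with corner \<open>x\<close>.\<close>

lemma mixed_derivatives_commute_real:
  fixes F :: "real \<times> real \<Rightarrow> real"
  assumes M: "open M" "smooth_on M F" "x \<in> M"
  shows "pdv (pdu F) x = pdu (pdv F) x"
proof (rule ccontr)
  let ?A = "pdv (pdu F)" and ?B = "pdu (pdv F)"
  assume ne: "?A x \<noteq> ?B x"
  define d where "d = \<bar>?A x - ?B x\<bar> / 2"
  have d: "d > 0" using ne by (simp add: d_def)
  have "smooth_on M ?A" "smooth_on M ?B"
    using M(2) by (intro smooth_on_dder; assumption)+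
  then have "isCont ?A x" "isCont ?B x"
    using smooth_on_imp_continuous_on continuous_on_eq_continuous_at[OF M(1)] M(3) by blast+
  then have lim: "(?A \<longlongrightarrow> ?A x) (nhds x)" "(?B \<longlongrightarrow> ?B x) (nhds x)"
    using tendsto_at_iff_tendsto_nhds[of ?A x] tendsto_at_iff_tendsto_nhds[of ?B x]
    unfolding isCont_def by blast+
  have "\<forall>\<^sub>F y in nhds x. dist (?A y) (?A x) < d \<and> dist (?B y) (?B x) < d \<and> y \<in> M"
    by (intro eventually_conj tendstoD[OF lim(1) d] tendstoD[OF lim(2) d]
        eventually_nhds_in_open[OF M(1,3)])
  then obtain e where e: "e > 0" "\<And>y. dist y x < e \<Longrightarrow> dist (?A y) (?A x) < d \<and> dist (?B y) (?B x) < d \<and> y \<in> M"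
    by (auto simp: eventually_nhds_metric)
  obtain a b where x: "x = (a, b)" by (cases x)
  define h where "h = e / 3"
  have h: "h > 0" using e by (simp add: h_def)
  have box: "dist y x < e" if "y \<in> {a..a + h} \<times> {b..b + h}" for y
  proof -
    obtain p q where y: "y = (p, q)" by (cases y)
    have "dist y x \<le> \<bar>p - a\<bar> + \<bar>q - b\<bar>"
      unfolding y x dist_norm by (simp add: norm_Pair sqrt_sum_squares_le_sum_abs)
    also have "\<dots> \<le> 2 * h" using that by (auto simp: y)
    also have "\<dots> < e" using e by (simp add: h_def)
    finally show ?thesis .
  qed
  then have sub: "{a..a + h} \<times> {b..b + h} \<subseteq> M" using e(2) by blast
  obtain y where y: "y \<in> {a..a + h} \<times> {b..b + h}"
    "F (a + h, b + h) - F (a, b + h) - (F (a + h, b) - F (a, b)) = h\<^sup>2 * ?A y"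
    by (rule second_difference_vu[OF M(1,2) h sub])
  obtain z where z: "z \<in> {a..a + h} \<times> {b..b + h}"
    "F (a + h, b + h) - F (a, b + h) - (F (a + h, b) - F (a, b)) = h\<^sup>2 * ?B z"
    by (rule second_difference_uv[OF M(1,2) h sub])
  have yz: "?A y = ?B z" using y(2) z(2) h by simp
  have "dist (?A y) (?A x) < d" "dist (?A y) (?B x) < d"
    using e(2)[OF box[OF y(1)]] e(2)[OF box[OF z(1)]] by (auto simp: yz)
  then have "dist (?A x) (?B x) < d + d"
    using dist_triangle3[of "?A x" "?B x" "?A y"] by linarith
  then show False by (simp add: d_def dist_real_def)
qed

lemma mixed_derivatives_commute:
  fixes F :: "real \<times> real \<Rightarrow> 'b::euclidean_space"
  assumes M: "open M" "smooth_on M F" "x \<in> M"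
  shows "pdv (pdu F) x = pdu (pdv F) x"
proof (rule euclidean_eqI)
  fix b :: 'b assume "b \<in> Basis"
  note L = bounded_linear_inner_left[of b]
  have eq: "dder (\<lambda>x. dder (\<lambda>x. F x \<bullet> b) x X) x Y = dder (\<lambda>x. dder F x X) x Y \<bullet> b" for X Y
  proof -
    have "dder (\<lambda>x. dder (\<lambda>x. F x \<bullet> b) x X) x Y = dder (\<lambda>x. dder F x X \<bullet> b) x Y"
      by (rule dder_cong[OF M(1,3) dder_bounded_linear[OF M(1) L M(2)]
            smooth_on_dder[OF smooth_on_bounded_linear[OF M(1) L M(2)]]])
    also have "\<dots> = dder (\<lambda>x. dder F x X) x Y \<bullet> b"
      by (rule dder_bounded_linear[OF M(1) L smooth_on_dder[OF M(2)] M(3)])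
    finally show ?thesis .
  qed
  show "pdv (pdu F) x \<bullet> b = pdu (pdv F) x \<bullet> b"
    using mixed_derivatives_commute_real[OF M(1) smooth_on_bounded_linear[OF M(1) L M(2)] M(3)]
    by (simp add: eq)
qed

section \<open>Linear algebra in signature (4,2)\<close>

lemma bounded_bilinear_lform: "bounded_bilinear lform"
proof -
  have "bilinear lform"
    unfolding bilinear_def
    by (auto intro!: linearI simp: lform_def algebra_simps)
  then show ?thesis by (simp add: bilinear_conv_bounded_bilinear)
qed

interpretation lform: bounded_bilinear lform
  by (rule bounded_bilinear_lform)

lemmas lform_simps = lform.add_left lform.add_right lform.diff_left lform.diff_right
  lform.scaleR_left lform.scaleR_right lform.minus_left lform.minus_right
  lform.zero_left lform.zero_right

lemma lform_commute: "lform x y = lform y x"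
  by (simp add: lform_def mult.commute)

lemma exhaust_6:
  fixes x :: 6
  shows "x = 1 \<or> x = 2 \<or> x = 3 \<or> x = 4 \<or> x = 5 \<or> x = 6"
proof (induct x)
  case (of_int z)
  then have "0 \<le> z" and "z < 6" by simp_all
  then have "z = 0 \<or> z = 1 \<or> z = 2 \<or> z = 3 \<or> z = 4 \<or> z = 5" by arith
  then show ?case by auto
qed

lemma R42_eqI:
  fixes x y :: R42
  assumes "x$1 = y$1" "x$2 = y$2" "x$3 = y$3" "x$4 = y$4" "x$5 = y$5" "x$6 = y$6"
  shows "x = y"
proof -
  have "x $ i = y $ i" for i
    using exhaust_6[of i] by (elim disjE) (simp_all only: assms)
  then show ?thesis by (simp add: vec_eq_iff)
qed

lemma lform_spacelike_part:
  assumes "y$5 = 0" "y$6 = 0" "lform y y \<le> 0"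
  shows "y = 0"
proof -
  have "y$1 * y$1 + y$2 * y$2 + y$3 * y$3 + y$4 * y$4 \<le> 0"
    using assms by (simp add: lform_def)
  then have "y$1 * y$1 = 0 \<and> y$2 * y$2 = 0 \<and> y$3 * y$3 = 0 \<and> y$4 * y$4 = 0"
    using zero_le_square[of "y$1"] zero_le_square[of "y$2"] zero_le_square[of "y$3"]
      zero_le_square[of "y$4"] by linarith
  then show ?thesis using assms by (intro R42_eqI) simp_all
qed

subsection \<open>Lines and planes\<close>

text \<open>Linear independence of two vectors as a statement on coefficients; unlike \<open>independent {a, b}\<close>
  it excludes \<open>a = b\<close>.\<close>

definition indep2 :: "'a::real_vector \<Rightarrow> 'a \<Rightarrow> bool" where
  "indep2 a b \<longleftrightarrow> (\<forall>s t. s *\<^sub>R a + t *\<^sub>R b = 0 \<longrightarrow> s = 0 \<and> t = 0)"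

lemma indep2_iff: "indep2 a b \<longleftrightarrow> independent {a, b} \<and> a \<noteq> b"
proof
  assume i: "indep2 a b"
  have "a \<noteq> b" using i[unfolded indep2_def, rule_format, of 1 "-1"] by auto
  moreover have "b \<noteq> 0" using i[unfolded indep2_def, rule_format, of 0 1] by auto
  moreover have "a \<notin> span {b}"
  proof
    assume "a \<in> span {b}"
    then obtain k where "a = k *\<^sub>R b" by (auto simp: span_singleton)
    then show False using i[unfolded indep2_def, rule_format, of 1 "-k"] by simp
  qed
  ultimately show "independent {a, b} \<and> a \<noteq> b"
    by (simp add: independent_insert)
next
  assume i: "independent {a, b} \<and> a \<noteq> b"
  then have a: "a \<notin> span {b}" and b: "b \<noteq> 0"
    by (auto simp: independent_insert dependent_single)
  show "indep2 a b"
    unfolding indep2_def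
  proof (intro allI impI)
    fix s t assume st: "s *\<^sub>R a + t *\<^sub>R b = 0"
    have "s = 0"
    proof (rule ccontr)
      assume "s \<noteq> 0"
      from st have "s *\<^sub>R a = (- t) *\<^sub>R b" by (simp add: eq_neg_iff_add_eq_0)
      then have "inverse s *\<^sub>R s *\<^sub>R a = (inverse s * (- t)) *\<^sub>R b" by simp
      then have "a = (inverse s * (- t)) *\<^sub>R b" using \<open>s \<noteq> 0\<close> by simp
      with a show False by (metis rangeI span_singleton)
    qed
    with st b show "s = 0 \<and> t = 0" by simp
  qed
qed

lemma in_span2: "x \<in> span {a, b} \<longleftrightarrow> (\<exists>s t. x = s *\<^sub>R a + t *\<^sub>R b)"
proof
  assume "x \<in> span {a, b}"
  then obtain k where "x - k *\<^sub>R a \<in> span {b}" using span_breakdown_eq by blast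
  then obtain t where "x - k *\<^sub>R a = t *\<^sub>R b" by (auto simp: span_singleton)
  then show "\<exists>s t. x = s *\<^sub>R a + t *\<^sub>R b" by (metis add.commute diff_add_cancel)
next
  assume "\<exists>s t. x = s *\<^sub>R a + t *\<^sub>R b"
  then show "x \<in> span {a, b}" by (auto intro!: span_add span_scale intro: span_base)
qed

lemma plane_eq_span:
  fixes V :: "'a::euclidean_space set"
  assumes "subspace V" "dim V = 2" "a \<in> V" "b \<in> V" "indep2 a b"
  shows "V = span {a, b}"
proof -
  have i: "independent {a, b}" "a \<noteq> b" using assms(5) by (auto simp: indep2_iff)
  have "dim (span {a, b}) = 2"
    using i by (simp add: dim_span_eq_card_independent del: dim_span)
  moreover have "span {a, b} \<subseteq> V"
    using assms by (intro span_minimal) auto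
  ultimately show ?thesis
    using subspace_dim_equal[OF subspace_span assms(1), of "{a, b}"] assms(2) by simp
qed

lemma plane_basis:
  fixes V :: "'a::euclidean_space set"
  assumes "subspace V" "dim V = 2"
  obtains a b where "indep2 a b" "V = span {a, b}"
proof -
  obtain B where B: "B \<subseteq> V" "independent B" "V \<subseteq> span B" "card B = dim V"
    using basis_exists by blast
  then obtain a b where ab: "B = {a, b}" "a \<noteq> b" using assms(2) by (auto simp: card_2_iff)
  then have "indep2 a b" using B by (simp add: indep2_iff)
  moreover have "V = span {a, b}"
    using B ab by (intro plane_eq_span[OF assms]) (auto simp: indep2_iff)
  ultimately show ?thesis using that by blast
qed

lemma line_eq_span:
  fixes V :: "'a::euclidean_space set"
  assumes "subspace V" "dim V = 1" "a \<in> V" "a \<noteq> 0"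
  shows "V = span {a}"
proof -
  have "dim (span {a}) = 1" using assms(4) by simp
  moreover have "span {a} \<subseteq> V" using assms by (intro span_minimal) auto
  ultimately show ?thesis
    using subspace_dim_equal[OF subspace_span assms(1), of "{a}"] assms(2) by simp
qed

lemma null_planes_D:
  assumes "V \<in> null_planes"
  shows "subspace V" "dim V = 2" "\<And>a b. a \<in> V \<Longrightarrow> b \<in> V \<Longrightarrow> lform a b = 0"
  using assms by (auto simp: null_planes_def)

lemma in_lperp_span2: "x \<in> lperp (span {a, b}) \<longleftrightarrow> lform a x = 0 \<and> lform b x = 0"
proof
  assume "x \<in> lperp (span {a, b})"
  then show "lform a x = 0 \<and> lform b x = 0" by (simp add: lperp_def span_base)
next
  assume "lform a x = 0 \<and> lform b x = 0"
  then show "x \<in> lperp (span {a, b})" by (auto simp: lperp_def in_span2 lform_simps)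
qed

text \<open>A null plane projects isomorphically onto the negative definite coordinate plane;
  consequently the quotient of its orthogonal complement by it is positive definite.\<close>

lemma null_plane_det:
  assumes V: "V \<in> null_planes" and ab: "a \<in> V" "b \<in> V" "indep2 a b"
  shows "a$5 * b$6 - a$6 * b$5 \<noteq> 0"
proof
  note VD = null_planes_D[OF V]
  have nz: "v = 0" if "v \<in> V" "v$5 = 0" "v$6 = 0" for v
    using lform_spacelike_part[OF that(2,3)] VD(3)[OF that(1,1)] by simp
  have comb: "s *\<^sub>R a + t *\<^sub>R b \<in> V" for s t
    using VD(1) ab by (intro subspace_add subspace_scale)
  assume D0: "a$5 * b$6 - a$6 * b$5 = 0"
  have "b$6 *\<^sub>R a + (- a$6) *\<^sub>R b = 0" "b$5 *\<^sub>R a + (- a$5) *\<^sub>R b = 0"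
    using D0 by (intro nz comb; simp add: algebra_simps)+
  then have "b$6 = 0 \<and> - a$6 = 0" "b$5 = 0 \<and> - a$5 = 0"
    using ab(3) unfolding indep2_def by blast+
  then have "a = 0" by (intro nz ab) auto
  then show False using ab(3)[unfolded indep2_def, rule_format, of 1 0] by simp
qed

lemma null_plane_perp_pos:
  assumes V: "V \<in> null_planes" and y: "y \<in> lperp V" "lform y y \<le> 0"
  shows "y \<in> V"
proof -
  note VD = null_planes_D[OF V]
  obtain a b where ab: "indep2 a b" "V = span {a, b}" using plane_basis[OF VD(1,2)] .
  have inV: "a \<in> V" "b \<in> V" by (simp_all add: ab(2) span_base)
  define D where "D = a$5 * b$6 - a$6 * b$5"
  have D: "D \<noteq> 0" unfolding D_def by (rule null_plane_det[OF V inV ab(1)])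
  \<comment> \<open>The element of \<open>V\<close> with the same negative coordinates as \<open>y\<close>.\<close>
  define w where "w = ((y$5 * b$6 - y$6 * b$5) / D) *\<^sub>R a + ((a$5 * y$6 - a$6 * y$5) / D) *\<^sub>R b"
  have w: "w \<in> V" unfolding w_def by (intro subspace_add subspace_scale VD(1) inV)
  have w5: "w$5 = y$5" and w6: "w$6 = y$6"
    using D by (simp_all add: w_def field_simps) (simp_all add: D_def algebra_simps)
  have "lform w y = 0" using y(1) w by (simp add: lperp_def)
  then have "lform (y - w) (y - w) \<le> 0"
    using VD(3)[OF w w] y(2) by (simp add: lform_simps lform_commute[of y w])
  then have "y - w = 0" by (intro lform_spacelike_part) (simp_all add: w5 w6)
  then show ?thesis using w by simp
qed

subsection \<open>Adapted frames\<close>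

text \<open>The frame of a Legendre curve \<open>span {a0, a1}\<close> in the orthogonal complement of the unit
  spacelike vector \<open>l\<close>: \<open>a0, a4\<close> and \<open>a1, a3\<close> are dual pairs of null vectors up to sign, \<open>a2\<close>
  and \<open>l\<close> are unit vectors.\<close>

definition lie_frame :: "R42 \<Rightarrow> R42 \<Rightarrow> R42 \<Rightarrow> R42 \<Rightarrow> R42 \<Rightarrow> R42 \<Rightarrow> bool" where
  "lie_frame a0 a1 a2 a3 a4 l \<longleftrightarrow>
     lform a0 a0 = 0 \<and> lform a0 a1 = 0 \<and> lform a0 a2 = 0 \<and> lform a0 a3 = 0 \<and> lform a0 a4 = 1 \<and>
     lform a1 a1 = 0 \<and> lform a1 a2 = 0 \<and> lform a1 a3 = -1 \<and> lform a1 a4 = 0 \<and>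
     lform a2 a2 = 1 \<and> lform a2 a3 = 0 \<and> lform a2 a4 = 0 \<and>
     lform a3 a3 = 0 \<and> lform a3 a4 = 0 \<and> lform a4 a4 = 0 \<and>
     lform a0 l = 0 \<and> lform a1 l = 0 \<and> lform a2 l = 0 \<and> lform a3 l = 0 \<and> lform a4 l = 0 \<and>
     lform l l = 1"

lemma lie_frame_gram:
  assumes "lie_frame a0 a1 a2 a3 a4 l"
  shows "lform a0 a0 = 0" "lform a0 a1 = 0" "lform a0 a2 = 0" "lform a0 a3 = 0" "lform a0 a4 = 1"
    "lform a0 l = 0"
    "lform a1 a0 = 0" "lform a1 a1 = 0" "lform a1 a2 = 0" "lform a1 a3 = -1" "lform a1 a4 = 0"
    "lform a1 l = 0"
    "lform a2 a0 = 0" "lform a2 a1 = 0" "lform a2 a2 = 1" "lform a2 a3 = 0" "lform a2 a4 = 0"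
    "lform a2 l = 0"
    "lform a3 a0 = 0" "lform a3 a1 = -1" "lform a3 a2 = 0" "lform a3 a3 = 0" "lform a3 a4 = 0"
    "lform a3 l = 0"
    "lform a4 a0 = 1" "lform a4 a1 = 0" "lform a4 a2 = 0" "lform a4 a3 = 0" "lform a4 a4 = 0"
    "lform a4 l = 0"
    "lform l a0 = 0" "lform l a1 = 0" "lform l a2 = 0" "lform l a3 = 0" "lform l a4 = 0"
    "lform l l = 1"
  using assms by (auto simp: lie_frame_def lform_commute)

text \<open>The map from coefficients to vectors is injective by the Gram relations, hence onto.\<close>

lemma lie_frame_expand:
  assumes "lie_frame a0 a1 a2 a3 a4 l"
  shows "y = lform y a4 *\<^sub>R a0 + lform y a0 *\<^sub>R a4 - lform y a3 *\<^sub>R a1 - lform y a1 *\<^sub>R a3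
    + lform y a2 *\<^sub>R a2 + lform y l *\<^sub>R l"
proof -
  note g = lie_frame_gram[OF assms]
  define T :: "R42 \<Rightarrow> R42" where
    "T = (\<lambda>x. x$1 *\<^sub>R a0 + x$2 *\<^sub>R a1 + x$3 *\<^sub>R a2 + x$4 *\<^sub>R a3 + x$5 *\<^sub>R a4 + x$6 *\<^sub>R l)"
  have lin: "linear T" by (rule linearI) (simp_all add: T_def algebra_simps)
  have co: "lform (T x) a4 = x$1" "lform (T x) a3 = - x$2" "lform (T x) a2 = x$3"
    "lform (T x) a1 = - x$4" "lform (T x) a0 = x$5" "lform (T x) l = x$6" for x
    by (simp_all add: T_def lform_simps g)
  have "inj T"
    using lin
  proof (subst linear_injective_0, simp, intro allI impI)
    fix x assume "T x = 0"
    then show "x = 0" using co[of x] by (intro R42_eqI) (simp_all add: lform_simps)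
  qed
  then have "surj T" using lin linear_injective_imp_surjective by blast
  then obtain x where x: "y = T x" by blast
  have "y = x$1 *\<^sub>R a0 + x$2 *\<^sub>R a1 + x$3 *\<^sub>R a2 + x$4 *\<^sub>R a3 + x$5 *\<^sub>R a4 + x$6 *\<^sub>R l"
    by (simp add: x T_def)
  then show ?thesis using co[of x, folded x] by (simp add: algebra_simps)
qed

lemma lie_frame_zero:
  assumes "lie_frame a0 a1 a2 a3 a4 l"
    "lform y a0 = 0" "lform y a1 = 0" "lform y a2 = 0" "lform y a3 = 0" "lform y a4 = 0" "lform y l = 0"
  shows "y = 0"
  using lie_frame_expand[OF assms(1), of y] assms(2-) by simp

section \<open>Legendre curves that project to constrained elastic curves\<close>

lemma open_interval_constant:
  assumes "open_interval I" "\<And>u. u \<in> I \<Longrightarrow> (F has_vector_derivative 0) (at u)" "a \<in> I" "b \<in> I"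
  shows "F a = F b"
proof -
  have "convex I" using assms(1) by (simp add: open_interval_def is_interval_convex)
  then obtain c where "\<And>u. u \<in> I \<Longrightarrow> F u = c"
    using has_vector_derivative_zero_constant[of I F] assms(2)
    by (metis has_vector_derivative_at_within)
  then show ?thesis using assms by simp
qed

lemma open_interval_sign:
  fixes F :: "real \<Rightarrow> real"
  assumes "open_interval I" "continuous_on I F" "\<And>u. u \<in> I \<Longrightarrow> F u \<noteq> 0"
  obtains s where "s = 1 \<or> s = -1" "\<And>u. u \<in> I \<Longrightarrow> s * F u > 0"
proof -
  have "connected (F ` I)"
    using assms by (auto simp: open_interval_def is_interval_connected intro: connected_continuous_image)
  then have iv: "is_interval (F ` I)" by (simp add: is_interval_connected_1)
  have z: "0 \<notin> F ` I" using assms(3) by auto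
  have "(\<forall>u\<in>I. F u > 0) \<or> (\<forall>u\<in>I. F u < 0)"
  proof (rule ccontr)
    assume "\<not> ?thesis"
    then obtain a b where "a \<in> I" "b \<in> I" "F a < 0" "F b > 0"
      using assms(3) by (metis linorder_neqE_linordered_idom)
    with iv z show False
      unfolding is_interval_1 by (metis image_eqI less_imp_le)
  qed
  then show ?thesis using that[of 1] that[of "-1"] by auto
qed

lemma lform_vector_derivative_const:
  assumes "open I" "u \<in> I" "(F has_vector_derivative F') (at u)" "(G has_vector_derivative G') (at u)"
    "\<And>w. w \<in> I \<Longrightarrow> lform (F w) (G w) = c"
  shows "lform F' (G u) + lform (F u) G' = 0"
proof -
  have "((\<lambda>u. lform (F u) (G u)) has_vector_derivative lform (F u) G' + lform F' (G u)) (at u)"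
    by (rule lform.has_vector_derivative[OF assms(3,4)])
  moreover have "((\<lambda>u. lform (F u) (G u)) has_vector_derivative 0) (at u)"
    by (rule has_vector_derivative_transform_within_open[OF has_vector_derivative_const assms(1,2)])
       (simp add: assms(5))
  ultimately show ?thesis
    using vector_derivative_unique_at by fastforce
qed

text \<open>A Legendre curve \<open>span {e0, e1}\<close> with its adapted frame; \<open>e0\<close> spans the curvature sphere
  congruence and is scaled such that its second derivative \<open>e2\<close> is a unit vector. With this scaling
  the curve has two invariants \<open>g\<close> and \<open>r\<close>, which occur in the structure equations.\<close>

locale contact_curve =
  fixes I :: "real set" and e0 e1 e2 e3 e4 :: "real \<Rightarrow> R42" and l :: R42 and g r :: "real \<Rightarrow> real"
  assumes I: "open_interval I"
    and smooth: "smooth_on I e0" "smooth_on I e1" "smooth_on I e2"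
    and frame: "u \<in> I \<Longrightarrow> lie_frame (e0 u) (e1 u) (e2 u) (e3 u) (e4 u) l"
    and d0: "u \<in> I \<Longrightarrow> (e0 has_vector_derivative e1 u) (at u)"
    and d1: "u \<in> I \<Longrightarrow> (e1 has_vector_derivative e2 u) (at u)"
    and d2: "u \<in> I \<Longrightarrow> (e2 has_vector_derivative e3 u - (g u / 2) *\<^sub>R e1 u) (at u)"
    and d3: "u \<in> I \<Longrightarrow> (e3 has_vector_derivative e4 u - (g u / 2) *\<^sub>R e2 u - r u *\<^sub>R e0 u) (at u)"
begin

lemma open_I: "open I"
  using I by (simp add: open_interval_def)

lemma pair_derivs:
  assumes "u \<in> I"
  shows "((\<lambda>u. lform (e0 u) w) has_real_derivative lform (e1 u) w) (at u)"
    "((\<lambda>u. lform (e1 u) w) has_real_derivative lform (e2 u) w) (at u)"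
    "((\<lambda>u. lform (e2 u) w) has_real_derivative lform (e3 u) w - g u / 2 * lform (e1 u) w) (at u)"
    "((\<lambda>u. lform (e3 u) w) has_real_derivative
        lform (e4 u) w - g u / 2 * lform (e2 u) w - r u * lform (e0 u) w) (at u)"
  using lform.has_vector_derivative[OF d0[OF assms] has_vector_derivative_const, of w]
    lform.has_vector_derivative[OF d1[OF assms] has_vector_derivative_const, of w]
    lform.has_vector_derivative[OF d2[OF assms] has_vector_derivative_const, of w]
    lform.has_vector_derivative[OF d3[OF assms] has_vector_derivative_const, of w]
  by (simp_all add: has_real_derivative_iff_has_vector_derivative lform_simps)

lemma smooth_pair:
  "smooth_on I (\<lambda>u. lform (e0 u) w)" "smooth_on I (\<lambda>u. lform (e1 u) w)" "smooth_on I (\<lambda>u. lform (e2 u) w)"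
  using smooth smooth_on_bounded_linear[OF open_I lform.bounded_linear_left] by blast+

lemma continuous_pair: "continuous_on I (\<lambda>u. lform (e0 u) w)"
  by (rule smooth_on_imp_continuous_on[OF smooth_pair(1)])

text \<open>For a constant vector \<open>w\<close> let \<open>W u = lform (e0 u) w\<close>. If three constant vectors have functions
  \<open>P\<close>, \<open>J\<close>, \<open>R\<close> with \<open>P > 0\<close>, \<open>J\<^sup>2 = P R\<close> and \<open>J / P\<close> immersed, and \<open>p\<close> is a unit vector, then the
  curve projects to a constrained elastic curve in the space form of \<open>p\<close> and the part \<open>q\<close> of \<open>j\<close>
  perpendicular to \<open>p\<close>. Its curvature is \<open>k = Q / P\<close>: the section \<open>- e0 / P\<close> of the curvature spheres
  equals \<open>\<tt> + k \<ff>\<close>.\<close>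

lemma elastic_projection:
  assumes perp: "lform p l = 0" "lform j l = 0" "lform p2 l = 0"
    and pos: "\<And>u. u \<in> I \<Longrightarrow> lform (e0 u) p > 0"
    and conic: "\<And>u. u \<in> I \<Longrightarrow> (lform (e0 u) j)\<^sup>2 = lform (e0 u) p * lform (e0 u) p2"
    and immersed: "\<And>u. u \<in> I \<Longrightarrow>
      lform (e0 u) p * lform (e1 u) j - lform (e0 u) j * lform (e1 u) p \<noteq> 0"
    and unit: "\<bar>lform p p\<bar> = 1"
  shows "\<exists>p q \<ff> \<tt> k. space_form_vectors (span {l}) p q \<and>
    projects_to I (span {l}) p q (\<lambda>u. span {e0 u, e1 u}) \<ff> \<tt> k \<and> constrained_elastic_on I p q \<ff> k"
proof -
  define a where "a = lform j p / lform p p"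
  define q where "q = j - a *\<^sub>R p"
  \<comment> \<open>The conic relation makes \<open>k\<^sup>2 / 2\<close> the pairing of \<open>E\<close> with \<open>- e0 / P\<close>; differentiating, \<open>E\<close> pairs
    with \<open>\<ff>\<close> to \<open>k\<close> and with \<open>\<tt>\<close> to \<open>- k\<^sup>2 / 2\<close>.\<close>
  define E where "E = (- 1/2) *\<^sub>R (p2 - (2 * a) *\<^sub>R j + a\<^sup>2 *\<^sub>R p)"
  have pp: "lform p p \<noteq> 0" using unit by auto
  have pq: "lform p q = 0" "lform q p = 0"
    using pp by (simp_all add: q_def a_def lform_simps lform_commute[of p j])
  have ql: "lform q l = 0" and El: "lform E l = 0" using perp by (simp_all add: q_def E_def lform_simps)
  define P P1 P2 where "P = (\<lambda>u. lform (e0 u) p)" and "P1 = (\<lambda>u. lform (e1 u) p)" and "P2 = (\<lambda>u. lform (e2 u) p)"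
  define Q Q1 Q2 where "Q = (\<lambda>u. lform (e0 u) q)" and "Q1 = (\<lambda>u. lform (e1 u) q)" and "Q2 = (\<lambda>u. lform (e2 u) q)"
  note PQ = P_def P1_def P2_def Q_def Q1_def Q2_def
  define \<delta> \<delta>1 where "\<delta> = (\<lambda>u. Q1 u * P u - Q u * P1 u)" and "\<delta>1 = (\<lambda>u. Q2 u * P u - Q u * P2 u)"
  have Ppos: "P u > 0" if "u \<in> I" for u using pos[OF that] by (simp add: P_def)
  have \<delta>: "\<delta> u \<noteq> 0" if "u \<in> I" for u
    using immersed[OF that] by (simp add: \<delta>_def PQ q_def lform_simps algebra_simps)
  have dP: "(P has_real_derivative P1 u) (at u)" "(P1 has_real_derivative P2 u) (at u)"
    "(Q has_real_derivative Q1 u) (at u)" "(Q1 has_real_derivative Q2 u) (at u)" if "u \<in> I" for u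
    unfolding PQ using pair_derivs[OF that] by auto
  have d\<delta>: "(\<delta> has_real_derivative \<delta>1 u) (at u)" if "u \<in> I" for u
    unfolding \<delta>_def \<delta>1_def
    by (rule derivative_eq_intros dP[OF that] refl)+ (simp add: algebra_simps)
  define k where "k = (\<lambda>u. Q u / P u)"
  define F where "F = (\<lambda>u. P u *\<^sub>R e1 u - P1 u *\<^sub>R e0 u)"
  define \<ff> where "\<ff> = (\<lambda>u. (- 1 / \<delta> u) *\<^sub>R F u)"
  define \<tt> where "\<tt> = (\<lambda>u. (- 1 / P u) *\<^sub>R e0 u - k u *\<^sub>R \<ff> u)"
  \<comment> \<open>The unit tangent of \<open>\<ff>\<close>, up to the sign of \<open>- \<delta>\<close>.\<close>
  define T where "T = (\<lambda>u. e2 u - (P2 u / P u) *\<^sub>R e0 u - (\<delta>1 u / (\<delta> u * P u)) *\<^sub>R F u)"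

  have nz: "P u \<noteq> 0" if "u \<in> I" for u using Ppos[OF that] by simp
  have smPQ: "smooth_on I P" "smooth_on I P1" "smooth_on I P2" "smooth_on I Q" "smooth_on I Q1" "smooth_on I Q2"
    unfolding PQ by (rule smooth_pair)+
  have sm\<delta>: "smooth_on I \<delta>" "smooth_on I \<delta>1"
    unfolding \<delta>_def \<delta>1_def by (intro smooth_intros open_I smPQ)+
  have smk: "smooth_on I k"
    unfolding k_def by (rule smooth_on_divide[OF open_I smPQ(4,1) nz])
  have smF: "smooth_on I F"
    unfolding F_def by (intro smooth_intros open_I smPQ smooth)
  have smf: "smooth_on I \<ff>"
    unfolding \<ff>_def
    by (rule smooth_on_scaleR[OF open_I smooth_on_divide[OF open_I smooth_on_const[OF open_I] sm\<delta>(1) \<delta>] smF])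
  have smt: "smooth_on I \<tt>"
    unfolding \<tt>_def
    by (intro smooth_on_diff smooth_on_scaleR open_I smk smf smooth
        smooth_on_divide[OF open_I smooth_on_const[OF open_I] smPQ(1) nz])
  have nz2: "\<delta> u * P u \<noteq> 0" if "u \<in> I" for u using nz[OF that] \<delta>[OF that] by simp
  have smT: "smooth_on I T"
    unfolding T_def
    by (intro smooth_on_diff smooth_on_scaleR open_I smF smooth
        smooth_on_divide[OF open_I smPQ(3,1) nz]
        smooth_on_divide[OF open_I sm\<delta>(2) smooth_on_mult[OF open_I sm\<delta>(1) smPQ(1)] nz2])

  have dk: "(k has_real_derivative \<delta> u / (P u)\<^sup>2) (at u)" if "u \<in> I" for u
    unfolding k_def
    by (rule derivative_eq_intros dP[OF that] nz[OF that] refl)+ (simp add: \<delta>_def power2_eq_square)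
  have dF: "(F has_vector_derivative P u *\<^sub>R e2 u - P2 u *\<^sub>R e0 u) (at u)" if "u \<in> I" for u
    unfolding F_def
    by (rule has_vector_derivative_eq_rhs[OF has_vector_derivative_diff[OF
            has_vector_derivative_scaleR[OF dP(1)[OF that] d1[OF that]]
            has_vector_derivative_scaleR[OF dP(2)[OF that] d0[OF that]]]])
       (simp add: algebra_simps)
  have df: "(\<ff> has_vector_derivative (- (P u / \<delta> u)) *\<^sub>R T u) (at u)" if "u \<in> I" for u
  proof -
    have "((\<lambda>u. - 1 / \<delta> u) has_real_derivative \<delta>1 u / (\<delta> u)\<^sup>2) (at u)"
      by (rule derivative_eq_intros d\<delta>[OF that] \<delta>[OF that] refl)+ (simp add: power2_eq_square)
    note has_vector_derivative_scaleR[OF this dF[OF that]]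
    moreover have "(- 1 / \<delta> u) *\<^sub>R (P u *\<^sub>R e2 u - P2 u *\<^sub>R e0 u) + (\<delta>1 u / (\<delta> u)\<^sup>2) *\<^sub>R F u
        = (- (P u / \<delta> u)) *\<^sub>R T u"
      using nz[OF that] \<delta>[OF that]
      by (simp add: T_def scaleR_diff_right power2_eq_square)
    ultimately show ?thesis unfolding \<ff>_def by simp
  qed
  have dt: "(\<tt> has_vector_derivative (- k u) *\<^sub>R ((- (P u / \<delta> u)) *\<^sub>R T u)) (at u)" if "u \<in> I" for u
  proof -
    have "((\<lambda>u. - 1 / P u) has_real_derivative P1 u / (P u)\<^sup>2) (at u)"
      by (rule derivative_eq_intros dP[OF that] nz[OF that] refl)+ (simp add: power2_eq_square)
    note has_vector_derivative_diff[OF has_vector_derivative_scaleR[OF this d0[OF that]]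
        has_vector_derivative_scaleR[OF dk[OF that] df[OF that]]]
    moreover have "(- 1 / P u) *\<^sub>R e1 u + (P1 u / (P u)\<^sup>2) *\<^sub>R e0 u - (\<delta> u / (P u)\<^sup>2) *\<^sub>R \<ff> u = 0"
      using nz[OF that] \<delta>[OF that]
      by (simp add: \<ff>_def F_def scaleR_diff_right power2_eq_square)
    ultimately show ?thesis unfolding \<tt>_def
      by (simp add: algebra_simps)
  qed
  define chi kappa where "chi = - lform p p" and "kappa = - lform q q"
  define R0 R1 where "R0 = (\<lambda>u. lform (e0 u) E)" and "R1 = (\<lambda>u. lform (e1 u) E)"

  have gram: "lform (e0 u) (e0 u) = 0" "lform (e0 u) (e1 u) = 0" "lform (e1 u) (e0 u) = 0"
    "lform (e1 u) (e1 u) = 0" "lform (e0 u) (e2 u) = 0" "lform (e2 u) (e0 u) = 0"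
    "lform (e1 u) (e2 u) = 0" "lform (e2 u) (e1 u) = 0" "lform (e2 u) (e2 u) = 1"
    "lform (e0 u) l = 0" "lform (e1 u) l = 0" "lform (e2 u) l = 0" if "u \<in> I" for u
    using lie_frame_gram[OF frame[OF that]] by auto
  have R0: "R0 u = - (Q u)\<^sup>2 / (2 * P u)" if "u \<in> I" for u
  proof -
    have "P u * R0 u = - (Q u)\<^sup>2 / 2"
      using conic[OF that]
      by (simp add: R0_def PQ E_def q_def lform_simps power2_eq_square algebra_simps)
    then show ?thesis using nz[OF that] by (simp add: field_simps)
  qed
  have R1: "P u * R1 u + P1 u * R0 u = - Q u * Q1 u" if "u \<in> I" for u
  proof -
    have "((\<lambda>u. P u * R0 u) has_real_derivative P u * R1 u + P1 u * R0 u) (at u)"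
      unfolding R0_def R1_def
      by (rule derivative_eq_intros dP[OF that] pair_derivs[OF that] refl)+ simp
    moreover have "((\<lambda>u. - (Q u * Q u) / 2) has_real_derivative - Q u * Q1 u) (at u)"
      by (rule derivative_eq_intros dP[OF that] refl)+ (simp_all add: field_simps)
    then have "((\<lambda>u. P u * R0 u) has_real_derivative - Q u * Q1 u) (at u)"
      by (rule has_field_derivative_transform_within_open[OF _ open_I that])
         (use R0 nz in \<open>simp add: field_simps power2_eq_square\<close>)
    ultimately show ?thesis by (rule DERIV_unique)
  qed

  have Fp: "lform (F u) p = 0" "lform (F u) q = \<delta> u" "lform (F u) E = P u * R1 u - P1 u * R0 u" for u
    by (simp_all add: F_def \<delta>_def PQ R0_def R1_def lform_simps)
  have Fe: "lform (F u) (e0 u) = 0" "lform (F u) (e1 u) = 0" "lform (F u) (e2 u) = 0"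
    "lform (F u) (F u) = 0" "lform (F u) l = 0"
    "lform (e0 u) (F u) = 0" "lform (e1 u) (F u) = 0" "lform (e2 u) (F u) = 0" if "u \<in> I" for u
    by (simp_all add: F_def lform_simps gram[OF that])
  have Te: "lform (T u) (e0 u) = 0" "lform (T u) (e1 u) = 0" "lform (T u) (F u) = 0"
    "lform (T u) (T u) = 1" "lform (T u) l = 0" if "u \<in> I" for u
    by (simp_all add: T_def lform_simps gram[OF that] Fe[OF that])
  have Tp: "lform (T u) p = 0" if "u \<in> I" for u
    using nz[OF that] by (simp add: T_def lform_simps Fp) (simp add: PQ)
  have Tq: "lform (T u) q = 0" if "u \<in> I" for u
  proof -
    have "lform (T u) q = Q2 u - (P2 u / P u) * Q u - (\<delta>1 u / (\<delta> u * P u)) * \<delta> u"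
      by (simp add: T_def lform_simps Fp) (simp add: PQ)
    also have "\<dots> = 0"
      using nz[OF that] \<delta>[OF that] by (simp add: field_simps) (simp add: \<delta>1_def algebra_simps)
    finally show ?thesis .
  qed
  have fp: "lform (\<ff> u) p = 0" "lform (\<ff> u) q = -1" "lform (\<ff> u) E = k u"
    "lform (\<tt> u) p = -1" "lform (\<tt> u) q = 0" "lform (\<tt> u) E = - (k u)\<^sup>2 / 2" if "u \<in> I" for u
  proof -
    show 1: "lform (\<ff> u) p = 0" "lform (\<ff> u) q = -1"
      using \<delta>[OF that] by (simp_all add: \<ff>_def lform_simps Fp)
    have "lform (\<ff> u) E = (- 1 / \<delta> u) * (- Q u * Q1 u - 2 * P1 u * R0 u)"
      using R1[OF that] by (simp add: \<ff>_def lform_simps Fp)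
    also have "\<dots> = k u"
      using nz[OF that] \<delta>[OF that] unfolding R0[OF that] k_def
      by (simp add: field_simps) (simp add: \<delta>_def algebra_simps power2_eq_square)
    finally show 2: "lform (\<ff> u) E = k u" .
    have e: "lform (e0 u) p = P u" "lform (e0 u) q = Q u" "lform (e0 u) E = R0 u"
      by (simp_all add: PQ R0_def)
    show "lform (\<tt> u) p = -1" "lform (\<tt> u) q = 0"
      using nz[OF that] by (simp_all add: \<tt>_def lform_simps 1 e) (simp add: k_def)
    show "lform (\<tt> u) E = - (k u)\<^sup>2 / 2"
      using nz[OF that] by (simp add: \<tt>_def lform_simps 2 e R0[OF that])
        (simp add: k_def power2_eq_square field_simps)
  qed
  have fe: "lform (\<ff> u) (T u) = 0" "lform (T u) (\<ff> u) = 0" "lform (\<tt> u) (T u) = 0" "lform (T u) (\<tt> u) = 0"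
    "lform (\<ff> u) l = 0" "lform (\<tt> u) l = 0" "lform (\<ff> u) (\<ff> u) = 0" "lform (\<tt> u) (\<tt> u) = 0"
    "lform (\<ff> u) (\<tt> u) = 0" "lform (\<tt> u) (\<ff> u) = 0" if "u \<in> I" for u
    by (simp_all add: \<ff>_def \<tt>_def lform_simps Te[OF that] Fe[OF that] gram[OF that]
        lform_commute[of _ "T u"])
  have TE: "lform (T u) E = - ((\<delta> u)\<^sup>2 / (P u) ^ 3)" if "u \<in> I" for u
  proof -
    have "((\<lambda>u. lform (\<ff> u) E) has_real_derivative - (P u / \<delta> u) * lform (T u) E) (at u)"
      using lform.has_vector_derivative[OF df[OF that] has_vector_derivative_const, of E]
      by (simp add: has_real_derivative_iff_has_vector_derivative lform_simps)
    moreover have "((\<lambda>u. lform (\<ff> u) E) has_real_derivative \<delta> u / (P u)\<^sup>2) (at u)"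
      by (rule has_field_derivative_transform_within_open[OF dk[OF that] open_I that]) (simp add: fp)
    ultimately have "- (P u / \<delta> u) * lform (T u) E = \<delta> u / (P u)\<^sup>2" by (rule DERIV_unique)
    then show ?thesis
      using nz[OF that] \<delta>[OF that] by (simp add: field_simps power2_eq_square power3_eq_cube)
  qed

  define T' where "T' = (\<lambda>u. vector_derivative T (at u))"
  have dT: "(T has_vector_derivative T' u) (at u)" if "u \<in> I" for u
    using smooth_on_imp_has_derivative[OF open_I smT that]
    unfolding T'_def by (metis differentiableI vector_derivative_works)

  \<comment> \<open>The derivative of \<open>T\<close> with respect to the arclength whose orientation makes \<open>T\<close> the derivative of
    \<open>\<ff>\<close>. Both sides have the same pairings with \<open>\<ff>\<close>, \<open>\<tt>\<close>, \<open>T\<close>, \<open>p\<close>, \<open>q\<close>, \<open>l\<close>, which span the space.\<close>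
  have Frenet: "(- (\<delta> u / P u)) *\<^sub>R T' u = (- kappa) *\<^sub>R \<ff> u + (chi * k u) *\<^sub>R \<tt> u - k u *\<^sub>R p + q"
    if u: "u \<in> I" for u
  proof -
    note const = lform_vector_derivative_const[OF open_I u dT[OF u]]
    have "lform (T' u) (\<ff> u) + lform (T u) ((- (P u / \<delta> u)) *\<^sub>R T u) = 0"
      by (rule const[OF df[OF u]]) (rule fe)
    then have T1: "lform (T' u) (\<ff> u) = P u / \<delta> u" using Te[OF u] by (simp add: lform_simps)
    have "lform (T' u) (\<tt> u) + lform (T u) ((- k u) *\<^sub>R ((- (P u / \<delta> u)) *\<^sub>R T u)) = 0"
      by (rule const[OF dt[OF u]]) (rule fe)
    then have T2: "lform (T' u) (\<tt> u) = - k u * (P u / \<delta> u)" using Te[OF u] by (simp add: lform_simps)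
    have T3: "lform (T' u) p = 0" "lform (T' u) q = 0" "lform (T' u) l = 0"
      using const[OF has_vector_derivative_const, of p 0] const[OF has_vector_derivative_const, of q 0]
        const[OF has_vector_derivative_const, of l 0] Tp Tq Te by (simp_all add: lform_simps)
    have "lform (T' u) (T u) + lform (T u) (T' u) = 0"
      by (rule const[OF dT[OF u]]) (rule Te)
    then have T4: "lform (T' u) (T u) = 0" by (simp add: lform_commute)
    define y where "y = (- (\<delta> u / P u)) *\<^sub>R T' u + kappa *\<^sub>R \<ff> u - (chi * k u) *\<^sub>R \<tt> u + k u *\<^sub>R p - q"
    note simps = y_def lform_simps T1 T2 T3 T4 fp[OF u] fe[OF u] Tp[OF u] Tq[OF u] pq perp ql
      lform_commute[of p "\<ff> u"] lform_commute[of q "\<ff> u"] lform_commute[of p "\<tt> u"]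
      lform_commute[of q "\<tt> u"] lform_commute[of p "T u"] lform_commute[of q "T u"]
    have yf: "lform y (\<ff> u) = 0" "lform y (\<tt> u) = 0"
      using nz[OF u] \<delta>[OF u] by (simp_all add: simps)
    have yp: "lform y p = 0" "lform y q = 0"
      by (simp_all add: simps chi_def kappa_def)
    have yT: "lform y (T u) = 0" "lform y l = 0" by (simp_all add: simps)
    have "e0 u = (- P u) *\<^sub>R (\<tt> u + k u *\<^sub>R \<ff> u)"
      using nz[OF u] by (simp add: \<tt>_def)
    then have ye0: "lform y (e0 u) = 0" by (simp add: lform_simps yf)
    have "F u = (- \<delta> u) *\<^sub>R \<ff> u" using \<delta>[OF u] by (simp add: \<ff>_def)
    then have yF: "lform y (F u) = 0" by (simp add: lform_simps yf)
    then have ye1: "lform y (e1 u) = 0"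
      using nz[OF u] ye0 by (simp add: F_def lform_simps)
    have ye2: "lform y (e2 u) = 0"
      using yT(1) by (simp add: T_def lform_simps ye0 yF)
    define s t where "s = lform y (e4 u)" and "t = - lform y (e3 u)"
    have y: "y = s *\<^sub>R e0 u + t *\<^sub>R e1 u"
      using lie_frame_expand[OF frame[OF u], of y] by (simp add: ye0 ye1 ye2 yT s_def t_def)
    have st: "s * P u + t * P1 u = 0" "s * Q u + t * Q1 u = 0"
      using yp by (simp_all add: y lform_simps PQ)
    have "t * \<delta> u = 0" "s * \<delta> u = 0"
      using st by (simp_all add: \<delta>_def, algebra+)
    then have "y = 0" using \<delta>[OF u] y by simp
    then show ?thesis by (simp add: y_def algebra_simps)
  qed

  have speed: "sqrt (lform (vector_derivative \<ff> (at u)) (vector_derivative \<ff> (at u))) = P u / \<bar>\<delta> u\<bar>"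
    if "u \<in> I" for u
  proof -
    have "lform (vector_derivative \<ff> (at u)) (vector_derivative \<ff> (at u)) = (P u / \<delta> u)\<^sup>2"
      using vector_derivative_at[OF df[OF that]] Te[OF that] by (simp add: lform_simps power2_eq_square)
    then show ?thesis using Ppos[OF that] by simp
  qed
  \<comment> \<open>The orientation is the same along the curve, and cancels in second derivatives.\<close>
  obtain \<epsilon> where \<epsilon>: "\<epsilon> = 1 \<or> \<epsilon> = -1" "\<And>u. u \<in> I \<Longrightarrow> \<epsilon> * \<delta> u > 0"
    using open_interval_sign[OF I smooth_on_imp_continuous_on[OF sm\<delta>(1)] \<delta>] by blast
  have abs\<delta>: "\<bar>\<delta> u\<bar> = \<epsilon> * \<delta> u" if "u \<in> I" for u
    using \<epsilon>(2)[OF that] \<epsilon>(1) by (auto simp: abs_if)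
  have ks: "arclength_deriv \<ff> k u = - \<epsilon> * lform (T u) E" if "u \<in> I" for u
    using nz[OF that] \<delta>[OF that] \<epsilon>(1)
    unfolding arclength_deriv_def speed[OF that] DERIV_imp_deriv[OF dk[OF that]] abs\<delta>[OF that] TE[OF that]
    by (auto simp: field_simps power2_eq_square power3_eq_cube)
  have kss: "arclength_deriv \<ff> (arclength_deriv \<ff> k) u = - (\<delta> u / P u) * lform (T' u) E"
    if "u \<in> I" for u
  proof -
    have "((\<lambda>u. - \<epsilon> * lform (T u) E) has_real_derivative - \<epsilon> * lform (T' u) E) (at u)"
      using has_vector_derivative_mult_right[OF
          lform.has_vector_derivative[OF dT[OF that] has_vector_derivative_const, of E], of "- \<epsilon>"]
      by (simp add: has_real_derivative_iff_has_vector_derivative lform_simps)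
    then have "(arclength_deriv \<ff> k has_real_derivative - \<epsilon> * lform (T' u) E) (at u)"
      by (rule has_field_derivative_transform_within_open[OF _ open_I that]) (simp add: ks)
    then have "deriv (arclength_deriv \<ff> k) u = - \<epsilon> * lform (T' u) E" by (rule DERIV_imp_deriv)
    then have "arclength_deriv \<ff> (arclength_deriv \<ff> k) u = - \<epsilon> * lform (T' u) E / (P u / (\<epsilon> * \<delta> u))"
      unfolding arclength_deriv_def[of \<ff> "arclength_deriv \<ff> k"] speed[OF that] abs\<delta>[OF that] by simp
    then show ?thesis using \<epsilon>(1) by auto
  qed
  have elastic: "arclength_deriv \<ff> (arclength_deriv \<ff> k) u + chi * (k u ^ 3 / 2)
      + (lform p E + kappa) * k u + (- lform q E) = 0" if "u \<in> I" for u
  proof -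
    have "- (\<delta> u / P u) * lform (T' u) E
        = lform ((- kappa) *\<^sub>R \<ff> u + (chi * k u) *\<^sub>R \<tt> u - k u *\<^sub>R p + q) E"
      unfolding Frenet[OF that, symmetric] by (simp add: lform_simps)
    also have "\<dots> = - kappa * k u - chi * k u * ((k u)\<^sup>2 / 2) - k u * lform p E + lform q E"
      by (simp add: lform_simps fp[OF that])
    finally show ?thesis
      unfolding kss[OF that] by (simp add: algebra_simps power2_eq_square power3_eq_cube)
  qed

  have meet: "y = z"
    if u: "u \<in> I" and y: "y \<in> span {e0 u, e1 u}" "z \<in> span {e0 u, e1 u}"
      and eq: "lform y p = lform z p" "lform y q = lform z q" for u y z
  proof -
    have "y - z \<in> span {e0 u, e1 u}" using y by (rule span_diff)
    then obtain s t where yz: "y - z = s *\<^sub>R e0 u + t *\<^sub>R e1 u" by (auto simp: in_span2)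
    have "lform (y - z) p = 0" "lform (y - z) q = 0" using eq by (simp_all add: lform_simps)
    then have st: "s * P u + t * P1 u = 0" "s * Q u + t * Q1 u = 0"
      unfolding yz by (simp_all add: lform_simps PQ)
    have "t * \<delta> u = 0" "s * \<delta> u = 0"
      using st by (simp_all add: \<delta>_def, algebra+)
    then have "y - z = 0" using \<delta>[OF u] yz by simp
    then show ?thesis by simp
  qed
  have fC: "\<ff> u \<in> span {e0 u, e1 u}" "\<tt> u \<in> span {e0 u, e1 u}" for u
    unfolding \<ff>_def \<tt>_def F_def
    by (auto intro!: span_diff span_scale span_neg intro: span_base)
  have lperp_l: "y \<in> lperp (span {l}) \<longleftrightarrow> lform y l = 0" for y
    by (auto simp: lperp_def span_singleton lform_simps lform_commute[of l])
  have points: "span {e0 u, e1 u} \<inter> point_form (span {l}) p q = {\<ff> u}"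
    "span {e0 u, e1 u} \<inter> line_form (span {l}) p q = {\<tt> u}" if "u \<in> I" for u
    using meet[OF that _ fC(1)] meet[OF that _ fC(2)] fC fp[OF that] fe[OF that]
    by (auto simp: point_form_def line_form_def light_cone_def lperp_l)
  have q0: "q \<noteq> 0"
  proof
    assume "q = 0"
    moreover obtain u where "u \<in> I" using I by (auto simp: open_interval_def)
    ultimately show False using fp(2)[of u] by (simp add: lform_simps)
  qed
  have "space_form_vectors (span {l}) p q"
    using unit q0 perp ql pq by (simp add: space_form_vectors_def lperp_l)
  moreover have "projects_to I (span {l}) p q (\<lambda>u. span {e0 u, e1 u}) \<ff> \<tt> k"
    unfolding projects_to_def
  proof (intro conjI ballI smf smt smk points; assumption?)
    fix u assume u: "u \<in> I"
    have "sqrt (lform (vector_derivative \<ff> (at u)) (vector_derivative \<ff> (at u))) > 0"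
      using speed[OF u] Ppos[OF u] \<delta>[OF u] by simp
    then show "lform (vector_derivative \<ff> (at u)) (vector_derivative \<ff> (at u)) > 0" by simp
    show "vector_derivative \<tt> (at u) = - k u *\<^sub>R vector_derivative \<ff> (at u)"
      using vector_derivative_at[OF df[OF u]] vector_derivative_at[OF dt[OF u]] by simp
  qed
  moreover have "constrained_elastic_on I p q \<ff> k"
    unfolding constrained_elastic_on_def Let_def
    using elastic unfolding chi_def kappa_def by blast
  ultimately show ?thesis by blast
qed

end

subsection \<open>Binary quadratic forms\<close>

text \<open>Binary forms are written \<open>\<alpha> x\<^sup>2 + 2 \<beta> x y + \<gamma> y\<^sup>2\<close>; an indefinite form is the product of two independent
  linear forms \<open>a1 x + b1 y\<close> and \<open>a2 x + b2 y\<close>.\<close>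

lemma indefinite_form_factors:
  fixes \<alpha> \<beta> \<gamma> :: real
  assumes "\<beta>\<^sup>2 - \<alpha> * \<gamma> > 0"
  obtains a1 b1 a2 b2 where "a1 * b2 - a2 * b1 \<noteq> 0"
    "\<alpha> = a1 * a2" "2 * \<beta> = a1 * b2 + a2 * b1" "\<gamma> = b1 * b2"
proof (cases "\<alpha> = 0")
  case True
  then have "\<beta> \<noteq> 0" using assms by auto
  then show ?thesis using True by (intro that[of 0 \<gamma> "2 * \<beta>" 1]) auto
next
  case False
  define s where "s = sqrt (\<beta>\<^sup>2 - \<alpha> * \<gamma>)"
  have s: "s > 0" "s * s = \<beta>\<^sup>2 - \<alpha> * \<gamma>" using assms by (simp_all add: s_def)
  show ?thesis
  proof (rule that[of \<alpha> "(\<beta> - s) / \<alpha>" 1 "\<beta> + s"])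
    show "\<alpha> * ((\<beta> - s) / \<alpha>) - 1 * (\<beta> + s) \<noteq> 0" using False s by simp
    show "2 * \<beta> = \<alpha> * ((\<beta> - s) / \<alpha>) + 1 * (\<beta> + s)" using False by simp
    have "(\<beta> + s) * (\<beta> - s) = \<alpha> * \<gamma>" using s(2) by (simp add: algebra_simps power2_eq_square)
    then show "\<gamma> = (\<beta> + s) * ((\<beta> - s) / \<alpha>)" using False by (simp add: field_simps)
  qed simp
qed

text \<open>A form with vanishing discriminant is the square of a linear form up to sign.\<close>

lemma degenerate_form_square:
  fixes \<alpha> \<beta> \<gamma> :: real
  assumes "\<beta>\<^sup>2 - \<alpha> * \<gamma> = 0"
  obtains e a b where "e = 1 \<or> e = -1" "\<alpha> = e * a\<^sup>2" "\<beta> = e * (a * b)" "\<gamma> = e * b\<^sup>2"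
proof (cases "\<alpha> = 0")
  case True
  then have "\<beta> = 0" using assms by simp
  then show ?thesis
    using True by (intro that[of "if \<gamma> < 0 then -1 else 1" 0 "sqrt \<bar>\<gamma>\<bar>"]) auto
next
  case False
  define e where "e = sgn \<alpha>"
  define a where "a = sqrt \<bar>\<alpha>\<bar>"
  have e: "e = 1 \<or> e = -1" "e * e = 1" using False by (auto simp: e_def sgn_if)
  have a: "a \<noteq> 0" "a\<^sup>2 = e * \<alpha>" using False by (auto simp: a_def e_def sgn_if)
  have ea: "e * a\<^sup>2 = \<alpha>" using e(2) a(2) by (metis mult.assoc mult_1)
  show ?thesis
  proof (rule that[OF e(1), of a "e * \<beta> / a"])
    show "\<alpha> = e * a\<^sup>2" using ea by simp
    show "\<beta> = e * (a * (e * \<beta> / a))" using e a(1) by auto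
    have "e * (e * \<beta> / a)\<^sup>2 = e * (e * e) * \<beta>\<^sup>2 / a\<^sup>2" by (simp add: power2_eq_square)
    also have "\<dots> = e * \<beta>\<^sup>2 / (e * \<alpha>)" using e(2) a(2) by simp
    also have "\<dots> = \<gamma>" using e(1) False assms by (auto simp: field_simps)
    finally show "\<gamma> = e * (e * \<beta> / a)\<^sup>2" by simp
  qed
qed

text \<open>The Jacobian of a definite form and another form is indefinite unless it vanishes.\<close>

lemma jacobian_form_indefinite:
  fixes \<alpha> \<beta> \<gamma> \<alpha>' \<beta>' \<gamma>' :: real
  defines "A \<equiv> \<alpha> * \<beta>' - \<beta> * \<alpha>'" and "B \<equiv> \<alpha> * \<gamma>' - \<gamma> * \<alpha>'" and "C \<equiv> \<beta> * \<gamma>' - \<gamma> * \<beta>'"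
  assumes def: "\<beta>\<^sup>2 - \<alpha> * \<gamma> < 0" and nz: "\<not> (A = 0 \<and> B = 0 \<and> C = 0)"
  shows "(B / 2)\<^sup>2 - A * C > 0"
proof -
  have \<alpha>: "\<alpha> \<noteq> 0" using def by (auto simp: not_less)
  have aC: "\<alpha> * C = \<beta> * B - \<gamma> * A" by (simp add: A_def B_def C_def algebra_simps)
  have AB: "A \<noteq> 0 \<or> \<alpha> * B - 2 * A * \<beta> \<noteq> 0"
    using nz aC \<alpha> by auto
  have "4 * \<alpha>\<^sup>2 * ((B / 2)\<^sup>2 - A * C) = \<alpha>\<^sup>2 * B\<^sup>2 - 4 * \<alpha> * A * (\<alpha> * C)"
    by (simp add: power2_eq_square algebra_simps)
  also have "\<dots> = (\<alpha> * B - 2 * A * \<beta>)\<^sup>2 + 4 * A\<^sup>2 * (\<alpha> * \<gamma> - \<beta>\<^sup>2)"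
    unfolding aC by (simp add: power2_eq_square algebra_simps)
  also have "\<dots> > 0"
  proof (cases "A = 0")
    case True
    then show ?thesis using AB by simp
  next
    case False
    then have "4 * A\<^sup>2 * (\<alpha> * \<gamma> - \<beta>\<^sup>2) > 0" using def by simp
    then show ?thesis using zero_le_power2[of "\<alpha> * B - 2 * A * \<beta>"] by linarith
  qed
  finally have "0 < 4 * \<alpha>\<^sup>2 * ((B / 2)\<^sup>2 - A * C)" .
  then show ?thesis using \<alpha> by (simp add: zero_less_mult_iff not_less)
qed

text \<open>A quartic polynomial that vanishes at \<open>0, \<dots>, 4\<close> vanishes identically.\<close>

lemma quartic_nonzero_nonneg:
  fixes a b c d e s :: real
  assumes "a + b * s + c * s^2 + d * s^3 + e * s^4 \<noteq> 0"
  shows "\<exists>t\<ge>0. a + b * t + c * t^2 + d * t^3 + e * t^4 \<noteq> 0"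
proof (rule ccontr)
  assume "\<not> ?thesis"
  then have z: "a + b * t + c * t^2 + d * t^3 + e * t^4 = 0" if "t \<ge> 0" for t using that by blast
  have "a = 0" "b = 0" "c = 0" "d = 0" "e = 0"
    using z[of 0] z[of 1] z[of 2] z[of 3] z[of 4] by simp_all
  with assms show False by simp
qed

text \<open>The determinant of the matrix with rows \<open>a\<close>, \<open>b\<close>, \<open>c\<close>, written out, so that it can be expanded
  at once.\<close>

definition det3 :: "real \<Rightarrow> real \<Rightarrow> real \<Rightarrow> real \<Rightarrow> real \<Rightarrow> real \<Rightarrow> real \<Rightarrow> real \<Rightarrow> real \<Rightarrow> real" where
  "det3 a0 a1 a2 b0 b1 b2 c0 c1 c2 =
     a0 * (b1 * c2 - b2 * c1) - a1 * (b0 * c2 - b2 * c0) + a2 * (b0 * c1 - b1 * c0)"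

text \<open>Multiplicativity for the product with a transposed matrix, that is, for the matrix of pairings of
  two triples.\<close>

lemma det3_gram:
  "det3 (y0*a0 + y1*a1 + y2*a2) (y0*b0 + y1*b1 + y2*b2) (y0*c0 + y1*c1 + y2*c2)
        (z0*a0 + z1*a1 + z2*a2) (z0*b0 + z1*b1 + z2*b2) (z0*c0 + z1*c1 + z2*c2)
        (w0*a0 + w1*a1 + w2*a2) (w0*b0 + w1*b1 + w2*b2) (w0*c0 + w1*c1 + w2*c2)
   = det3 y0 y1 y2 z0 z1 z2 w0 w1 w2 * det3 a0 a1 a2 b0 b1 b2 c0 c1 c2"
  by (simp add: det3_def algebra_simps)

lemma det3_combine:
  "det3 (y0*a0 + y1*b0 + y2*c0) (y0*a1 + y1*b1 + y2*c1) (y0*a2 + y1*b2 + y2*c2)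
        (z0*a0 + z1*b0 + z2*c0) (z0*a1 + z1*b1 + z2*c1) (z0*a2 + z1*b2 + z2*c2)
        (w0*a0 + w1*b0 + w2*c0) (w0*a1 + w1*b1 + w2*c1) (w0*a2 + w1*b2 + w2*c2)
   = det3 y0 y1 y2 z0 z1 z2 w0 w1 w2 * det3 a0 a1 a2 b0 b1 b2 c0 c1 c2"
  by (simp add: det3_def algebra_simps)

text \<open>The determinant of the symmetric square of a linear map of the plane.\<close>

lemma det3_symmetric_square:
  "det3 (a1\<^sup>2) (2*a1*b1) (b1\<^sup>2) (a1*a2) (a1*b2 + a2*b1) (b1*b2) (a2\<^sup>2) (2*a2*b2) (b2\<^sup>2)
   = (a1*b2 - a2*b1) ^ 3"
  unfolding det3_def by algebra

lemma det3_symmetric_product: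
  "det3 (z*a2 + h*a1 - x*a0) (h*a0 - z*a1) (z*a0) (z*b2 + h*b1 - x*b0) (h*b0 - z*b1) (z*b0)
     (z*c2 + h*c1 - x*c0) (h*c0 - z*c1) (z*c0) = det3 a0 a1 a2 b0 b1 b2 c0 c1 c2 * z ^ 3"
  by (simp add: det3_def algebra_simps power3_eq_cube)

lemma det3_kernel:
  assumes "r*a0 + s*a1 + t*a2 = 0" "r*b0 + s*b1 + t*b2 = 0" "r*c0 + s*c1 + t*c2 = 0"
  shows "t * det3 a0 a1 a2 b0 b1 b2 c0 c1 c2 = 0"
  using assms unfolding det3_def by algebra

subsection \<open>Curves satisfying a third order equation\<close>

text \<open>For a vector \<open>w\<close> perpendicular to \<open>l\<close> let \<open>N u = lform (e0 u) w\<close>. Orthogonality of \<open>w\<close> to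
  \<open>\<Omega>\<close> is the equation \<open>2 Z N''' + 3 Z' N'' + (Z'' - 2 x) N' - x' N = 0\<close>; the
  term with \<open>g\<close> stems from \<open>N''' = lform (e3 u) w - g / 2 * N'\<close>. The vectors with this property form \<open>W\<close>.\<close>

locale applicable_profile = contact_curve +
  fixes Z Z1 Z2 x x1 :: "real \<Rightarrow> real"
  assumes dZ: "u \<in> I \<Longrightarrow> (Z has_real_derivative Z1 u) (at u)"
    and dZ1: "u \<in> I \<Longrightarrow> (Z1 has_real_derivative Z2 u) (at u)"
    and dx: "u \<in> I \<Longrightarrow> (x has_real_derivative x1 u) (at u)"
    and diff: "u \<in> I \<Longrightarrow> Z2 differentiable (at u)" "u \<in> I \<Longrightarrow> x1 differentiable (at u)"
      "u \<in> I \<Longrightarrow> g differentiable (at u)"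
begin

definition \<Omega> :: "real \<Rightarrow> R42" where
  "\<Omega> u = (2 * Z u) *\<^sub>R e3 u + (3 * Z1 u) *\<^sub>R e2 u + (Z2 u - 2 * x u - g u * Z u) *\<^sub>R e1 u - x1 u *\<^sub>R e0 u"

definition W :: "R42 set" where
  "W = {w. lform w l = 0 \<and> (\<forall>u\<in>I. lform (\<Omega> u) w = 0)}"

lemma W_add: "v \<in> W \<Longrightarrow> w \<in> W \<Longrightarrow> v + w \<in> W"
  and W_scale: "w \<in> W \<Longrightarrow> s *\<^sub>R w \<in> W"
  and W_diff: "v \<in> W \<Longrightarrow> w \<in> W \<Longrightarrow> v - w \<in> W"
  by (simp_all add: W_def lform_simps)

lemma W_equation:
  assumes "w \<in> W" "u \<in> I"
  shows "2 * Z u * lform (e3 u) w + 3 * Z1 u * lform (e2 u) w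
    + (Z2 u - 2 * x u - g u * Z u) * lform (e1 u) w - x1 u * lform (e0 u) w = 0"
  using assms by (simp add: W_def \<Omega>_def lform_simps)

text \<open>Uniqueness of solutions with vanishing initial data. No theory of differential equations is needed:
  the equation and its derivative at the one point \<open>u\<close> make \<open>w\<close> perpendicular to the whole frame there.\<close>

lemma W_zero:
  assumes w: "w \<in> W" and u: "u \<in> I" "Z u \<noteq> 0"
    and z: "lform (e0 u) w = 0" "lform (e1 u) w = 0" "lform (e2 u) w = 0"
  shows "w = 0"
proof -
  have z3: "lform (e3 u) w = 0" using W_equation[OF w u(1)] z u(2) by simp
  obtain z2' x1' g' where d: "(Z2 has_real_derivative z2') (at u)" "(x1 has_real_derivative x1') (at u)"
    "(g has_real_derivative g') (at u)"
    using diff[OF u(1)] by (auto simp: real_differentiable_def)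
  note p = pair_derivs[OF u(1), of w] and dd = dZ[OF u(1)] dZ1[OF u(1)] dx[OF u(1)]
  have "((\<lambda>u. 2 * Z u * lform (e3 u) w + 3 * Z1 u * lform (e2 u) w
    + (Z2 u - 2 * x u - g u * Z u) * lform (e1 u) w - x1 u * lform (e0 u) w)
    has_real_derivative 2 * Z u * lform (e4 u) w) (at u)"
    by (rule derivative_eq_intros p dd d refl)+ (simp add: z z3)
  moreover have "((\<lambda>u. 2 * Z u * lform (e3 u) w + 3 * Z1 u * lform (e2 u) w
    + (Z2 u - 2 * x u - g u * Z u) * lform (e1 u) w - x1 u * lform (e0 u) w)
    has_real_derivative 0) (at u)"
    by (rule has_field_derivative_transform_within_open[OF DERIV_const open_I u(1), of 0])
       (use W_equation[OF w] in simp)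
  ultimately have "2 * Z u * lform (e4 u) w = 0" by (rule DERIV_unique)
  then have z4: "lform (e4 u) w = 0" using u(2) by simp
  have "lform w l = 0" using w by (simp add: W_def)
  then show ?thesis
    using lie_frame_zero[OF frame[OF u(1)], of w] z z3 z4 by (simp add: lform_commute[of w])
qed

text \<open>The polarised quadratic first integral of the third order equation.\<close>

definition Qf :: "R42 \<Rightarrow> R42 \<Rightarrow> real \<Rightarrow> real" where
  "Qf a b u = Z u * (lform (e0 u) a * lform (e2 u) b + lform (e2 u) a * lform (e0 u) b)
     + Z1 u / 2 * (lform (e0 u) a * lform (e1 u) b + lform (e1 u) a * lform (e0 u) b)
     - x u * lform (e0 u) a * lform (e0 u) b - Z u * lform (e1 u) a * lform (e1 u) b"

lemma Qf_constant:
  assumes a: "a \<in> W" and b: "b \<in> W" and uv: "u \<in> I" "v \<in> I"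
  shows "Qf a b u = Qf a b v"
proof (rule open_interval_constant[OF I _ uv])
  fix u assume u: "u \<in> I"
  have "(Qf a b has_real_derivative
     lform (e0 u) a / 2 * (2 * Z u * lform (e3 u) b + 3 * Z1 u * lform (e2 u) b
       + (Z2 u - 2 * x u - g u * Z u) * lform (e1 u) b - x1 u * lform (e0 u) b)
   + lform (e0 u) b / 2 * (2 * Z u * lform (e3 u) a + 3 * Z1 u * lform (e2 u) a
       + (Z2 u - 2 * x u - g u * Z u) * lform (e1 u) a - x1 u * lform (e0 u) a)) (at u)"
    unfolding Qf_def
    by (auto intro!: derivative_eq_intros pair_derivs[OF u] dZ[OF u] dZ1[OF u] dx[OF u]
        simp: field_simps)
  then show "(Qf a b has_vector_derivative 0) (at u)"
    by (simp add: W_equation[OF a u] W_equation[OF b u] has_real_derivative_iff_has_vector_derivative)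
qed

text \<open>The Wronskian of the functions of three vectors.\<close>

definition wr :: "R42 \<Rightarrow> R42 \<Rightarrow> R42 \<Rightarrow> real \<Rightarrow> real" where
  "wr a b c u = det3 (lform (e0 u) a) (lform (e1 u) a) (lform (e2 u) a)
     (lform (e0 u) b) (lform (e1 u) b) (lform (e2 u) b)
     (lform (e0 u) c) (lform (e1 u) c) (lform (e2 u) c)"

text \<open>The Gram determinant of the first integral; as the left hand side is constant, so is the right hand side.\<close>

lemma wr_Qf:
  "det3 (Qf a a u) (Qf a b u) (Qf a c u) (Qf b a u) (Qf b b u) (Qf b c u) (Qf c a u) (Qf c b u) (Qf c c u)
    = (wr a b c u)\<^sup>2 * Z u ^ 3"
proof -
  define y where "y = (\<lambda>w. (Z u * lform (e2 u) w + Z1 u / 2 * lform (e1 u) w - x u * lform (e0 u) w,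
    Z1 u / 2 * lform (e0 u) w - Z u * lform (e1 u) w, Z u * lform (e0 u) w))"
  have Q: "Qf v w u = fst (y v) * lform (e0 u) w + fst (snd (y v)) * lform (e1 u) w
     + snd (snd (y v)) * lform (e2 u) w" for v w
    by (simp add: Qf_def y_def algebra_simps)
  have "det3 (fst (y a)) (fst (snd (y a))) (snd (snd (y a))) (fst (y b)) (fst (snd (y b))) (snd (snd (y b)))
      (fst (y c)) (fst (snd (y c))) (snd (snd (y c))) = wr a b c u * Z u ^ 3"
    unfolding y_def fst_conv snd_conv wr_def by (rule det3_symmetric_product)
  then show ?thesis
    unfolding Q det3_gram by (simp add: wr_def power2_eq_square)
qed

text \<open>If the Wronskian does not vanish, all initial data at \<open>u\<close> are attained in \<open>W\<close>; the coefficients are those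
  of Cramer's rule.\<close>

lemma W_data:
  assumes "m1 \<in> W" "m2 \<in> W" "m3 \<in> W" and ind: "wr m1 m2 m3 u \<noteq> 0"
  obtains w where "w \<in> W" "lform (e0 u) w = t0" "lform (e1 u) w = t1" "lform (e2 u) w = t2"
proof -
  define D where "D = wr m1 m2 m3 u"
  define a1 a2 a3 where "a1 = lform (e0 u) m1" and "a2 = lform (e0 u) m2" and "a3 = lform (e0 u) m3"
  define b1 b2 b3 where "b1 = lform (e1 u) m1" and "b2 = lform (e1 u) m2" and "b3 = lform (e1 u) m3"
  define c1 c2 c3 where "c1 = lform (e2 u) m1" and "c2 = lform (e2 u) m2" and "c3 = lform (e2 u) m3"
  define s1 where "s1 = t0 * (b2*c3 - c2*b3) - t1 * (a2*c3 - c2*a3) + t2 * (a2*b3 - b2*a3)"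
  define s2 where "s2 = - t0 * (b1*c3 - c1*b3) + t1 * (a1*c3 - c1*a3) - t2 * (a1*b3 - b1*a3)"
  define s3 where "s3 = t0 * (b1*c2 - c1*b2) - t1 * (a1*c2 - c1*a2) + t2 * (a1*b2 - b1*a2)"
  define w where "w = (1 / D) *\<^sub>R (s1 *\<^sub>R m1 + s2 *\<^sub>R m2 + s3 *\<^sub>R m3)"
  have D: "D = a1*(b2*c3 - c2*b3) - b1*(a2*c3 - c2*a3) + c1*(a2*b3 - b2*a3)"
    by (simp add: D_def wr_def det3_def a1_def a2_def a3_def b1_def b2_def b3_def c1_def c2_def c3_def)
  have s: "s1*a1 + s2*a2 + s3*a3 = t0 * D" "s1*b1 + s2*b2 + s3*b3 = t1 * D" "s1*c1 + s2*c2 + s3*c3 = t2 * D"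
    unfolding s1_def s2_def s3_def D by (simp_all add: algebra_simps)
  have "D \<noteq> 0" using ind by (simp add: D_def)
  show ?thesis
  proof (rule that[of w])
    show "w \<in> W" unfolding w_def by (intro W_scale W_add assms)
    show "lform (e0 u) w = t0" "lform (e1 u) w = t1" "lform (e2 u) w = t2"
      using \<open>D \<noteq> 0\<close> s
      by (simp_all add: w_def lform_simps flip: a1_def a2_def a3_def b1_def b2_def b3_def c1_def c2_def c3_def)
  qed
qed

text \<open>A basis of \<open>W\<close> in which the first integral is a multiple of the form \<open>4 x0 x2 - x1\<^sup>2\<close> in the
  coefficients. Evaluation of functions at \<open>u\<close> corresponds, under this form, to an isotropic vector,
  because the first integral of two functions that vanish at \<open>u\<close> with their first derivatives vanishes;
  this says that the point \<open>(lform (e0 u) w0 : lform (e0 u) w1 : lform (e0 u) w2)\<close> runs in a conic.\<close>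

lemma conic_basis:
  assumes u1: "u1 \<in> I" "Z u1 \<noteq> 0" and m: "m1 \<in> W" "m2 \<in> W" "m3 \<in> W" and ind: "wr m1 m2 m3 u1 \<noteq> 0"
  shows "\<exists>w0 w1 w2. w0 \<in> W \<and> w1 \<in> W \<and> w2 \<in> W \<and>
    (\<forall>u\<in>I. (lform (e0 u) w1)\<^sup>2 = lform (e0 u) w0 * lform (e0 u) w2 \<and> wr w0 w1 w2 u \<noteq> 0) \<and>
    (\<forall>w\<in>W. \<exists>\<alpha> \<beta> \<gamma>. w = \<alpha> *\<^sub>R w0 + (2 * \<beta>) *\<^sub>R w1 + \<gamma> *\<^sub>R w2)"
proof -
  \<comment> \<open>The initial data at \<open>u1\<close> are chosen such that \<open>w0\<close> and \<open>w2\<close> are isotropic and perpendicular to \<open>w1\<close>.\<close>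
  define \<zeta> where "\<zeta> = Z u1"
  have \<zeta>: "\<zeta> \<noteq> 0" using u1 by (simp add: \<zeta>_def)
  obtain w0 where w0: "w0 \<in> W" "lform (e0 u1) w0 = 1" "lform (e1 u1) w0 = 0" "lform (e2 u1) w0 = x u1 / (2 * \<zeta>)"
    by (rule W_data[OF m ind])
  obtain w1 where w1: "w1 \<in> W" "lform (e0 u1) w1 = 0" "lform (e1 u1) w1 = 1" "lform (e2 u1) w1 = - Z1 u1 / (2 * \<zeta>)"
    by (rule W_data[OF m ind])
  obtain w2 where w2: "w2 \<in> W" "lform (e0 u1) w2 = 0" "lform (e1 u1) w2 = 0" "lform (e2 u1) w2 = 2"
    by (rule W_data[OF m ind])
  have Q1: "Qf w0 w0 u1 = 0" "Qf w0 w1 u1 = 0" "Qf w0 w2 u1 = 2 * \<zeta>"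
    "Qf w1 w0 u1 = 0" "Qf w1 w1 u1 = - \<zeta>" "Qf w1 w2 u1 = 0"
    "Qf w2 w0 u1 = 2 * \<zeta>" "Qf w2 w1 u1 = 0" "Qf w2 w2 u1 = 0"
    using \<zeta> by (simp_all add: Qf_def w0 w1 w2 flip: \<zeta>_def)
  have Q: "Qf w0 w0 u = 0" "Qf w0 w1 u = 0" "Qf w0 w2 u = 2 * \<zeta>"
    "Qf w1 w0 u = 0" "Qf w1 w1 u = - \<zeta>" "Qf w1 w2 u = 0"
    "Qf w2 w0 u = 2 * \<zeta>" "Qf w2 w1 u = 0" "Qf w2 w2 u = 0" if "u \<in> I" for u
    using Q1 Qf_constant[OF _ _ that u1(1)] w0(1) w1(1) w2(1) by simp_all
  have wr: "wr w0 w1 w2 u \<noteq> 0" "Z u \<noteq> 0" if "u \<in> I" for u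
  proof -
    have "(wr w0 w1 w2 u)\<^sup>2 * Z u ^ 3 = 4 * \<zeta> ^ 3"
      unfolding wr_Qf[symmetric] by (simp add: Q[OF that] det3_def power3_eq_cube)
    with \<zeta> show "wr w0 w1 w2 u \<noteq> 0" "Z u \<noteq> 0" by auto
  qed
  have conic: "(lform (e0 u) w1)\<^sup>2 = lform (e0 u) w0 * lform (e0 u) w2" if u: "u \<in> I" for u
  proof -
    \<comment> \<open>The vector that represents evaluation at \<open>u\<close> with respect to the first integral.\<close>
    define a where "a = (lform (e0 u) w2 / 2) *\<^sub>R w0 + (lform (e0 u) w0 / 2) *\<^sub>R w2 - lform (e0 u) w1 *\<^sub>R w1"
    have lin: "Qf a n u = lform (e0 u) w2 / 2 * Qf w0 n u + lform (e0 u) w0 / 2 * Qf w2 n u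
        - lform (e0 u) w1 * Qf w1 n u" for n
      by (simp add: Qf_def a_def lform_simps algebra_simps)
    have Qa: "Qf a w0 u = \<zeta> * lform (e0 u) w0" "Qf a w1 u = \<zeta> * lform (e0 u) w1" "Qf a w2 u = \<zeta> * lform (e0 u) w2"
      unfolding lin by (simp_all add: Q[OF u])
    have e: "(Z u * lform (e2 u) a + Z1 u / 2 * lform (e1 u) a - x u * lform (e0 u) a - \<zeta>) * lform (e0 u) n
       + (Z1 u / 2 * lform (e0 u) a - Z u * lform (e1 u) a) * lform (e1 u) n
       + (Z u * lform (e0 u) a) * lform (e2 u) n = Qf a n u - \<zeta> * lform (e0 u) n" for n
      by (simp add: Qf_def algebra_simps)
    have "(Z u * lform (e0 u) a) * wr w0 w1 w2 u = 0"
      unfolding wr_def by (rule det3_kernel; (subst e, simp add: Qa))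
    then have "lform (e0 u) a = 0" using wr[OF u] by simp
    then show ?thesis by (simp add: a_def lform_simps power2_eq_square)
  qed
  have rep: "\<exists>\<alpha> \<beta> \<gamma>. w = \<alpha> *\<^sub>R w0 + (2 * \<beta>) *\<^sub>R w1 + \<gamma> *\<^sub>R w2" if w: "w \<in> W" for w
  proof -
    define \<alpha> \<beta> where "\<alpha> = lform (e0 u1) w" and "\<beta> = lform (e1 u1) w / 2"
    define \<gamma> where "\<gamma> = (lform (e2 u1) w - \<alpha> * x u1 / (2 * \<zeta>) + 2 * \<beta> * Z1 u1 / (2 * \<zeta>)) / 2"
    have "w - (\<alpha> *\<^sub>R w0 + (2 * \<beta>) *\<^sub>R w1 + \<gamma> *\<^sub>R w2) = 0"
    proof (rule W_zero[OF _ u1])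
      show "w - (\<alpha> *\<^sub>R w0 + (2 * \<beta>) *\<^sub>R w1 + \<gamma> *\<^sub>R w2) \<in> W"
        by (intro W_diff W_add W_scale w w0(1) w1(1) w2(1))
    qed (use \<zeta> in \<open>simp_all add: lform_simps w0 w1 w2 \<alpha>_def \<beta>_def \<gamma>_def field_simps\<close>)
    then show ?thesis by (intro exI) (rule eq_iff_diff_eq_0[THEN iffD2])
  qed
  show ?thesis
    by (rule exI[of _ w0], rule exI[of _ w1], rule exI[of _ w2], intro conjI ballI w0(1) w1(1) w2(1) conic wr(1) rep)
qed

text \<open>Vectors of \<open>W\<close> with positive values on the curve such that \<open>(P1 : J : P2)\<close> immerses \<open>I\<close> into
  the conic \<open>J\<^sup>2 = P1 P2\<close>.\<close>

definition conic_triple :: "R42 \<Rightarrow> R42 \<Rightarrow> R42 \<Rightarrow> bool" where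
  "conic_triple p1 j p2 \<longleftrightarrow> p1 \<in> W \<and> j \<in> W \<and> p2 \<in> W \<and> (\<forall>u\<in>I.
    lform (e0 u) p1 > 0 \<and> lform (e0 u) j > 0 \<and> lform (e0 u) p2 > 0 \<and>
    (lform (e0 u) j)\<^sup>2 = lform (e0 u) p1 * lform (e0 u) p2 \<and>
    lform (e0 u) p1 * lform (e1 u) j - lform (e0 u) j * lform (e1 u) p1 \<noteq> 0)"

text \<open>The product of two independent linear forms, read as a quadratic form on the conic, and the squares
  of the two forms: if the product has no zeros on the curve, these three give a triple after a choice
  of signs.\<close>

lemma triple_of_linear_forms:
  assumes w: "w0 \<in> W" "w1 \<in> W" "w2 \<in> W"
    and conic: "\<And>u. u \<in> I \<Longrightarrow> (lform (e0 u) w1)\<^sup>2 = lform (e0 u) w0 * lform (e0 u) w2"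
    and wr: "\<And>u. u \<in> I \<Longrightarrow> wr w0 w1 w2 u \<noteq> 0"
    and ind: "a1 * b2 - a2 * b1 \<noteq> 0"
    and nz: "\<And>u. u \<in> I \<Longrightarrow> lform (e0 u) ((a1 * a2) *\<^sub>R w0 + (a1 * b2 + a2 * b1) *\<^sub>R w1 + (b1 * b2) *\<^sub>R w2) \<noteq> 0"
  shows "\<exists>p1 j p2. conic_triple p1 j p2"
proof -
  define n where "n = (\<lambda>a b. a\<^sup>2 *\<^sub>R w0 + (2 * a * b) *\<^sub>R w1 + b\<^sup>2 *\<^sub>R w2)"
  define j where "j = (a1 * a2) *\<^sub>R w0 + (a1 * b2 + a2 * b1) *\<^sub>R w1 + (b1 * b2) *\<^sub>R w2"
  have inW: "n a b \<in> W" "j \<in> W" for a b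
    unfolding n_def j_def by (intro W_add W_scale w)+
  have sq: "(lform (e0 u) j)\<^sup>2 = lform (e0 u) (n a1 b1) * lform (e0 u) (n a2 b2)" if "u \<in> I" for u
  proof -
    have "(a1*a2*x0 + (a1*b2 + a2*b1)*x1 + b1*b2*x2)\<^sup>2
        = (a1\<^sup>2*x0 + 2*a1*b1*x1 + b1\<^sup>2*x2) * (a2\<^sup>2*x0 + 2*a2*b2*x1 + b2\<^sup>2*x2)"
      if "x1\<^sup>2 = x0 * x2" for x0 x1 x2 :: real
      using that by algebra
    from this[OF conic[OF that]] show ?thesis by (simp add: j_def n_def lform_simps)
  qed
  have jnz: "lform (e0 u) j \<noteq> 0" if "u \<in> I" for u using nz[OF that] by (simp add: j_def)
  have nnz: "lform (e0 u) (n a1 b1) \<noteq> 0" "lform (e0 u) (n a2 b2) \<noteq> 0" if "u \<in> I" for u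
    using sq[OF that] jnz[OF that] by auto
  have wr': "wr (n a1 b1) j (n a2 b2) u \<noteq> 0" if "u \<in> I" for u
  proof -
    have "wr (n a1 b1) j (n a2 b2) u = (a1 * b2 - a2 * b1) ^ 3 * wr w0 w1 w2 u"
      unfolding wr_def n_def j_def lform_simps real_scaleR_def det3_combine det3_symmetric_square ..
    then show ?thesis using wr[OF that] ind by simp
  qed
  have imm: "lform (e0 u) (n a1 b1) * lform (e1 u) j - lform (e0 u) j * lform (e1 u) (n a1 b1) \<noteq> 0"
    if u: "u \<in> I" for u
  proof
    define P P' P'' where "P = lform (e0 u) (n a1 b1)" and "P' = lform (e1 u) (n a1 b1)" and "P'' = lform (e2 u) (n a1 b1)"
    define R R' R'' where "R = lform (e0 u) (n a2 b2)" and "R' = lform (e1 u) (n a2 b2)" and "R'' = lform (e2 u) (n a2 b2)"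
    define J J' J'' where "J = lform (e0 u) j" and "J' = lform (e1 u) j" and "J'' = lform (e2 u) j"
    assume "lform (e0 u) (n a1 b1) * lform (e1 u) j - lform (e0 u) j * lform (e1 u) (n a1 b1) = 0"
    then have 1: "P * J' = J * P'" by (simp add: P_def P'_def J_def J'_def)
    have "((\<lambda>u. lform (e0 u) j * lform (e0 u) j) has_real_derivative J' * J + J * J') (at u)"
      unfolding J_def J'_def by (auto intro!: derivative_eq_intros pair_derivs[OF u])
    moreover have "((\<lambda>u. lform (e0 u) (n a1 b1) * lform (e0 u) (n a2 b2)) has_real_derivative P' * R + P * R') (at u)"
      unfolding P_def P'_def R_def R'_def by (auto intro!: derivative_eq_intros pair_derivs[OF u])
    then have "((\<lambda>u. lform (e0 u) j * lform (e0 u) j) has_real_derivative P' * R + P * R') (at u)"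
      by (rule has_field_derivative_transform_within_open[OF _ open_I u])
         (simp add: sq[symmetric] power2_eq_square)
    ultimately have 2: "J' * J + J * J' = P' * R + P * R'" by (rule DERIV_unique)
    have 3: "J\<^sup>2 = P * R" using sq[OF u] by (simp add: J_def P_def R_def)
    have P: "P \<noteq> 0" using nnz[OF u] by (simp add: P_def)
    have "P * (P * R') = P * (R * P')"
      using 1 2 3 by algebra
    then have 4: "P * R' = R * P'" using P by simp
    have "P * wr (n a1 b1) j (n a2 b2) u = 0"
      using 1 4 unfolding wr_def det3_def
        P_def[symmetric] P'_def[symmetric] P''_def[symmetric] R_def[symmetric] R'_def[symmetric]
        R''_def[symmetric] J_def[symmetric] J'_def[symmetric] J''_def[symmetric]
      by algebra
    then show False using P wr'[OF u] by simp
  qed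
  obtain s where s: "s = 1 \<or> s = -1" "\<And>u. u \<in> I \<Longrightarrow> s * lform (e0 u) (n a1 b1) > 0"
    using open_interval_sign[OF I continuous_pair nnz(1)] by blast
  obtain t where t: "t = 1 \<or> t = -1" "\<And>u. u \<in> I \<Longrightarrow> t * lform (e0 u) j > 0"
    using open_interval_sign[OF I continuous_pair jnz] by blast
  show ?thesis
  proof (rule exI[of _ "s *\<^sub>R n a1 b1"], rule exI[of _ "t *\<^sub>R j"], rule exI[of _ "s *\<^sub>R n a2 b2"],
      unfold conic_triple_def, intro conjI ballI)
    fix u assume u: "u \<in> I"
    have "lform (e0 u) (n a1 b1) * lform (e0 u) (n a2 b2) > 0"
      using sq[OF u] jnz[OF u] by (metis zero_less_power2)
    then have "s * lform (e0 u) (n a1 b1) * (s * lform (e0 u) (n a2 b2)) > 0"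
      using s(1) by auto
    from zero_less_mult_pos[OF this s(2)[OF u]]
    show "lform (e0 u) (s *\<^sub>R n a2 b2) > 0" by (simp add: lform_simps)
    show "lform (e0 u) (s *\<^sub>R n a1 b1) > 0" "lform (e0 u) (t *\<^sub>R j) > 0"
      using s(2)[OF u] t(2)[OF u] by (simp_all add: lform_simps)
    show "(lform (e0 u) (t *\<^sub>R j))\<^sup>2 = lform (e0 u) (s *\<^sub>R n a1 b1) * lform (e0 u) (s *\<^sub>R n a2 b2)"
      using sq[OF u] s(1) t(1) by (auto simp: lform_simps power2_eq_square)
    show "lform (e0 u) (s *\<^sub>R n a1 b1) * lform (e1 u) (t *\<^sub>R j)
        - lform (e0 u) (t *\<^sub>R j) * lform (e1 u) (s *\<^sub>R n a1 b1) \<noteq> 0"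
      using imm[OF u] s(1) t(1) by (auto simp: lform_simps)
  qed (intro W_scale inW)+
qed

text \<open>The curve avoids two points of the conic. A form \<open>m v\<close> has no zeros on the curve. If it is indefinite,
  its roots are avoided. If it is definite, the roots of its Jacobian with the derivative \<open>h v\<close> are
  avoided, since \<open>reg\<close> says that the Jacobian has no zeros on the curve. If every \<open>m v\<close> is degenerate, the
  double roots of two independent ones are avoided.\<close>

lemma positive_conic_triple:
  fixes m h :: "real \<Rightarrow> R42"
  assumes K: "open_interval K"
    and m: "\<And>v. v \<in> K \<Longrightarrow> m v \<in> W" "\<And>v. v \<in> K \<Longrightarrow> h v \<in> W"
    and dm: "\<And>v. v \<in> K \<Longrightarrow> (m has_vector_derivative h v) (at v)"
    and M: "\<And>u v. u \<in> I \<Longrightarrow> v \<in> K \<Longrightarrow> lform (e0 u) (m v) \<noteq> 0"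
    and reg: "\<And>u v. u \<in> I \<Longrightarrow> v \<in> K \<Longrightarrow>
      lform (e0 u) (m v) * lform (e1 u) (h v) - lform (e1 u) (m v) * lform (e0 u) (h v) \<noteq> 0"
    and span: "\<not> (\<exists>a\<in>m ` K. \<exists>b\<in>m ` K. \<forall>v\<in>K. m v \<in> span {a, b})"
    and Z: "u1 \<in> I" "Z u1 \<noteq> 0"
  shows "\<exists>p1 j p2. conic_triple p1 j p2"
proof -
  define n0 n1 n2 where "n0 = (\<lambda>w. lform (e0 u1) w)" and "n1 = (\<lambda>w. lform (e1 u1) w)" and "n2 = (\<lambda>w. lform (e2 u1) w)"
  obtain v1 where v1: "v1 \<in> K" using K by (auto simp: open_interval_def)
  have oK: "open K" using K by (simp add: open_interval_def)
  \<comment> \<open>The functions of the vectors \<open>m v\<close> do not all have proportional first order jets at \<open>u1\<close>, by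
    \<open>reg\<close>, and the vectors are not all contained in a plane; so three of them have non-vanishing Wronskian at \<open>u1\<close>.\<close>
  have "\<exists>v2\<in>K. n0 (m v1) * n1 (m v2) - n1 (m v1) * n0 (m v2) \<noteq> 0"
  proof (rule ccontr)
    assume "\<not> ?thesis"
    then have z: "n0 (m v1) * n1 (m v) - n1 (m v1) * n0 (m v) = 0" if "v \<in> K" for v using that by blast
    define F :: R42 where "F = n0 (m v1) *\<^sub>R e1 u1 - n1 (m v1) *\<^sub>R e0 u1"
    have "lform 0 (m v1) + lform F (h v1) = 0"
      by (rule lform_vector_derivative_const[OF oK v1 has_vector_derivative_const dm[OF v1], of _ 0])
         (use z in \<open>simp add: F_def lform_simps n0_def n1_def\<close>)
    then show False using reg[OF Z(1) v1] by (simp add: F_def lform_simps n0_def n1_def)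
  qed
  then obtain v2 where v2: "v2 \<in> K" "n0 (m v1) * n1 (m v2) - n1 (m v1) * n0 (m v2) \<noteq> 0" by blast
  define D where "D = n0 (m v1) * n1 (m v2) - n1 (m v1) * n0 (m v2)"
  have D: "D \<noteq> 0" using v2 by (simp add: D_def)
  have "\<exists>v3\<in>K. wr (m v1) (m v2) (m v3) u1 \<noteq> 0"
  proof (rule ccontr)
    assume "\<not> ?thesis"
    then have z: "wr (m v1) (m v2) (m v) u1 = 0" if "v \<in> K" for v using that by blast
    have "m v \<in> span {m v1, m v2}" if v: "v \<in> K" for v
    proof -
      define s t where "s = (n0 (m v) * n1 (m v2) - n1 (m v) * n0 (m v2)) / D"
        and "t = (n0 (m v1) * n1 (m v) - n1 (m v1) * n0 (m v)) / D"
      have e: "n0 (m v) = s * n0 (m v1) + t * n0 (m v2)" "n1 (m v) = s * n1 (m v1) + t * n1 (m v2)"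
        using D by (simp_all add: s_def t_def field_simps) (simp_all add: D_def algebra_simps)
      have "wr (m v1) (m v2) (m v) u1 = D * (n2 (m v) - s * n2 (m v1) - t * n2 (m v2))"
        unfolding wr_def n0_def[symmetric] n1_def[symmetric] n2_def[symmetric] e D_def det3_def
        by (simp add: algebra_simps)
      then have e2: "n2 (m v) = s * n2 (m v1) + t * n2 (m v2)" using z[OF v] D by simp
      have "m v - (s *\<^sub>R m v1 + t *\<^sub>R m v2) = 0"
        by (rule W_zero[OF W_diff[OF m(1)[OF v] W_add[OF W_scale[OF m(1)[OF v1]] W_scale[OF m(1)[OF v2(1)]]]] Z])
           (use e e2 in \<open>simp_all add: lform_simps n0_def n1_def n2_def\<close>)
      then show ?thesis by (auto simp: in_span2)
    qed
    with span v1 v2(1) show False by blast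
  qed
  then obtain v3 where v3: "v3 \<in> K" "wr (m v1) (m v2) (m v3) u1 \<noteq> 0" by blast
  obtain w0 w1 w2 where basis: "w0 \<in> W \<and> w1 \<in> W \<and> w2 \<in> W \<and>
    (\<forall>u\<in>I. (lform (e0 u) w1)\<^sup>2 = lform (e0 u) w0 * lform (e0 u) w2 \<and> wr w0 w1 w2 u \<noteq> 0) \<and>
    (\<forall>w\<in>W. \<exists>\<alpha> \<beta> \<gamma>. w = \<alpha> *\<^sub>R w0 + (2 * \<beta>) *\<^sub>R w1 + \<gamma> *\<^sub>R w2)"
    using conic_basis[OF Z m(1)[OF v1] m(1)[OF v2(1)] m(1)[OF v3(1)] v3(2)] by (elim exE)
  from basis have w: "w0 \<in> W" "w1 \<in> W" "w2 \<in> W" by simp_all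
  from basis have conic: "(lform (e0 u) w1)\<^sup>2 = lform (e0 u) w0 * lform (e0 u) w2"
    and wr: "wr w0 w1 w2 u \<noteq> 0" if "u \<in> I" for u
    using that by blast+
  from basis have rep: "\<forall>w\<in>W. \<exists>\<alpha> \<beta> \<gamma>. w = \<alpha> *\<^sub>R w0 + (2 * \<beta>) *\<^sub>R w1 + \<gamma> *\<^sub>R w2"
    by (elim conjE)
  have triple: ?thesis
    if "a1 * b2 - a2 * b1 \<noteq> 0"
      "\<And>u. u \<in> I \<Longrightarrow> lform (e0 u) ((a1 * a2) *\<^sub>R w0 + (a1 * b2 + a2 * b1) *\<^sub>R w1 + (b1 * b2) *\<^sub>R w2) \<noteq> 0"
    for a1 b1 a2 b2
    by (rule triple_of_linear_forms[OF w conic wr that])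
  define X0 X1 X2 where "X0 = (\<lambda>u. lform (e0 u) w0)" and "X1 = (\<lambda>u. lform (e0 u) w1)" and "X2 = (\<lambda>u. lform (e0 u) w2)"
  define Y0 Y1 Y2 where "Y0 = (\<lambda>u. lform (e1 u) w0)" and "Y1 = (\<lambda>u. lform (e1 u) w1)" and "Y2 = (\<lambda>u. lform (e1 u) w2)"
  note XY = X0_def X1_def X2_def Y0_def Y1_def Y2_def
  obtain \<alpha> \<beta> \<gamma> where mrep: "\<And>v. v \<in> K \<Longrightarrow> m v = \<alpha> v *\<^sub>R w0 + (2 * \<beta> v) *\<^sub>R w1 + \<gamma> v *\<^sub>R w2"
  proof -
    have "\<forall>v\<in>K. \<exists>\<alpha> \<beta> \<gamma>. m v = \<alpha> *\<^sub>R w0 + (2 * \<beta>) *\<^sub>R w1 + \<gamma> *\<^sub>R w2"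
      by (intro ballI bspec[OF rep m(1)])
    from this[unfolded bchoice_iff] obtain \<alpha> \<beta> \<gamma>
      where "\<forall>v\<in>K. m v = \<alpha> v *\<^sub>R w0 + (2 * \<beta> v) *\<^sub>R w1 + \<gamma> v *\<^sub>R w2"
      by (elim exE)
    then show ?thesis by (intro that) (rule bspec)
  qed
  have Mrep: "lform (e0 u) (m v) = \<alpha> v * X0 u + 2 * \<beta> v * X1 u + \<gamma> v * X2 u"
    "lform (e1 u) (m v) = \<alpha> v * Y0 u + 2 * \<beta> v * Y1 u + \<gamma> v * Y2 u" if "v \<in> K" for u v
    using mrep[OF that] by (simp_all add: XY lform_simps)
  have indefinite: ?thesis
    if disc: "\<beta>\<^sup>2 - \<alpha> * \<gamma> > 0" and nz: "\<And>u. u \<in> I \<Longrightarrow> \<alpha> * X0 u + 2 * \<beta> * X1 u + \<gamma> * X2 u \<noteq> 0"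
    for \<alpha> \<beta> \<gamma> :: real
  proof -
    obtain a1 b1 a2 b2 where ab: "a1 * b2 - a2 * b1 \<noteq> 0"
      "\<alpha> = a1 * a2" "2 * \<beta> = a1 * b2 + a2 * b1" "\<gamma> = b1 * b2"
      by (rule indefinite_form_factors[OF disc])
    show ?thesis
      by (rule triple[OF ab(1)]) (use nz in \<open>simp_all add: lform_simps XY flip: ab(2-)\<close>)
  qed
  consider (indef) v where "v \<in> K" "(\<beta> v)\<^sup>2 - \<alpha> v * \<gamma> v > 0"
    | (def) v where "v \<in> K" "(\<beta> v)\<^sup>2 - \<alpha> v * \<gamma> v < 0"
    | (deg) "\<And>v. v \<in> K \<Longrightarrow> (\<beta> v)\<^sup>2 - \<alpha> v * \<gamma> v = 0"
    by (meson linorder_neqE_linordered_idom)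
  then show ?thesis
  proof cases
    case indef
    show ?thesis by (rule indefinite[OF indef(2)]) (use M[OF _ indef(1)] Mrep[OF indef(1)] in simp)
  next
    case def
    obtain \<alpha>' \<beta>' \<gamma>' where hrep: "h v = \<alpha>' *\<^sub>R w0 + (2 * \<beta>') *\<^sub>R w1 + \<gamma>' *\<^sub>R w2"
      using bspec[OF rep m(2)[OF def(1)]] by (elim exE)
    define A B C where "A = \<alpha> v * \<beta>' - \<beta> v * \<alpha>'" and "B = \<alpha> v * \<gamma>' - \<gamma> v * \<alpha>'"
      and "C = \<beta> v * \<gamma>' - \<gamma> v * \<beta>'"
    have nz: "A * X0 u + 2 * (B / 2) * X1 u + C * X2 u \<noteq> 0" if u: "u \<in> I" for u
    proof
      assume J: "A * X0 u + 2 * (B / 2) * X1 u + C * X2 u = 0"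
      define k01 k02 k12 where "k01 = X0 u * Y1 u - X1 u * Y0 u" and "k02 = X0 u * Y2 u - X2 u * Y0 u"
        and "k12 = X1 u * Y2 u - X2 u * Y1 u"
      have r: "2 * A * k01 + B * k02 + 2 * C * k12 \<noteq> 0"
      proof -
        have "lform (e0 u) (m v) * lform (e1 u) (h v) - lform (e1 u) (m v) * lform (e0 u) (h v)
            = 2 * A * k01 + B * k02 + 2 * C * k12"
          unfolding Mrep[OF def(1)] hrep lform_simps real_scaleR_def XY[symmetric] A_def B_def C_def k01_def k02_def k12_def
          by (simp add: XY algebra_simps)
        then show ?thesis using reg[OF u def(1)] by simp
      qed
      have c: "X1 u * X1 u = X0 u * X2 u" using conic[OF u] by (simp add: XY power2_eq_square)
      have "((\<lambda>u. X1 u * X1 u) has_real_derivative Y1 u * X1 u + X1 u * Y1 u) (at u)"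
        unfolding XY by (auto intro!: derivative_eq_intros pair_derivs[OF u])
      moreover have "((\<lambda>u. X0 u * X2 u) has_real_derivative Y0 u * X2 u + X0 u * Y2 u) (at u)"
        unfolding XY by (auto intro!: derivative_eq_intros pair_derivs[OF u])
      then have "((\<lambda>u. X1 u * X1 u) has_real_derivative Y0 u * X2 u + X0 u * Y2 u) (at u)"
        by (rule has_field_derivative_transform_within_open[OF _ open_I u])
           (use conic in \<open>simp add: XY power2_eq_square\<close>)
      ultimately have d: "Y1 u * X1 u + X1 u * Y1 u = Y0 u * X2 u + X0 u * Y2 u" by (rule DERIV_unique)
      \<comment> \<open>On the conic the two by two Wronskians are proportional to \<open>(X0, 2 X1, X2)\<close>, so the Wronskian in
        \<open>reg\<close> is a multiple of the Jacobian.\<close>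
      have k: "X0 u * k02 = 2 * X1 u * k01" "X0 u * k12 = X2 u * k01"
        "X2 u * k02 = 2 * X1 u * k12"
        unfolding k01_def k02_def k12_def using c d by algebra+
      have "X0 u * (2 * A * k01 + B * k02 + 2 * C * k12) = 0"
        "X2 u * (2 * A * k01 + B * k02 + 2 * C * k12) = 0"
        using J k by algebra+
      then have "X0 u = 0" "X2 u = 0" using r by auto
      then have "X1 u = 0" using c by simp
      with \<open>X0 u = 0\<close> \<open>X2 u = 0\<close> show False using wr[OF u] by (simp add: wr_def det3_def XY)
    qed
    obtain u where u: "u \<in> I" using Z by blast
    have "(B / 2)\<^sup>2 - A * C > 0"
      unfolding A_def B_def C_def
      by (rule jacobian_form_indefinite[OF def(2)]) (use nz[OF u] in \<open>auto simp: A_def B_def C_def\<close>)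
    then show ?thesis by (rule indefinite) (rule nz)
  next
    case deg
    obtain e1' a1 b1 where f1: "e1' = 1 \<or> e1' = -1" "\<alpha> v1 = e1' * a1\<^sup>2" "\<beta> v1 = e1' * (a1 * b1)" "\<gamma> v1 = e1' * b1\<^sup>2"
      by (rule degenerate_form_square[OF deg[OF v1]])
    obtain e2' a2 b2 where f2: "e2' = 1 \<or> e2' = -1" "\<alpha> v2 = e2' * a2\<^sup>2" "\<beta> v2 = e2' * (a2 * b2)" "\<gamma> v2 = e2' * b2\<^sup>2"
      by (rule degenerate_form_square[OF deg[OF v2(1)]])
    have ind: "a1 * b2 - a2 * b1 \<noteq> 0"
    proof
      assume z: "a1 * b2 - a2 * b1 = 0"
      have "n0 (m v1) * n1 (m v2) - n1 (m v1) * n0 (m v2) = 0"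
        unfolding n0_def n1_def Mrep[OF v1] Mrep[OF v2(1)] f1(2-) f2(2-)
        using z by algebra
      with v2(2) show False by simp
    qed
    show ?thesis
    proof (rule triple[OF ind])
      fix u assume u: "u \<in> I"
      have "(a1*a2*x0 + (a1*b2 + a2*b1)*x1 + b1*b2*x2)\<^sup>2
          = (a1\<^sup>2*x0 + 2*a1*b1*x1 + b1\<^sup>2*x2) * (a2\<^sup>2*x0 + 2*a2*b2*x1 + b2\<^sup>2*x2)"
        if "x1\<^sup>2 = x0 * x2" for x0 x1 x2 :: real
        using that by algebra
      moreover have "(X1 u)\<^sup>2 = X0 u * X2 u" using conic[OF u] by (simp add: XY)
      ultimately have "(lform (e0 u) ((a1 * a2) *\<^sub>R w0 + (a1 * b2 + a2 * b1) *\<^sub>R w1 + (b1 * b2) *\<^sub>R w2))\<^sup>2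
        = (a1\<^sup>2 * X0 u + 2*a1*b1 * X1 u + b1\<^sup>2 * X2 u) * (a2\<^sup>2 * X0 u + 2*a2*b2 * X1 u + b2\<^sup>2 * X2 u)"
        by (simp add: lform_simps XY)
      also have "\<dots> = e1' * lform (e0 u) (m v1) * (e2' * lform (e0 u) (m v2))"
        using f1(1) f2(1) unfolding Mrep[OF v1] Mrep[OF v2(1)] f1(2-) f2(2-)
        by (auto simp: algebra_simps)
      also have "\<dots> \<noteq> 0" using f1(1) f2(1) M[OF u v1] M[OF u v2(1)] by auto
      finally show "lform (e0 u) ((a1 * a2) *\<^sub>R w0 + (a1 * b2 + a2 * b1) *\<^sub>R w1 + (b1 * b2) *\<^sub>R w2) \<noteq> 0"
        by auto
    qed
  qed
qed

text \<open>The vectors \<open>ps s\<close> with \<open>s \<ge> 0\<close> all have positive functions and lie on the cone of isotropic vectors of the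
  first integral; together with \<open>js s\<close> and \<open>p2\<close> they satisfy the conic relation again. One of them is not
  null and can be normalised.\<close>

lemma elastic_profile:
  fixes m h :: "real \<Rightarrow> R42"
  assumes K: "open_interval K"
    and m: "\<And>v. v \<in> K \<Longrightarrow> m v \<in> W" "\<And>v. v \<in> K \<Longrightarrow> h v \<in> W"
    and dm: "\<And>v. v \<in> K \<Longrightarrow> (m has_vector_derivative h v) (at v)"
    and M: "\<And>u v. u \<in> I \<Longrightarrow> v \<in> K \<Longrightarrow> lform (e0 u) (m v) \<noteq> 0"
    and reg: "\<And>u v. u \<in> I \<Longrightarrow> v \<in> K \<Longrightarrow>
      lform (e0 u) (m v) * lform (e1 u) (h v) - lform (e1 u) (m v) * lform (e0 u) (h v) \<noteq> 0"
    and span: "\<not> (\<exists>a\<in>m ` K. \<exists>b\<in>m ` K. \<forall>v\<in>K. m v \<in> span {a, b})"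
    and Z: "u1 \<in> I" "Z u1 \<noteq> 0"
  shows "\<exists>p q \<ff> \<tt> k. space_form_vectors (span {l}) p q \<and>
    projects_to I (span {l}) p q (\<lambda>u. span {e0 u, e1 u}) \<ff> \<tt> k \<and> constrained_elastic_on I p q \<ff> k"
proof -
  have "\<exists>p1 j p2. conic_triple p1 j p2"
    by (rule positive_conic_triple[OF K m dm M reg span Z])
  then obtain p1 j p2 where triple: "conic_triple p1 j p2"
    by (elim exE)
  from triple[unfolded conic_triple_def] have pW: "p1 \<in> W" "j \<in> W" "p2 \<in> W" by simp_all
  from triple[unfolded conic_triple_def] have pos: "lform (e0 u) p1 > 0" "lform (e0 u) j > 0" "lform (e0 u) p2 > 0"
    and conic: "(lform (e0 u) j)\<^sup>2 = lform (e0 u) p1 * lform (e0 u) p2"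
    and imm: "lform (e0 u) p1 * lform (e1 u) j - lform (e0 u) j * lform (e1 u) p1 \<noteq> 0"
    if "u \<in> I" for u
    using that by blast+
  define ps where "ps = (\<lambda>s. p1 + (2 * s) *\<^sub>R j + s\<^sup>2 *\<^sub>R p2)"
  define js where "js = (\<lambda>s. j + s *\<^sub>R p2)"
  have poly: "lform (ps s) (ps s) = lform p1 p1 + (4 * lform p1 j) * s + (4 * lform j j + 2 * lform p1 p2) * s^2
      + (4 * lform j p2) * s^3 + lform p2 p2 * s^4" for s
    by (simp add: ps_def lform_simps lform_commute[of j p1] lform_commute[of p2 p1] lform_commute[of p2 j]
        algebra_simps power2_eq_square power3_eq_cube power4_eq_xxxx)
  \<comment> \<open>For the parameter at which the null form \<open>ps s\<close> has its double zero at \<open>u1\<close>, the vector \<open>ps s\<close>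
    lies in the span of \<open>e0\<close>, \<open>e1\<close>, \<open>e2\<close> at \<open>u1\<close> and is spacelike.\<close>
  have "\<exists>s. lform (ps s) (ps s) \<noteq> 0"
  proof -
    define P P' P'' where "P = lform (e0 u1) p1" and "P' = lform (e1 u1) p1" and "P'' = lform (e2 u1) p1"
    define R R' R'' where "R = lform (e0 u1) p2" and "R' = lform (e1 u1) p2" and "R'' = lform (e2 u1) p2"
    define J J' J'' where "J = lform (e0 u1) j" and "J' = lform (e1 u1) j" and "J'' = lform (e2 u1) j"
    note defs = P_def P'_def P''_def R_def R'_def R''_def J_def J'_def J''_def
    define s where "s = - P / J"
    have J: "J > 0" "P > 0" "R > 0" using pos[OF Z(1)] by (simp_all add: defs)
    have c0: "J * J = P * R" using conic[OF Z(1)] by (simp add: defs power2_eq_square)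
    have sJ: "s * J = - P" using J by (simp add: s_def)
    have d1: "2 * J u * J1 u = P1 u * R u + P u * R1 u" if "u \<in> I"
      "J = (\<lambda>u. lform (e0 u) j)" "J1 = (\<lambda>u. lform (e1 u) j)" "P = (\<lambda>u. lform (e0 u) p1)"
      "P1 = (\<lambda>u. lform (e1 u) p1)" "R = (\<lambda>u. lform (e0 u) p2)" "R1 = (\<lambda>u. lform (e1 u) p2)"
      for J J1 P P1 R R1 u
    proof -
      have "((\<lambda>u. J u * J u) has_real_derivative J1 u * J u + J u * J1 u) (at u)"
        unfolding that(2-) by (auto intro!: derivative_eq_intros pair_derivs[OF that(1)])
      moreover have "((\<lambda>u. P u * R u) has_real_derivative P1 u * R u + P u * R1 u) (at u)"
        unfolding that(2-) by (auto intro!: derivative_eq_intros pair_derivs[OF that(1)])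
      then have "((\<lambda>u. J u * J u) has_real_derivative P1 u * R u + P u * R1 u) (at u)"
        by (rule has_field_derivative_transform_within_open[OF _ open_I that(1)])
           (use conic in \<open>simp add: that(2-) power2_eq_square\<close>)
      ultimately have "J1 u * J u + J u * J1 u = P1 u * R u + P u * R1 u" by (rule DERIV_unique)
      then show ?thesis by (simp add: mult.commute)
    qed
    have c1: "2 * J * J' = P' * R + P * R'"
      using d1[OF Z(1) refl refl refl refl refl refl] by (simp add: defs)
    have c2: "2 * (J' * J' + J * J'') = P'' * R + 2 * P' * R' + P * R''"
    proof -
      have "((\<lambda>u. 2 * lform (e0 u) j * lform (e1 u) j) has_real_derivative 2 * (J' * J' + J * J'')) (at u1)"
        unfolding defs by (auto intro!: derivative_eq_intros pair_derivs[OF Z(1)] simp: algebra_simps)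
      moreover have "((\<lambda>u. lform (e1 u) p1 * lform (e0 u) p2 + lform (e0 u) p1 * lform (e1 u) p2)
          has_real_derivative P'' * R + 2 * P' * R' + P * R'') (at u1)"
        unfolding defs by (auto intro!: derivative_eq_intros pair_derivs[OF Z(1)] simp: algebra_simps)
      then have "((\<lambda>u. 2 * lform (e0 u) j * lform (e1 u) j) has_real_derivative
          P'' * R + 2 * P' * R' + P * R'') (at u1)"
        by (rule has_field_derivative_transform_within_open[OF _ open_I Z(1)])
           (rule d1[OF _ refl refl refl refl refl refl, symmetric])
      ultimately show ?thesis by (rule DERIV_unique)
    qed
    have imm1: "P * J' - J * P' \<noteq> 0" using imm[OF Z(1)] by (simp add: defs)
    have s0: "lform (e0 u1) (ps s) = 0"
    proof -
      have "J\<^sup>2 * (P + 2 * s * J + s\<^sup>2 * R) = 0" using sJ c0 by algebra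
      then show ?thesis using J by (simp add: ps_def lform_simps flip: defs)
    qed
    have s1: "lform (e1 u1) (ps s) = 0"
    proof -
      have "J^3 * (P' + 2 * s * J' + s\<^sup>2 * R') = 0" using sJ c0 c1 by algebra
      then show ?thesis using J by (simp add: ps_def lform_simps flip: defs)
    qed
    have s2: "lform (e2 u1) (ps s) \<noteq> 0"
    proof -
      have "J\<^sup>2 * P * (P'' + 2 * s * J'' + s\<^sup>2 * R'') = 2 * (P * J' - J * P')\<^sup>2" using sJ c0 c1 c2 by algebra
      then show ?thesis using imm1 J by (auto simp: ps_def lform_simps simp flip: defs)
    qed
    have "lform (ps s) l = 0" using pW by (simp add: ps_def lform_simps W_def)
    then have "ps s = lform (ps s) (e4 u1) *\<^sub>R e0 u1 - lform (ps s) (e3 u1) *\<^sub>R e1 u1 + lform (ps s) (e2 u1) *\<^sub>R e2 u1"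
      using lie_frame_expand[OF frame[OF Z(1)], of "ps s"] s0 s1 by (simp add: lform_commute[of "ps s"])
    from arg_cong[OF this, of "\<lambda>y. lform y (ps s)"]
    have "lform (ps s) (ps s) = lform (ps s) (e2 u1) * lform (e2 u1) (ps s)"
      unfolding lform.add_left lform.diff_left lform.scaleR_left real_scaleR_def s0 s1 by simp
    then have "lform (ps s) (ps s) \<noteq> 0" using s2 by (simp add: lform_commute)
    then show ?thesis by blast
  qed
  then obtain s where s: "s \<ge> 0" "lform (ps s) (ps s) \<noteq> 0"
    using quartic_nonzero_nonneg unfolding poly by metis
  define c where "c = 1 / sqrt \<bar>lform (ps s) (ps s)\<bar>"
  have c: "c > 0" "c * c = 1 / \<bar>lform (ps s) (ps s)\<bar>" using s(2) by (simp_all add: c_def)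
  show ?thesis
  proof (rule elastic_projection[of "c *\<^sub>R ps s" "js s" "(1 / c) *\<^sub>R p2"])
    show "lform (c *\<^sub>R ps s) l = 0" "lform (js s) l = 0" "lform ((1 / c) *\<^sub>R p2) l = 0"
      using pW by (simp_all add: ps_def js_def lform_simps W_def)
    have "lform (c *\<^sub>R ps s) (c *\<^sub>R ps s) = (c * c) * lform (ps s) (ps s)" by (simp add: lform_simps)
    then show "\<bar>lform (c *\<^sub>R ps s) (c *\<^sub>R ps s)\<bar> = 1" using s(2) by (simp add: c(2) abs_mult)
    fix u assume u: "u \<in> I"
    define P P' where "P = lform (e0 u) p1" and "P' = lform (e1 u) p1"
    define R R' where "R = lform (e0 u) p2" and "R' = lform (e1 u) p2"
    define J J' where "J = lform (e0 u) j" and "J' = lform (e1 u) j"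
    note defs = P_def P'_def R_def R'_def J_def J'_def
    have pos': "P > 0" "J > 0" "R > 0" using pos[OF u] by (simp_all add: defs)
    have c0: "J\<^sup>2 = P * R" using conic[OF u] by (simp add: defs)
    have "P + 2 * s * J + s\<^sup>2 * R > 0" using pos' s(1) by (simp add: add_pos_nonneg)
    then show "lform (e0 u) (c *\<^sub>R ps s) > 0" using c by (simp add: ps_def lform_simps flip: defs)
    have "(J + s * R)\<^sup>2 = (P + 2 * s * J + s\<^sup>2 * R) * R" using c0 by algebra
    then show "(lform (e0 u) (js s))\<^sup>2 = lform (e0 u) (c *\<^sub>R ps s) * lform (e0 u) ((1 / c) *\<^sub>R p2)"
      using c(1) by (simp add: ps_def js_def lform_simps flip: defs)
    have "P * J' - J * P' \<noteq> 0" using imm[OF u] by (simp add: defs)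
    have "((\<lambda>u. lform (e0 u) j * lform (e0 u) j) has_real_derivative J' * J + J * J') (at u)"
      unfolding defs by (auto intro!: derivative_eq_intros pair_derivs[OF u])
    moreover have "((\<lambda>u. lform (e0 u) p1 * lform (e0 u) p2) has_real_derivative P' * R + P * R') (at u)"
      unfolding defs by (auto intro!: derivative_eq_intros pair_derivs[OF u])
    then have "((\<lambda>u. lform (e0 u) j * lform (e0 u) j) has_real_derivative P' * R + P * R') (at u)"
      by (rule has_field_derivative_transform_within_open[OF _ open_I u])
         (use conic in \<open>simp add: power2_eq_square\<close>)
    ultimately have c1: "J' * J + J * J' = P' * R + P * R'" by (rule DERIV_unique)
    have "P\<^sup>2 * ((P + 2 * s * J + s\<^sup>2 * R) * (J' + s * R') - (J + s * R) * (P' + 2 * s * J' + s\<^sup>2 * R'))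
      = (P + s * J)\<^sup>2 * (P * J' - J * P')"
      using c0 c1 by algebra
    moreover have "(P + s * J)\<^sup>2 * (P * J' - J * P') \<noteq> 0"
      using pos' s(1) imm[OF u] by (auto simp: defs add_pos_nonneg less_imp_neq[symmetric])
    ultimately have "(P + 2 * s * J + s\<^sup>2 * R) * (J' + s * R') - (J + s * R) * (P' + 2 * s * J' + s\<^sup>2 * R') \<noteq> 0"
      by auto
    then have "c * ((P + 2 * s * J + s\<^sup>2 * R) * (J' + s * R') - (J + s * R) * (P' + 2 * s * J' + s\<^sup>2 * R')) \<noteq> 0"
      using c(1) by simp
    then show "lform (e0 u) (c *\<^sub>R ps s) * lform (e1 u) (js s) - lform (e0 u) (js s) * lform (e1 u) (c *\<^sub>R ps s) \<noteq> 0"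
      by (simp add: ps_def js_def lform_simps algebra_simps flip: defs)
  qed
qed

end

section \<open>Global sections of line bundles\<close>

lemma span_singleton_scale:
  fixes v :: "'a::real_vector"
  assumes "k \<noteq> 0"
  shows "span {k *\<^sub>R v} = span {v}"
proof -
  have "k *\<^sub>R v \<in> span {v}" by (simp add: span_scale span_base)
  moreover have "inverse k *\<^sub>R k *\<^sub>R v \<in> span {k *\<^sub>R v}"
    by (intro span_scale span_base) simp
  then have "v \<in> span {k *\<^sub>R v}" using assms by simp
  ultimately show ?thesis by (intro equalityI span_minimal) simp_all
qed

lemma line_bundle_local_section:
  fixes V :: "'a::euclidean_space \<Rightarrow> 'b::euclidean_space set"
  assumes "subbundle_on M 1 V" "x \<in> M"
  shows "\<exists>U n. open U \<and> x \<in> U \<and> U \<subseteq> M \<and> smooth_on U n \<and>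
    (\<forall>y\<in>U. norm (n y) = 1 \<and> V y = span {n y})"
proof -
  obtain U F where U: "open U" "x \<in> U" "U \<subseteq> M" "\<forall>i<(1::nat). smooth_on U (F i)"
    "\<forall>y\<in>U. V y = span ((\<lambda>i. F i y) ` {..<1})"
    using assms unfolding subbundle_on_def by blast
  define s where "s = F 0"
  have s: "smooth_on U s" using U(4) by (simp add: s_def)
  have V: "V y = span {s y}" if "y \<in> U" for y
    using U(5) that by (simp add: s_def lessThan_Suc)
  have s0: "s y \<noteq> 0" if "y \<in> U" for y
  proof
    assume "s y = 0"
    then have "dim (V y) = 0" using V[OF that] by simp
    moreover have "dim (V y) = 1" using assms(1) U(3) that unfolding subbundle_on_def by blast
    ultimately show False by simp
  qed
  define n where "n = (\<lambda>y. inverse (sqrt (s y \<bullet> s y)) *\<^sub>R s y)"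
  have "smooth_on U n"
    unfolding n_def using s0
    by (intro smooth_on_scaleR smooth_on_inverse smooth_on_sqrt smooth_on_inner U(1) s) auto
  moreover have "norm (n y) = 1" if "y \<in> U" for y
    using s0[OF that] by (simp add: n_def norm_eq_sqrt_inner[symmetric])
  moreover have "V y = span {n y}" if "y \<in> U" for y
    unfolding V[OF that] n_def using s0[OF that] by (intro span_singleton_scale[symmetric]) simp
  ultimately show ?thesis using U(1-3) by blast
qed

text \<open>The unit vectors of a line bundle form a two-sheeted covering, which has a section over a
  simply connected base.\<close>

lemma line_bundle_section:
  fixes V :: "'a::euclidean_space \<Rightarrow> 'b::euclidean_space set"
  assumes V: "subbundle_on M 1 V" and M: "open M" "convex M"
  obtains s where "smooth_on M s" "\<And>x. x \<in> M \<Longrightarrow> s x \<in> V x" "\<And>x. x \<in> M \<Longrightarrow> norm (s x) = 1"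
proof -
  define S where "S = {z. fst z \<in> M \<and> snd z \<in> V (fst z) \<and> norm (snd z) = 1}"
  have pm: "w = n \<or> w = - n" if "w \<in> span {n}" "norm w = 1" "norm n = 1" for w n :: 'b
  proof -
    obtain k where k: "w = k *\<^sub>R n" using \<open>w \<in> span {n}\<close> by (auto simp: span_singleton)
    then have "\<bar>k\<bar> = 1" using that by simp
    then show ?thesis using k by (auto simp: abs_if split: if_splits)
  qed
  have cov: "covering_space S fst M"
    unfolding covering_space_def
  proof (intro conjI ballI)
    show "continuous_on S fst" by (rule continuous_on_fst[OF continuous_on_id])
    show "fst ` S = M"
    proof
      show "M \<subseteq> fst ` S"
      proof
        fix x assume x: "x \<in> M"
        obtain U n where U: "x \<in> U" "\<forall>y\<in>U. norm (n y) = 1 \<and> V y = span {n y}"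
          using line_bundle_local_section[OF V x] by blast
        then have "(x, n x) \<in> S" using x by (simp add: S_def span_base)
        then show "x \<in> fst ` S" by force
      qed
    qed (auto simp: S_def)
    fix x assume x: "x \<in> M"
    obtain U n where U: "open U" "x \<in> U" "U \<subseteq> M" "smooth_on U n"
      and nU: "\<forall>y\<in>U. norm (n y) = 1 \<and> V y = span {n y}"
      using line_bundle_local_section[OF V x] by blast
    have n: "norm (n y) = 1" "V y = span {n y}" if "y \<in> U" for y
      using nU that by simp_all
    define A where "A = (\<lambda>e::real. {(y, e *\<^sub>R n y) | y. y \<in> U})"
    have cn: "continuous_on U n" using U(4) smooth_on_imp_continuous_on by blast
    have nn: "n y \<bullet> n y = 1" if "y \<in> U" for y using n(1)[OF that] by (simp add: dot_square_norm)
    have op: "openin (top_of_set S) (A e)" if e: "e = 1 \<or> e = -1" for e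
    proof -
      have "continuous_on (U \<times> UNIV) (\<lambda>z. e * (snd z \<bullet> n (fst z)))"
        by (intro continuous_intros continuous_on_compose2[OF cn]) auto
      then have "open ((U \<times> UNIV) \<inter> (\<lambda>z. e * (snd z \<bullet> n (fst z))) -` {0<..})"
        by (intro continuous_open_preimage) (use U(1) in \<open>auto simp: open_Times\<close>)
      moreover have "A e = S \<inter> ((U \<times> UNIV) \<inter> (\<lambda>z. e * (snd z \<bullet> n (fst z))) -` {0<..})"
      proof (intro set_eqI iffI)
        fix z assume "z \<in> A e"
        then obtain y where y: "z = (y, e *\<^sub>R n y)" "y \<in> U" by (auto simp: A_def)
        show "z \<in> S \<inter> ((U \<times> UNIV) \<inter> (\<lambda>z. e * (snd z \<bullet> n (fst z))) -` {0<..})"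
          using y e U(3) n[OF y(2)] nn[OF y(2)]
          by (auto simp: S_def span_base span_neg)
      next
        fix z assume z: "z \<in> S \<inter> ((U \<times> UNIV) \<inter> (\<lambda>z. e * (snd z \<bullet> n (fst z))) -` {0<..})"
        then have y: "fst z \<in> U" "snd z \<in> V (fst z)" "norm (snd z) = 1" "e * (snd z \<bullet> n (fst z)) > 0"
          by (auto simp: S_def)
        have "snd z = n (fst z) \<or> snd z = - n (fst z)"
          using pm n[OF y(1)] y(2,3) by blast
        then have "snd z = e *\<^sub>R n (fst z)"
          using y(4) e nn[OF y(1)] by auto
        then show "z \<in> A e" using y(1) unfolding A_def by (metis (mono_tags, lifting) mem_Collect_eq prod.collapse)
      qed
      ultimately show ?thesis by (simp add: openin_open) blast
    qed
    have hom: "homeomorphism (A e) U fst (\<lambda>y. (y, e *\<^sub>R n y))" for e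
      unfolding homeomorphism_def A_def
      by (auto intro!: continuous_intros cn continuous_on_fst image_eqI) 
    have disj: "A 1 \<inter> A (-1) = {}"
    proof (rule ccontr)
      assume "A 1 \<inter> A (-1) \<noteq> {}"
      then obtain y where y: "y \<in> U" "n y = - n y" by (auto simp: A_def)
      then have "2 *\<^sub>R n y = 0" by (metis add.right_inverse scaleR_2)
      then show False using n(1)[OF y(1)] by simp
    qed
    have un: "\<Union>{A 1, A (-1)} = S \<inter> fst -` U"
    proof (intro set_eqI iffI)
      fix z assume "z \<in> \<Union>{A 1, A (-1)}"
      then obtain y where "z = (y, n y) \<or> z = (y, - n y)" "y \<in> U" by (auto simp: A_def)
      then show "z \<in> S \<inter> fst -` U" using n[of y] U(3) by (auto simp: S_def span_base span_neg)
    next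
      fix z assume "z \<in> S \<inter> fst -` U"
      then have y: "fst z \<in> U" "snd z \<in> V (fst z)" "norm (snd z) = 1" by (auto simp: S_def)
      have "snd z = 1 *\<^sub>R n (fst z) \<or> snd z = (- 1) *\<^sub>R n (fst z)"
        using pm n[OF y(1)] y(2,3) by auto
      then have "z = (fst z, 1 *\<^sub>R n (fst z)) \<or> z = (fst z, (- 1) *\<^sub>R n (fst z))"
        by (metis prod.collapse)
      then show "z \<in> \<Union>{A 1, A (-1)}" using y(1) unfolding A_def by blast
    qed
    show "\<exists>T. x \<in> T \<and> openin (top_of_set M) T \<and>
      (\<exists>v. \<Union>v = S \<inter> fst -` T \<and> (\<forall>u\<in>v. openin (top_of_set S) u) \<and> pairwise disjnt v \<and>
        (\<forall>u\<in>v. \<exists>q. homeomorphism u T fst q))"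
    proof (intro exI[of _ U] conjI exI[of _ "{A 1, A (-1)}"])
      show "openin (top_of_set M) U" using U(1,3) by (simp add: open_subset)
      show "\<forall>u\<in>{A 1, A (-1)}. openin (top_of_set S) u" using op by simp
      show "pairwise disjnt {A 1, A (-1)}"
        using disj by (auto simp: pairwise_insert disjnt_def Int_commute)
      show "\<forall>u\<in>{A 1, A (-1)}. \<exists>q. homeomorphism u U fst q" using hom by blast
    qed (use U(2) un in auto)
  qed
  have "simply_connected M" using M(2) by (rule convex_imp_simply_connected)
  moreover have "locally path_connected M" using M(1) by (rule open_imp_locally_path_connected)
  ultimately obtain q where q: "continuous_on M q" "q \<in> M \<rightarrow> S" "\<And>y. y \<in> M \<Longrightarrow> fst (q y) = y"
    using covering_space_lift[OF cov _ _ continuous_on_id, of M] by (metis Pi_I)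
  define s where "s = (\<lambda>y. snd (q y))"
  have s: "s y \<in> V y" "norm (s y) = 1" if "y \<in> M" for y
  proof -
    have "q y \<in> S" using q(2) that by (rule funcset_mem)
    then show "s y \<in> V y" "norm (s y) = 1" using q(3)[OF that] by (simp_all add: s_def S_def)
  qed
  have cs: "continuous_on M s" unfolding s_def using q(1) by (rule continuous_on_snd)
  have "smooth_on M s"
  proof (rule smooth_on_local[OF M(1)])
    fix x assume x: "x \<in> M"
    obtain U n where U: "open U" "x \<in> U" "U \<subseteq> M" "smooth_on U n"
      and nU: "\<forall>y\<in>U. norm (n y) = 1 \<and> V y = span {n y}"
      using line_bundle_local_section[OF V x] by blast
    have n: "norm (n y) = 1" "V y = span {n y}" if "y \<in> U" for y
      using nU that by simp_all
    have snn: "s y = n y \<or> s y = - n y" if "y \<in> U" for y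
      using pm n[OF that] s[of y] U(3) that by blast
    have nn: "n y \<bullet> n y = 1" if "y \<in> U" for y using n(1)[OF that] by (simp add: dot_square_norm)
    define e where "e = s x \<bullet> n x"
    have e: "e = 1 \<or> e = -1" using snn[OF U(2)] nn[OF U(2)] by (auto simp: e_def)
    define U' where "U' = U \<inter> (\<lambda>y. e * (s y \<bullet> n y)) -` {0<..}"
    have "continuous_on U (\<lambda>y. e * (s y \<bullet> n y))"
      by (intro continuous_intros continuous_on_subset[OF cs U(3)] smooth_on_imp_continuous_on[OF U(4)])
    then have oU': "open U'"
      unfolding U'_def by (intro continuous_open_preimage U(1)) auto
    have eq: "e *\<^sub>R n y = s y" if "y \<in> U'" for y
    proof -
      have y: "y \<in> U" "e * (s y \<bullet> n y) > 0" using that by (auto simp: U'_def)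
      then show ?thesis using snn[OF y(1)] nn[OF y(1)] e by auto
    qed
    have "smooth_on U' (\<lambda>y. e *\<^sub>R n y)"
      by (intro smooth_on_scaleR smooth_on_const oU' smooth_on_subset[OF U(1) _ oU' U(4)]) (auto simp: U'_def)
    from smooth_on_cong[OF oU' _ this, of s] have "smooth_on U' s" by (simp add: eq)
    moreover have "x \<in> U'" using U(2) e snn[OF U(2)] nn[OF U(2)] by (auto simp: U'_def e_def)
    ultimately show "\<exists>U. open U \<and> x \<in> U \<and> smooth_on U s" using oU' by blast
  qed
  then show ?thesis using that s by blast
qed

text \<open>For a line bundle the immersion condition can be tested on one section without zeros.\<close>

lemma immersed_line_bundle:
  fixes V :: "'a::euclidean_space \<Rightarrow> 'b::euclidean_space set"
  assumes M: "open M" "x \<in> M" and V: "immersed_on M V"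
    and s: "smooth_on M s" "\<And>y. y \<in> M \<Longrightarrow> s y \<noteq> 0" "\<And>y. y \<in> M \<Longrightarrow> V y = span {s y}"
    and X: "dder s x X \<in> span {s x}"
  shows "X = 0"
proof -
  have "dder \<rho> x X \<in> V x" if \<rho>: "\<rho> \<in> sections M V" for \<rho>
  proof -
    define k where "k = (\<lambda>y. (\<rho> y \<bullet> s y) / (s y \<bullet> s y))"
    have sm: "smooth_on M \<rho>" using \<rho> by (simp add: sections_def)
    have k: "smooth_on M k"
      unfolding k_def by (intro smooth_on_divide smooth_on_inner M(1) sm s(1)) (use s(2) in simp)
    have eq: "k y *\<^sub>R s y = \<rho> y" if "y \<in> M" for y
    proof -
      have "\<rho> y \<in> span {s y}" using \<rho> that s(3) by (auto simp: sections_def)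
      then obtain r where "\<rho> y = r *\<^sub>R s y" by (auto simp: span_singleton)
      then show ?thesis using s(2)[OF that] by (simp add: k_def)
    qed
    have "dder \<rho> x X = dder (\<lambda>y. k y *\<^sub>R s y) x X"
      by (rule dder_cong[OF M _ sm]) (simp add: eq)
    also have "\<dots> = dder k x X *\<^sub>R s x + k x *\<^sub>R dder s x X"
      by (rule dder_scaleR[OF M(1) k s(1) M(2)])
    finally show ?thesis
      using X by (simp add: s(3)[OF M(2)] span_add span_scale span_base)
  qed
  then show ?thesis using V M(2) unfolding immersed_on_def by blast
qed

section \<open>Derivatives of sections of a null plane bundle\<close>

lemma smooth_on_lform [smooth_intros]:
  "open M \<Longrightarrow> smooth_on M F \<Longrightarrow> smooth_on M G \<Longrightarrow> smooth_on M (\<lambda>x. lform (F x) (G x))"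
  by (rule smooth_on_bilinear[OF _ bounded_bilinear_lform])

lemma dder_lform:
  assumes "open M" "smooth_on M F" "smooth_on M G" "x \<in> M"
  shows "dder (\<lambda>x. lform (F x) (G x)) x X = lform (dder F x X) (G x) + lform (F x) (dder G x X)"
  by (rule dder_bilinear[OF assms(1) bounded_bilinear_lform assms(2-4)])

lemma dder_lform_const:
  assumes "open M" "smooth_on M F" "smooth_on M G" "x \<in> M" "\<And>y. y \<in> M \<Longrightarrow> lform (F y) (G y) = k"
  shows "lform (dder F x X) (G x) + lform (F x) (dder G x X) = 0"
  using dder_lform[OF assms(1-4), of X] dder_zero_on[OF assms(1,4), of "\<lambda>y. lform (F y) (G y)" k X] assms(5)
  by simp

text \<open>Cramer's rule in the coordinates \<open>5\<close> and \<open>6\<close>: a multiple of \<open>\<rho>\<close> is a combination of \<open>a\<close> and \<open>b\<close> with smooth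
  coefficients, and the factor does not vanish at \<open>x\<close>.\<close>

lemma bundle_section_derivative:
  fixes a b \<rho> :: "'a::euclidean_space \<Rightarrow> R42"
  assumes M: "open M" "x \<in> M" and sm: "smooth_on M \<rho>" "smooth_on M a" "smooth_on M b"
    and \<rho>: "\<And>y. y \<in> M \<Longrightarrow> \<rho> y \<in> span {a y, b y}"
    and D: "a x$5 * b x$6 - a x$6 * b x$5 \<noteq> 0"
  obtains \<alpha> \<beta> \<gamma> \<delta> where
    "dder \<rho> x X = \<alpha> *\<^sub>R a x + \<beta> *\<^sub>R b x + \<gamma> *\<^sub>R dder a x X + \<delta> *\<^sub>R dder b x X"
proof -
  have comp: "smooth_on M (\<lambda>y. F y $ i)" if "smooth_on M F" for F :: "'a \<Rightarrow> R42" and i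
    by (rule smooth_on_bounded_linear[OF M(1) bounded_linear_vec_nth that])
  define d A B where "d = (\<lambda>y. a y$5 * b y$6 - a y$6 * b y$5)"
    and "A = (\<lambda>y. \<rho> y$5 * b y$6 - \<rho> y$6 * b y$5)" and "B = (\<lambda>y. a y$5 * \<rho> y$6 - a y$6 * \<rho> y$5)"
  have smd: "smooth_on M d" "smooth_on M A" "smooth_on M B"
    unfolding d_def A_def B_def by (intro smooth_on_diff smooth_on_mult M(1) comp sm)+
  have eq: "A y *\<^sub>R a y + B y *\<^sub>R b y = d y *\<^sub>R \<rho> y" if y: "y \<in> M" for y
  proof -
    obtain s t where st: "\<rho> y = s *\<^sub>R a y + t *\<^sub>R b y" using \<rho>[OF y] by (auto simp: in_span2)
    have "A y = s * d y" "B y = t * d y" by (simp_all add: A_def B_def d_def st algebra_simps)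
    then show ?thesis by (simp add: st algebra_simps)
  qed
  have "dder (\<lambda>y. d y *\<^sub>R \<rho> y) x X = dder (\<lambda>y. A y *\<^sub>R a y + B y *\<^sub>R b y) x X"
    by (rule dder_cong[OF M _ smooth_on_scaleR[OF M(1) smd(1) sm(1)]]) (simp add: eq)
  then have e: "dder d x X *\<^sub>R \<rho> x + d x *\<^sub>R dder \<rho> x X
    = dder A x X *\<^sub>R a x + A x *\<^sub>R dder a x X + (dder B x X *\<^sub>R b x + B x *\<^sub>R dder b x X)"
    by (simp add: dder_scaleR[OF M(1) _ _ M(2)] dder_add[OF M(1) _ _ M(2)] smooth_on_scaleR[OF M(1)] smd sm)
  obtain s t where st: "\<rho> x = s *\<^sub>R a x + t *\<^sub>R b x" using \<rho>[OF M(2)] by (auto simp: in_span2)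
  have d: "d x \<noteq> 0" using D by (simp add: d_def)
  have "d x *\<^sub>R dder \<rho> x X = (dder A x X - dder d x X * s) *\<^sub>R a x + (dder B x X - dder d x X * t) *\<^sub>R b x
    + A x *\<^sub>R dder a x X + B x *\<^sub>R dder b x X"
    using e by (simp add: st algebra_simps)
  then have "inverse (d x) *\<^sub>R d x *\<^sub>R dder \<rho> x X = inverse (d x) *\<^sub>R ((dder A x X - dder d x X * s) *\<^sub>R a x + (dder B x X - dder d x X * t) *\<^sub>R b x
    + A x *\<^sub>R dder a x X + B x *\<^sub>R dder b x X)" by simp
  then have "dder \<rho> x X = (inverse (d x) * (dder A x X - dder d x X * s)) *\<^sub>R a x
      + (inverse (d x) * (dder B x X - dder d x X * t)) *\<^sub>R b x
      + (inverse (d x) * A x) *\<^sub>R dder a x X + (inverse (d x) * B x) *\<^sub>R dder b x X"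
    using d by (simp add: scaleR_add_right)
  then show ?thesis by (rule that)
qed

section \<open>Moving frames of surfaces with spherical curvature lines\<close>

text \<open>A Legendre map \<open>f\<close> in curvature line coordinates, with sections \<open>c\<close> and \<open>t\<close> of its curvature
  sphere congruences, and a unit vector \<open>l\<close> perpendicular to \<open>f\<close> that does not depend on \<open>u\<close>. The first
  section is scaled such that its second derivative in direction \<open>u\<close> is a unit vector, so that the
  adapted frame needs no further normalisation. The congruences are immersed (\<open>imm_c\<close>, \<open>imm_t\<close>).\<close>

locale spherical_surface =
  fixes I1 I2 :: "real set" and f :: "real \<times> real \<Rightarrow> R42 set" and c t l :: "real \<times> real \<Rightarrow> R42"
  assumes I1: "open_interval I1" and I2: "open_interval I2"
    and sm: "smooth_on (I1 \<times> I2) c" "smooth_on (I1 \<times> I2) t" "smooth_on (I1 \<times> I2) l"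
    and null: "x \<in> I1 \<times> I2 \<Longrightarrow> f x \<in> null_planes"
    and legendre: "\<rho> \<in> sections (I1 \<times> I2) f \<Longrightarrow> x \<in> I1 \<times> I2 \<Longrightarrow> dder \<rho> x X \<in> lperp (f x)"
    and c_f: "x \<in> I1 \<times> I2 \<Longrightarrow> c x \<in> f x" "x \<in> I1 \<times> I2 \<Longrightarrow> pdu c x \<in> f x"
    and t_f: "x \<in> I1 \<times> I2 \<Longrightarrow> t x \<in> f x" "x \<in> I1 \<times> I2 \<Longrightarrow> pdv t x \<in> f x"
    and ct: "x \<in> I1 \<times> I2 \<Longrightarrow> indep2 (c x) (t x)"
    and c_unit: "x \<in> I1 \<times> I2 \<Longrightarrow> lform (pdu (pdu c) x) (pdu (pdu c) x) = 1"
    and imm_c: "x \<in> I1 \<times> I2 \<Longrightarrow> dder c x X \<in> span {c x} \<Longrightarrow> X = 0"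
    and imm_t: "x \<in> I1 \<times> I2 \<Longrightarrow> dder t x X \<in> span {t x} \<Longrightarrow> X = 0"
    and l_unit: "x \<in> I1 \<times> I2 \<Longrightarrow> lform (l x) (l x) = 1"
    and l_perp: "x \<in> I1 \<times> I2 \<Longrightarrow> l x \<in> lperp (f x)"
    and l_u: "x \<in> I1 \<times> I2 \<Longrightarrow> pdu l x = 0"
begin

abbreviation "M \<equiv> I1 \<times> I2"

lemma open_M [simp]: "open M"
  using I1 I2 by (simp add: open_interval_def open_Times)

lemmas d_const = dder_lform_const[OF open_M]
lemmas mixed = mixed_derivatives_commute[OF open_M]

lemma perp_f: "x \<in> M \<Longrightarrow> y \<in> f x \<Longrightarrow> z \<in> lperp (f x) \<Longrightarrow> lform y z = 0"
  by (simp add: lperp_def)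

text \<open>The derivatives of \<open>c\<close> along the \<open>u\<close>-lines.\<close>

definition c1 where "c1 = pdu c"
definition c2 where "c2 = pdu c1"
definition c3 where "c3 = pdu c2"

lemma sm_ci [simp]: "smooth_on M c" "smooth_on M c1" "smooth_on M c2" "smooth_on M c3"
  "smooth_on M t" "smooth_on M l"
  unfolding c1_def c2_def c3_def by (intro smooth_on_dder sm)+

lemma sections_f: "c \<in> sections M f" "c1 \<in> sections M f"
  using c_f by (simp_all add: sections_def c1_def sm smooth_on_dder)

lemma c_gram:
  assumes "x \<in> M"
  shows "lform (c x) (c x) = 0" "lform (c x) (c1 x) = 0" "lform (c1 x) (c1 x) = 0"
    "lform (c x) (c2 x) = 0" "lform (c1 x) (c2 x) = 0" "lform (c2 x) (c2 x) = 1"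
  using null_planes_D(3)[OF null[OF assms]] c_f[OF assms] perp_f[OF assms]
    legendre[OF sections_f(2) assms] c_unit[OF assms]
  by (auto simp: c1_def c2_def)

lemma c3_gram:
  assumes x: "x \<in> M"
  shows "lform (c x) (c3 x) = 0" "lform (c1 x) (c3 x) = -1" "lform (c2 x) (c3 x) = 0"
proof -
  have e: "pdu c = c1" "pdu c1 = c2" "pdu c2 = c3" by (simp_all add: c1_def c2_def c3_def)
  show "lform (c x) (c3 x) = 0"
    using d_const[OF sm_ci(1,3) x c_gram(4), of "(1, 0)"] c_gram[OF x]
    by (simp add: fun_cong[OF e(1)] fun_cong[OF e(3)])
  show "lform (c1 x) (c3 x) = -1"
    using d_const[OF sm_ci(2,3) x c_gram(5), of "(1, 0)"] c_gram[OF x]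
    by (simp add: fun_cong[OF e(2)] fun_cong[OF e(3)])
  show "lform (c2 x) (c3 x) = 0"
    using d_const[OF sm_ci(3,3) x c_gram(6), of "(1, 0)"]
    by (simp add: fun_cong[OF e(3)] lform_commute)
qed

lemma l_pdu_perp:
  assumes "smooth_on M F" "\<And>y. y \<in> M \<Longrightarrow> lform (F y) (l y) = 0" "x \<in> M"
  shows "lform (pdu F x) (l x) = 0"
  using d_const[OF assms(1) sm(3) assms(3,2), of "(1, 0)"] l_u[OF assms(3)] by (simp add: lform_simps)

lemma c_l: "x \<in> M \<Longrightarrow> lform (c x) (l x) = 0" "x \<in> M \<Longrightarrow> lform (c1 x) (l x) = 0"
  "x \<in> M \<Longrightarrow> lform (c2 x) (l x) = 0" "x \<in> M \<Longrightarrow> lform (c3 x) (l x) = 0"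
proof -
  show 0: "lform (c x) (l x) = 0" if "x \<in> M" for x using perp_f[OF that c_f(1) l_perp] that by blast
  show 1: "lform (c1 x) (l x) = 0" if "x \<in> M" for x unfolding c1_def by (rule l_pdu_perp[OF sm(1) 0 that])
  show 2: "lform (c2 x) (l x) = 0" if "x \<in> M" for x unfolding c2_def by (rule l_pdu_perp[OF sm_ci(2) 1 that])
  show 3: "lform (c3 x) (l x) = 0" if "x \<in> M" for x unfolding c3_def by (rule l_pdu_perp[OF sm_ci(3) 2 that])
qed

text \<open>The frame \<open>c, c1, c2, e3, e4, l\<close>: null corrections of the third and fourth derivatives of \<open>c\<close>. The
  functions \<open>g\<close> and \<open>r\<close> are the invariants of the \<open>u\<close>-lines.\<close>

definition g where "g = (\<lambda>x. lform (c3 x) (c3 x))"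
definition e3 where "e3 = (\<lambda>x. c3 x + (g x / 2) *\<^sub>R c1 x)"
definition e3u where "e3u = pdu e3"
definition r where "r = (\<lambda>x. - (lform (e3u x) (e3u x) - (g x)\<^sup>2 / 4) / 2)"
definition e4 where "e4 = (\<lambda>x. e3u x + (g x / 2) *\<^sub>R c2 x + r x *\<^sub>R c x)"

lemma sm_half: "smooth_on M h \<Longrightarrow> smooth_on M (\<lambda>x. h x / (2::real))"
  by (rule smooth_on_bounded_linear[OF open_M bounded_linear_divide])

lemma sm_ei [simp]: "smooth_on M g" "smooth_on M e3" "smooth_on M e3u" "smooth_on M r" "smooth_on M e4"
proof -
  show 1: "smooth_on M g" unfolding g_def by (intro smooth_on_lform open_M sm_ci)
  show 2: "smooth_on M e3" unfolding e3_def by (intro smooth_on_add smooth_on_scaleR sm_half open_M sm_ci 1)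
  show 3: "smooth_on M e3u" unfolding e3u_def by (intro smooth_on_dder 2)
  have "smooth_on M (\<lambda>x. (g x)\<^sup>2 / 4)"
    by (rule smooth_on_bounded_linear[OF open_M bounded_linear_divide smooth_on_power2[OF open_M 1]])
  then show 4: "smooth_on M r"
    unfolding r_def by (intro sm_half smooth_on_minus smooth_on_diff smooth_on_lform open_M 3)
  show "smooth_on M e4"
    unfolding e4_def by (intro smooth_on_add smooth_on_scaleR sm_half open_M sm_ci 1 3 4)
qed

lemma e3_gram:
  assumes x: "x \<in> M"
  shows "lform (c x) (e3 x) = 0" "lform (c1 x) (e3 x) = -1" "lform (c2 x) (e3 x) = 0" "lform (e3 x) (e3 x) = 0"
    "lform (e3 x) (l x) = 0"
  using c_gram[OF x] c3_gram[OF x] c_l[OF x]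
  by (simp_all add: e3_def lform_simps lform_commute[of "c3 x" "c1 x"] lform_commute[of "c2 x" "c1 x"] g_def)

lemma e3u_gram:
  assumes x: "x \<in> M"
  shows "lform (c x) (e3u x) = 1" "lform (c1 x) (e3u x) = 0" "lform (c2 x) (e3u x) = - (g x / 2)"
    "lform (e3 x) (e3u x) = 0" "lform (e3u x) (l x) = 0"
proof -
  have e: "pdu c = c1" "pdu c1 = c2" "pdu c2 = c3" "pdu e3 = e3u" by (simp_all add: c1_def c2_def c3_def e3u_def)
  have c3: "c3 x = e3 x - (g x / 2) *\<^sub>R c1 x" by (simp add: e3_def)
  show "lform (c x) (e3u x) = 1"
    using d_const[OF sm_ci(1) sm_ei(2) x e3_gram(1), of "(1, 0)"] e3_gram[OF x]
    by (simp add: fun_cong[OF e(1)] fun_cong[OF e(4)])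
  show "lform (c1 x) (e3u x) = 0"
    using d_const[OF sm_ci(2) sm_ei(2) x e3_gram(2), of "(1, 0)"] e3_gram[OF x]
    by (simp add: fun_cong[OF e(2)] fun_cong[OF e(4)])
  show "lform (c2 x) (e3u x) = - (g x / 2)"
    using d_const[OF sm_ci(3) sm_ei(2) x e3_gram(3), of "(1, 0)"] e3_gram[OF x]
    by (simp add: fun_cong[OF e(3)] fun_cong[OF e(4)] c3 lform_simps)
  show "lform (e3 x) (e3u x) = 0"
    using d_const[OF sm_ei(2,2) x e3_gram(4), of "(1, 0)"]
    by (simp add: fun_cong[OF e(4)] lform_commute)
  show "lform (e3u x) (l x) = 0"
    unfolding e3u_def by (rule l_pdu_perp[OF sm_ei(2) e3_gram(5) x])
qed

lemma frame:
  assumes x: "x \<in> M"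
  shows "lie_frame (c x) (c1 x) (c2 x) (e3 x) (e4 x) (l x)"
  unfolding lie_frame_def
  using c_gram[OF x] c_l[OF x] e3_gram[OF x] e3u_gram[OF x] l_unit[OF x]
  by (simp add: e4_def lform_simps lform_commute[of "c2 x" "c x"] lform_commute[of "c2 x" "c1 x"]
      lform_commute[of "c1 x" "c x"] lform_commute[of "e3u x" "c x"] lform_commute[of "e3u x" "c1 x"]
      lform_commute[of "e3u x" "c2 x"] lform_commute[of "e3 x" "c x"] lform_commute[of "e3 x" "c2 x"])
     (simp add: r_def power2_eq_square field_simps)

lemmas gram = lie_frame_gram[OF frame]
lemmas expand = lie_frame_expand[OF frame]

lemma frenet:
  assumes x: "x \<in> M"
  shows "pdu c x = c1 x" "pdu c1 x = c2 x" "pdu c2 x = e3 x - (g x / 2) *\<^sub>R c1 x"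
    "pdu e3 x = e4 x - (g x / 2) *\<^sub>R c2 x - r x *\<^sub>R c x" "pdu e4 x = (- r x) *\<^sub>R c1 x"
proof -
  show 0: "pdu c x = c1 x" "pdu c1 x = c2 x" "pdu c2 x = e3 x - (g x / 2) *\<^sub>R c1 x"
    "pdu e3 x = e4 x - (g x / 2) *\<^sub>R c2 x - r x *\<^sub>R c x"
    by (simp_all add: c1_def c2_def c3_def e3_def e4_def e3u_def)
  note G = gram[OF x]
  note d = d_const[OF _ sm_ei(5) x, of _ _ "(1, 0)"]
  have "lform (pdu c x) (e4 x) + lform (c x) (pdu e4 x) = 0" by (rule d[OF sm_ci(1) gram(5)])
  then have 1: "lform (pdu e4 x) (c x) = 0" by (simp add: 0 G lform_commute[of _ "c x"])
  have "lform (pdu c1 x) (e4 x) + lform (c1 x) (pdu e4 x) = 0" by (rule d[OF sm_ci(2) gram(11)])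
  then have 2: "lform (pdu e4 x) (c1 x) = 0" by (simp add: 0 G lform_commute[of _ "c1 x"])
  have "lform (pdu c2 x) (e4 x) + lform (c2 x) (pdu e4 x) = 0" by (rule d[OF sm_ci(3) gram(17)])
  then have 3: "lform (pdu e4 x) (c2 x) = 0" by (simp add: 0 G lform_simps lform_commute[of _ "c2 x"])
  have "lform (pdu e3 x) (e4 x) + lform (e3 x) (pdu e4 x) = 0" by (rule d[OF sm_ei(2) gram(23)])
  then have 4: "lform (pdu e4 x) (e3 x) = r x" by (simp add: 0 G lform_simps lform_commute[of _ "e3 x"])
  have "lform (pdu e4 x) (e4 x) + lform (e4 x) (pdu e4 x) = 0" by (rule d[OF sm_ei(5) gram(29)])
  then have 5: "lform (pdu e4 x) (e4 x) = 0" by (simp add: lform_commute)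
  have 6: "lform (pdu e4 x) (l x) = 0" by (rule l_pdu_perp[OF sm_ei(5) gram(30) x])
  show "pdu e4 x = (- r x) *\<^sub>R c1 x"
    using expand[OF x, of "pdu e4 x"] by (simp add: 1 2 3 4 5 6)
qed

subsection \<open>The second curvature direction\<close>

text \<open>Vector fields perpendicular to \<open>l\<close> that are parallel along the \<open>v\<close>-lines for the connection induced
  on the orthogonal complement of \<open>l\<close>. As \<open>l\<close> does not depend on \<open>u\<close>, their derivatives along the \<open>u\<close>-lines
  are parallel as well.\<close>

definition parallel :: "(real \<times> real \<Rightarrow> R42) \<Rightarrow> bool" where
  "parallel F \<longleftrightarrow> smooth_on M F \<and>
     (\<forall>x\<in>M. lform (F x) (l x) = 0 \<and> pdv F x = (- lform (F x) (pdv l x)) *\<^sub>R l x)"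

lemma sm_lv: "smooth_on M (pdv l)"
  by (rule smooth_on_dder[OF sm(3)])

lemma l_lv: assumes "x \<in> M" shows "lform (l x) (pdv l x) = 0"
  using d_const[OF sm(3) sm(3) assms l_unit, of "(0, 1)"] by (simp add: lform_commute)

lemma pdu_lv: assumes "x \<in> M" shows "pdu (pdv l) x = 0"
  using mixed[OF sm(3) assms] dder_zero_on[OF open_M assms, of "pdu l" 0 "(0, 1)"] l_u by simp

lemma parallelD:
  assumes "parallel F"
  shows "smooth_on M F" "x \<in> M \<Longrightarrow> lform (F x) (l x) = 0"
    "x \<in> M \<Longrightarrow> pdv F x = (- lform (F x) (pdv l x)) *\<^sub>R l x"
  using assms by (auto simp: parallel_def)

lemma parallel_pdu:
  assumes F: "parallel F"
  shows "parallel (pdu F)"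
  unfolding parallel_def
proof (intro conjI ballI)
  note D = parallelD[OF F]
  show sF: "smooth_on M (pdu F)" by (rule smooth_on_dder[OF D(1)])
  fix x assume x: "x \<in> M"
  show "lform (pdu F x) (l x) = 0" by (rule l_pdu_perp[OF D(1,2) x])
  have s: "smooth_on M (\<lambda>y. - lform (F y) (pdv l y))"
    by (intro smooth_on_minus smooth_on_lform open_M D(1) sm_lv)
  have "pdv (pdu F) x = pdu (pdv F) x" by (rule mixed[OF D(1) x])
  also have "\<dots> = pdu (\<lambda>y. (- lform (F y) (pdv l y)) *\<^sub>R l y) x"
    by (rule dder_cong[OF open_M x D(3) smooth_on_dder[OF D(1)]])
  also have "\<dots> = (- lform (pdu F x) (pdv l x)) *\<^sub>R l x"
    by (subst dder_scaleR[OF open_M s sm(3) x], subst dder_minus[OF open_M smooth_on_lform[OF open_M D(1) sm_lv] x],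
        subst dder_lform[OF open_M D(1) sm_lv x])
       (simp add: l_u[OF x] pdu_lv[OF x] lform_simps)
  finally show "pdv (pdu F) x = (- lform (pdu F x) (pdv l x)) *\<^sub>R l x" .
qed

lemma parallel_add: "parallel F \<Longrightarrow> parallel G \<Longrightarrow> parallel (\<lambda>x. F x + G x)"
  unfolding parallel_def
  by (auto simp: smooth_on_add dder_add[OF open_M] lform_simps algebra_simps)

lemma parallel_scale:
  assumes "smooth_on M h" "\<And>x. x \<in> M \<Longrightarrow> pdv h x = 0" "parallel F"
  shows "parallel (\<lambda>x. h x *\<^sub>R F x)"
  using assms unfolding parallel_def
  by (auto simp: smooth_on_scaleR dder_scaleR[OF open_M] lform_simps)

lemma parallel_lform:
  assumes "parallel F" "parallel G" "x \<in> M"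
  shows "pdv (\<lambda>x. lform (F x) (G x)) x = 0"
  using parallelD[OF assms(1)] parallelD[OF assms(2)] assms(3)
  by (simp add: dder_lform[OF open_M] lform_simps lform_commute[of "l x"])

text \<open>All components of \<open>pdv c\<close> except that along \<open>l\<close> vanish. The key is that the derivative of \<open>c1\<close> is
  perpendicular to \<open>c2\<close>: modulo \<open>c\<close>, the section \<open>c1\<close> is a multiple of \<open>t\<close>, whose derivative lies in \<open>f\<close>. The
  other relations follow by differentiating in direction \<open>u\<close> and from the normalisation of \<open>c\<close>.\<close>

lemma pdv_c_gram:
  assumes x: "x \<in> M"
  shows "lform (pdv c x) (c x) = 0" "lform (pdv c x) (c1 x) = 0" "lform (pdv c x) (c2 x) = 0"
    "lform (pdv c1 x) (c2 x) = 0" "lform (pdv c x) (e3 x) = 0" "lform (pdv c x) (e4 x) = 0"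
    "lform (pdv c x) (l x) = - lform (c x) (pdv l x)"
proof -
  have sv: "smooth_on M (pdv c)" "smooth_on M (pdv c1)" by (intro smooth_on_dder sm_ci)+
  have f: "c x \<in> f x" "c1 x \<in> f x" "c2 x \<in> lperp (f x)" if "x \<in> M" for x
    using c_f[OF that] legendre[OF sections_f(2) that] by (simp_all add: c1_def c2_def)
  have A: "lform (pdv c x) y = 0" "lform (pdv c1 x) y = 0" if "x \<in> M" "y \<in> f x" for x y
    using perp_f[OF that legendre[OF sections_f(1) that(1)]] perp_f[OF that legendre[OF sections_f(2) that(1)]]
    by (simp_all add: lform_commute)
  have cv: "pdu (pdv c) x = pdv c1 x" if "x \<in> M" for x
    using mixed[OF sm(1) that] by (simp add: c1_def)
  have c1v: "pdu (pdv c1) x = pdv c2 x" if "x \<in> M" for x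
    using mixed[OF sm_ci(2) that] by (simp add: c2_def)
  show "lform (pdv c x) (c x) = 0" "lform (pdv c x) (c1 x) = 0" using A(1) f x by blast+
  have 2: "lform (pdv c x) (c2 x) = 0" if x: "x \<in> M" for x
    using d_const[OF sv(1) sm_ci(2) x A(1)[OF _ f(2)], of "(1, 0)"] A(2)[OF x f(2)[OF x]]
    by (simp add: cv[OF x] frenet[OF x])
  have 3: "lform (pdv c1 x) (c2 x) = 0" if x: "x \<in> M" for x
  proof -
    have "c1 y \<in> span {c y, t y}" if "y \<in> M" for y
      using plane_eq_span[OF null_planes_D(1,2)[OF null[OF that]] c_f(1)[OF that] t_f(1)[OF that] ct[OF that]]
        f(2)[OF that] by simp
    then obtain \<alpha> \<beta> \<gamma> \<delta> where
      "pdv c1 x = \<alpha> *\<^sub>R c x + \<beta> *\<^sub>R t x + \<gamma> *\<^sub>R pdv c x + \<delta> *\<^sub>R pdv t x"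
      using bundle_section_derivative[OF open_M x sm_ci(2) sm(1,2) _
          null_plane_det[OF null[OF x] c_f(1)[OF x] t_f(1)[OF x] ct[OF x]]] by blast
    then show ?thesis
      using perp_f[OF x _ f(3)[OF x]] f(1)[OF x] t_f[OF x] 2[OF x] by (simp add: lform_simps)
  qed
  show "lform (pdv c x) (c2 x) = 0" "lform (pdv c1 x) (c2 x) = 0" using 2 3 x by blast+
  have 4: "lform (pdv c x) (c3 x) = 0" if x: "x \<in> M" for x
    using d_const[OF sv(1) sm_ci(3) x 2, of "(1, 0)"] 3[OF x] by (simp add: cv[OF x] c3_def)
  have e3: "lform (pdv c x) (e3 x) = 0" if x: "x \<in> M" for x
    using 4[OF x] A(1)[OF x f(2)[OF x]] by (simp add: e3_def lform_simps)
  show "lform (pdv c x) (e3 x) = 0" by (rule e3[OF x])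
  have "lform (pdv c2 x) (c2 x) = 0"
    using d_const[OF sm_ci(3,3) x c_gram(6), of "(0, 1)"] by (simp add: lform_commute)
  then have "lform (pdv c1 x) (c3 x) = 0"
    using d_const[OF sv(2) sm_ci(3) x 3, of "(1, 0)"] by (simp add: c1v[OF x] c3_def)
  then have "lform (pdv c1 x) (e3 x) = 0"
    using A(2)[OF x f(2)[OF x]] by (simp add: e3_def lform_simps)
  then have "lform (pdv c x) (e3u x) = 0"
    using d_const[OF sv(1) sm_ei(2) x e3, of "(1, 0)"] by (simp add: cv[OF x] e3u_def)
  then show "lform (pdv c x) (e4 x) = 0"
    using 2[OF x] A(1)[OF x f(1)[OF x]] by (simp add: e4_def lform_simps)
  show "lform (pdv c x) (l x) = - lform (c x) (pdv l x)"
    using d_const[OF sm(1,3) x c_l(1), of "(0, 1)"] by simp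
qed

lemma parallel_c: "parallel c"
  unfolding parallel_def
proof (intro conjI ballI sm(1) c_l(1); assumption?)
  fix x assume x: "x \<in> M"
  show "pdv c x = (- lform (c x) (pdv l x)) *\<^sub>R l x"
    using expand[OF x, of "pdv c x"] by (simp add: pdv_c_gram[OF x])
qed

lemma parallel_frame: "parallel c" "parallel c1" "parallel c2" "parallel e3" "parallel e4"
  and pdv_invariants: "x \<in> M \<Longrightarrow> pdv g x = 0" "x \<in> M \<Longrightarrow> pdv r x = 0"
proof -
  show p: "parallel c" "parallel c1" "parallel c2"
    unfolding c1_def c2_def by (intro parallel_pdu parallel_c)+
  have p3: "parallel c3" unfolding c3_def by (intro parallel_pdu p)
  show g: "pdv g x = 0" if "x \<in> M" for x unfolding g_def by (rule parallel_lform[OF p3 p3 that])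
  have half: "pdv (\<lambda>x. h x / k) x = 0" if "smooth_on M h" "pdv h x = 0" "x \<in> M" for h :: "real \<times> real \<Rightarrow> real" and k x
    using dder_bounded_linear[OF open_M bounded_linear_divide[of k] that(1,3), of "(0, 1)"] that(2) by simp
  show p4: "parallel e3"
    unfolding e3_def by (intro parallel_add parallel_scale p p3 sm_half sm_ei half g)
  have pu: "parallel e3u" unfolding e3u_def by (rule parallel_pdu[OF p4])
  show r: "pdv r x = 0" if x: "x \<in> M" for x
  proof -
    have g2: "smooth_on M (\<lambda>x. (g x)\<^sup>2)" by (intro smooth_on_power2 open_M sm_ei)
    have g2v: "pdv (\<lambda>x. (g x)\<^sup>2) x = 0"
      unfolding power2_eq_square using dder_mult[OF open_M sm_ei(1,1) x, of "(0, 1)"] g[OF x] by simp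
    have s4: "smooth_on M (\<lambda>x. (g x)\<^sup>2 / 4)"
      by (rule smooth_on_bounded_linear[OF open_M bounded_linear_divide g2])
    have sl: "smooth_on M (\<lambda>x. lform (e3u x) (e3u x))" by (intro smooth_on_lform open_M sm_ei)
    have sd: "smooth_on M (\<lambda>x. lform (e3u x) (e3u x) - (g x)\<^sup>2 / 4)"
      by (intro smooth_on_diff open_M sl s4)
    have "pdv (\<lambda>x. lform (e3u x) (e3u x) - (g x)\<^sup>2 / 4) x = 0"
      by (simp add: dder_diff[OF open_M sl s4 x] parallel_lform[OF pu pu x] half[OF g2 g2v x])
    then have "pdv (\<lambda>x. - (lform (e3u x) (e3u x) - (g x)\<^sup>2 / 4)) x = 0"
      by (subst dder_minus[OF open_M sd x]) (simp only: minus_zero)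
    then show ?thesis
      unfolding r_def by (rule half[OF smooth_on_minus[OF open_M sd] _ x])
  qed
  show "parallel e4"
    unfolding e4_def by (intro parallel_add parallel_scale p pu sm_half sm_ei half g r)
qed

lemma M_nonzero:
  assumes x: "x \<in> M"
  shows "lform (c x) (pdv l x) \<noteq> 0"
proof
  assume "lform (c x) (pdv l x) = 0"
  then have "dder c x (0, 1) \<in> span {c x}"
    using parallelD(3)[OF parallel_c x] by (simp add: span_zero)
  from imm_c[OF x this] show False by (simp add: zero_prod_def)
qed

text \<open>The second curvature sphere congruence is spanned by the vector of \<open>f\<close> perpendicular to the
  derivative of \<open>l\<close>; it is immersed, so it varies with \<open>v\<close>.\<close>

lemma regular_second:
  assumes x: "x \<in> M"
  shows "lform (c x) (pdv l x) * pdv (\<lambda>x. lform (c1 x) (pdv l x)) x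
    - lform (c1 x) (pdv l x) * pdv (\<lambda>x. lform (c x) (pdv l x)) x \<noteq> 0"
proof
  define m0 m1 where "m0 = (\<lambda>x. lform (c x) (pdv l x))" and "m1 = (\<lambda>x. lform (c1 x) (pdv l x))"
  have sm01: "smooth_on M m0" "smooth_on M m1"
    unfolding m0_def m1_def by (intro smooth_on_lform open_M sm_ci sm_lv)+
  assume "lform (c x) (pdv l x) * pdv (\<lambda>x. lform (c1 x) (pdv l x)) x
    - lform (c1 x) (pdv l x) * pdv (\<lambda>x. lform (c x) (pdv l x)) x = 0"
  then have z: "m0 x * pdv m1 x = m1 x * pdv m0 x" by (simp add: m0_def m1_def)
  have tlv: "lform (t y) (pdv l y) = 0" if y: "y \<in> M" for y
    using d_const[OF sm(2,3) y perp_f[OF _ t_f(1) l_perp], of "(0, 1)"] perp_f[OF y t_f(2)[OF y] l_perp[OF y]]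
    by simp
  define b where "b = (\<lambda>y. lform (t y) (e3 y))"
  have smb: "smooth_on M b" unfolding b_def by (intro smooth_on_lform open_M sm sm_ei)
  have te: "t y = lform (t y) (e4 y) *\<^sub>R c y - b y *\<^sub>R c1 y" if y: "y \<in> M" for y
  proof -
    have "lform (t y) (c y) = 0" "lform (t y) (c1 y) = 0"
      using null_planes_D(3)[OF null[OF y] t_f(1)[OF y]] c_f[OF y] by (auto simp: c1_def)
    moreover have "lform (t y) (c2 y) = 0"
      using perp_f[OF y t_f(1)[OF y]] legendre[OF sections_f(2) y] by (simp add: c2_def)
    moreover have "lform (t y) (l y) = 0" by (rule perp_f[OF y t_f(1)[OF y] l_perp[OF y]])
    ultimately show ?thesis using expand[OF y, of "t y"] by (simp add: b_def)
  qed
  define \<rho> where "\<rho> = (\<lambda>y. m1 y *\<^sub>R c y - m0 y *\<^sub>R c1 y)"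
  have sm\<rho>: "smooth_on M \<rho>" unfolding \<rho>_def by (intro smooth_on_diff smooth_on_scaleR open_M sm01 sm_ci)
  have tr: "m0 y *\<^sub>R t y = b y *\<^sub>R \<rho> y" if y: "y \<in> M" for y
  proof -
    have "lform (t y) (e4 y) * m0 y - b y * m1 y = 0"
      using tlv[OF y] by (subst (asm) te[OF y]) (simp add: lform_simps m0_def m1_def)
    then have e: "lform (t y) (e4 y) * m0 y = b y * m1 y" by simp
    have "m0 y *\<^sub>R t y = (lform (t y) (e4 y) * m0 y) *\<^sub>R c y - (b y * m0 y) *\<^sub>R c1 y"
      by (subst te[OF y]) (simp add: algebra_simps)
    also have "\<dots> = b y *\<^sub>R \<rho> y" unfolding e \<rho>_def by (simp add: algebra_simps)
    finally show ?thesis .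
  qed
  have m0: "m0 x \<noteq> 0" using M_nonzero[OF x] by (simp add: m0_def)
  have "b x \<noteq> 0"
  proof
    assume "b x = 0"
    then have "t x = 0" using tr[OF x] m0 by simp
    then show False using ct[OF x, unfolded indep2_def, rule_format, of 0 1] by simp
  qed
  then have \<rho>t: "\<rho> x = (m0 x / b x) *\<^sub>R t x"
  proof -
    have "inverse (b x) *\<^sub>R m0 x *\<^sub>R t x = inverse (b x) *\<^sub>R b x *\<^sub>R \<rho> x" using tr[OF x] by simp
    then show ?thesis using \<open>b x \<noteq> 0\<close> by (simp add: divide_inverse mult.commute)
  qed
  have "pdv (\<lambda>y. m0 y *\<^sub>R t y) x = pdv (\<lambda>y. b y *\<^sub>R \<rho> y) x"
    by (rule dder_cong[OF open_M x tr smooth_on_scaleR[OF open_M sm01(1) sm(2)]])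
  then have 1: "pdv m0 x *\<^sub>R t x + m0 x *\<^sub>R pdv t x = pdv b x *\<^sub>R \<rho> x + b x *\<^sub>R pdv \<rho> x"
    by (simp add: dder_scaleR[OF open_M _ _ x] sm01 sm smb sm\<rho>)
  have 2: "pdv \<rho> x = pdv m1 x *\<^sub>R c x - pdv m0 x *\<^sub>R c1 x"
  proof -
    have "pdv \<rho> x = (pdv m1 x *\<^sub>R c x + m1 x *\<^sub>R pdv c x) - (pdv m0 x *\<^sub>R c1 x + m0 x *\<^sub>R pdv c1 x)"
      unfolding \<rho>_def
      by (simp add: dder_diff[OF open_M _ _ x] dder_scaleR[OF open_M _ _ x] sm01 smooth_on_scaleR)
    also have "\<dots> = pdv m1 x *\<^sub>R c x - pdv m0 x *\<^sub>R c1 x"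
      using parallelD(3)[OF parallel_frame(1) x] parallelD(3)[OF parallel_frame(2) x]
      by (simp add: m0_def m1_def)
    finally show ?thesis .
  qed
  have "m0 x *\<^sub>R pdv \<rho> x = pdv m0 x *\<^sub>R \<rho> x"
    unfolding 2 by (simp add: \<rho>_def scaleR_diff_right z mult.commute)
  then have 3: "m0 x *\<^sub>R pdv \<rho> x \<in> span {t x}"
    by (simp add: \<rho>t span_scale span_base)
  have 4: "m0 x *\<^sub>R pdv t x = pdv b x *\<^sub>R \<rho> x + b x *\<^sub>R pdv \<rho> x - pdv m0 x *\<^sub>R t x"
    unfolding 1[symmetric] by simp
  have "m0 x *\<^sub>R m0 x *\<^sub>R pdv t x
      = m0 x *\<^sub>R (pdv b x *\<^sub>R \<rho> x - pdv m0 x *\<^sub>R t x) + b x *\<^sub>R m0 x *\<^sub>R pdv \<rho> x"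
    unfolding 4 by (simp add: scaleR_diff_right scaleR_add_right scaleR_left_commute)
  also have "\<dots> \<in> span {t x}"
    by (intro span_add span_scale[OF 3] span_scale span_diff) (simp_all add: \<rho>t span_scale span_base)
  finally have "m0 x *\<^sub>R m0 x *\<^sub>R pdv t x \<in> span {t x}" .
  define k where "k = m0 x * m0 x"
  have "k *\<^sub>R pdv t x \<in> span {t x}"
    using \<open>m0 x *\<^sub>R m0 x *\<^sub>R pdv t x \<in> span {t x}\<close> by (simp add: k_def)
  moreover have "k \<noteq> 0" using m0 by (simp add: k_def)
  ultimately have "dder t x (0, 1) \<in> span {t x}"
    using span_scale[of "k *\<^sub>R pdv t x" "{t x}" "inverse k"] by simp
  from imm_t[OF x this] show False by (simp add: zero_prod_def)
qed

subsection \<open>All curvature lines of the family are congruent\<close>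

lemma v_constant:
  fixes F :: "real \<times> real \<Rightarrow> 'b::real_normed_vector"
  assumes "smooth_on M F" "\<And>x. x \<in> M \<Longrightarrow> pdv F x = 0" "u \<in> I1" "v \<in> I2" "w \<in> I2"
  shows "F (u, v) = F (u, w)"
proof (rule open_interval_constant[OF I2 _ assms(4,5), of "\<lambda>v. F (u, v)"])
  fix v assume "v \<in> I2"
  then show "((\<lambda>v. F (u, v)) has_vector_derivative 0) (at v)"
    using slice_v_vector_derivative[OF open_M assms(1), of u v] assms(2)[of "(u, v)"] assms(3) by simp
qed

lemma u_constant:
  fixes F :: "real \<times> real \<Rightarrow> 'b::real_normed_vector"
  assumes "smooth_on M F" "\<And>x. x \<in> M \<Longrightarrow> pdu F x = 0" "u \<in> I1" "w \<in> I1" "v \<in> I2"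
  shows "F (u, v) = F (w, v)"
proof (rule open_interval_constant[OF I1 _ assms(3,4), of "\<lambda>u. F (u, v)"])
  fix u assume "u \<in> I1"
  then show "((\<lambda>u. F (u, v)) has_vector_derivative 0) (at u)"
    using slice_u_vector_derivative[OF open_M assms(1), of u v] assms(2)[of "(u, v)"] assms(5) by simp
qed

lemma frame_indep:
  assumes x: "x \<in> M"
  shows "indep2 (c x) (c1 x)"
  unfolding indep2_def
proof (intro allI impI)
  fix s t assume "s *\<^sub>R c x + t *\<^sub>R c1 x = 0"
  then have "lform (s *\<^sub>R c x + t *\<^sub>R c1 x) (e4 x) = 0" "lform (s *\<^sub>R c x + t *\<^sub>R c1 x) (e3 x) = 0"
    by (simp_all add: lform.zero_left)
  then show "s = 0 \<and> t = 0" by (simp add: lform_simps gram[OF x])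
qed

lemma f_span:
  assumes x: "x \<in> M"
  shows "f x = span {c x, c1 x}"
proof (rule plane_eq_span[OF null_planes_D(1,2)[OF null[OF x]] _ _ frame_indep[OF x]])
  show "c x \<in> f x" "c1 x \<in> f x" using c_f[OF x] by (simp_all add: c1_def)
qed

text \<open>The linear map that sends the frame at \<open>(u, v)\<close> to the frame at \<open>(u, w)\<close>.\<close>

definition transport :: "real \<Rightarrow> real \<Rightarrow> real \<Rightarrow> R42 \<Rightarrow> R42" where
  "transport u v w y =
     lform y (e4 (u, v)) *\<^sub>R c (u, w) + lform y (c (u, v)) *\<^sub>R e4 (u, w)
   - lform y (e3 (u, v)) *\<^sub>R c1 (u, w) - lform y (c1 (u, v)) *\<^sub>R e3 (u, w)
   + lform y (c2 (u, v)) *\<^sub>R c2 (u, w) + lform y (l (u, v)) *\<^sub>R l (u, w)"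

lemma transport_u_independent:
  assumes u: "u \<in> I1" "u' \<in> I1" and v: "v \<in> I2" "w \<in> I2"
  shows "transport u v w y = transport u' v w y"
proof (rule open_interval_constant[OF I1 _ u, of "\<lambda>u. transport u v w y"])
  fix u assume "u \<in> I1"
  with v have x: "(u, v) \<in> M" "(u, w) \<in> M" by auto
  have d: "((\<lambda>u. lform y (F (u, v)) *\<^sub>R G (u, w)) has_vector_derivative
      lform y (F (u, v)) *\<^sub>R pdu G (u, w) + lform y (pdu F (u, v)) *\<^sub>R G (u, w)) (at u)"
    if "smooth_on M F" "smooth_on M G" for F G
  proof -
    have "((\<lambda>u. lform y (F (u, v))) has_real_derivative lform y (pdu F (u, v))) (at u)"
      using lform.has_vector_derivative[OF has_vector_derivative_const
          slice_u_vector_derivative[OF open_M that(1) x(1)], of y]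
      by (simp add: has_real_derivative_iff_has_vector_derivative lform_simps)
    from has_vector_derivative_scaleR[OF this slice_u_vector_derivative[OF open_M that(2) x(2)]]
    show ?thesis .
  qed
  have gr: "g (u, w) = g (u, v)"
    by (rule v_constant[OF sm_ei(1) pdv_invariants(1) \<open>u \<in> I1\<close> v(2,1)])
  have rr: "r (u, w) = r (u, v)"
    by (rule v_constant[OF sm_ei(4) pdv_invariants(2) \<open>u \<in> I1\<close> v(2,1)])
  show "((\<lambda>u. transport u v w y) has_vector_derivative 0) (at u)"
    unfolding transport_def
    by (rule has_vector_derivative_eq_rhs[OF
          has_vector_derivative_add[OF has_vector_derivative_add[OF
            has_vector_derivative_diff[OF has_vector_derivative_diff[OF has_vector_derivative_add[OF
              d[OF sm_ei(5) sm_ci(1)] d[OF sm_ci(1) sm_ei(5)]] d[OF sm_ei(2) sm_ci(2)]] d[OF sm_ci(2) sm_ei(2)]]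
            d[OF sm_ci(3,3)]] d[OF sm_ci(6,6)]]])
       (simp add: frenet[OF x(1)] frenet[OF x(2)] l_u[OF x(1)] l_u[OF x(2)] gr rr lform_simps algebra_simps)
qed

lemma transport_linear: "linear (transport u v w)"
  by (rule linearI) (simp_all add: transport_def lform_simps algebra_simps)

lemma transport_frame:
  assumes "u \<in> I1" "v \<in> I2"
  shows "transport u v w (c (u, v)) = c (u, w)" "transport u v w (c1 (u, v)) = c1 (u, w)"
    "transport u v w (c2 (u, v)) = c2 (u, w)" "transport u v w (e3 (u, v)) = e3 (u, w)"
    "transport u v w (e4 (u, v)) = e4 (u, w)" "transport u v w (l (u, v)) = l (u, w)"
  using gram[of "(u, v)"] assms by (simp_all add: transport_def)

lemma transport_isometry:
  assumes "u \<in> I1" "v \<in> I2" "w \<in> I2"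
  shows "lform (transport u v w y) (transport u v w z) = lform y z"
proof -
  have x: "(u, v) \<in> M" "(u, w) \<in> M" using assms by auto
  have "lform (transport u v w y) (transport u v w z) =
      lform y (e4 (u, v)) * lform z (c (u, v)) + lform y (c (u, v)) * lform z (e4 (u, v))
    - lform y (e3 (u, v)) * lform z (c1 (u, v)) - lform y (c1 (u, v)) * lform z (e3 (u, v))
    + lform y (c2 (u, v)) * lform z (c2 (u, v)) + lform y (l (u, v)) * lform z (l (u, v))"
    by (simp add: transport_def lform_simps gram[OF x(2)])
  also have "\<dots> = lform y z"
    using arg_cong[OF expand[OF x(1), of z], of "lform y"] by (simp add: lform_simps algebra_simps)
  finally show ?thesis .
qed

lemma congruent_curvature_lines:
  assumes v: "v \<in> I2" "w \<in> I2"
  shows "\<exists>B. lie_sphere_transformation B \<and> (\<forall>u\<in>I1. f (u, w) = (\<lambda>y. B *v y) ` f (u, v))"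
proof -
  obtain u0 where u0: "u0 \<in> I1" using I1 by (auto simp: open_interval_def)
  define B where "B = matrix (transport u0 v w)"
  have B: "B *v y = transport u v w y" if "u \<in> I1" for u y
    unfolding B_def
    using fun_cong[OF matrix_vector_mul(2)[OF transport_linear[of u0 v w]], of y]
      transport_u_independent[OF u0 that v, of y] by simp
  have "lie_sphere_transformation B"
    unfolding lie_sphere_transformation_def B[OF u0] by (simp add: transport_isometry[OF u0 v])
  moreover have "f (u, w) = (\<lambda>y. B *v y) ` f (u, v)" if u: "u \<in> I1" for u
  proof -
    have x: "(u, v) \<in> M" "(u, w) \<in> M" using u v by auto
    have "(\<lambda>y. B *v y) ` f (u, v) = transport u v w ` span {c (u, v), c1 (u, v)}"
      by (simp add: f_span[OF x(1)] B[OF u])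
    also have "\<dots> = span (transport u v w ` {c (u, v), c1 (u, v)})"
      by (rule linear_span_image[OF transport_linear, symmetric])
    also have "\<dots> = f (u, w)"
      by (simp add: f_span[OF x(2)] transport_frame[OF u v(1)])
    finally show ?thesis by simp
  qed
  ultimately show ?thesis by blast
qed

subsection \<open>The derivative of the sphere vector, transported to one curvature line\<close>

text \<open>The components of \<open>l\<^sub>v\<close>.\<close>

definition mu :: "(real \<times> real \<Rightarrow> R42) \<Rightarrow> real \<times> real \<Rightarrow> real" where
  "mu F = (\<lambda>x. lform (F x) (pdv l x))"

lemma sm_mu: "smooth_on M F \<Longrightarrow> smooth_on M (mu F)"
  unfolding mu_def by (intro smooth_on_lform open_M sm_lv)

lemma pdu_mu: "smooth_on M F \<Longrightarrow> x \<in> M \<Longrightarrow> pdu (mu F) x = mu (pdu F) x"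
  unfolding mu_def by (simp add: dder_lform[OF open_M _ sm_lv] pdu_lv lform_simps)

text \<open>The vector \<open>l\<^sub>v\<close> at \<open>(u0, v)\<close>, written in the frame there and read in the frame at \<open>(u0, v0)\<close>, and its
  derivative with respect to \<open>v\<close>. By the next lemmas it does not matter at which \<open>u0\<close> this is done.\<close>

definition mhat :: "real \<Rightarrow> real \<Rightarrow> real \<Rightarrow> R42" where
  "mhat u0 v0 v = mu c (u0, v) *\<^sub>R e4 (u0, v0) + mu e4 (u0, v) *\<^sub>R c (u0, v0)
    - mu c1 (u0, v) *\<^sub>R e3 (u0, v0) - mu e3 (u0, v) *\<^sub>R c1 (u0, v0) + mu c2 (u0, v) *\<^sub>R c2 (u0, v0)"

definition mhat' :: "real \<Rightarrow> real \<Rightarrow> real \<Rightarrow> R42" where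
  "mhat' u0 v0 v = pdv (mu c) (u0, v) *\<^sub>R e4 (u0, v0) + pdv (mu e4) (u0, v) *\<^sub>R c (u0, v0)
    - pdv (mu c1) (u0, v) *\<^sub>R e3 (u0, v0) - pdv (mu e3) (u0, v) *\<^sub>R c1 (u0, v0)
    + pdv (mu c2) (u0, v) *\<^sub>R c2 (u0, v0)"

lemma mhat_derivative:
  assumes "u0 \<in> I1" "v \<in> I2"
  shows "(mhat u0 v0 has_vector_derivative mhat' u0 v0 v) (at v)"
proof -
  have x: "(u0, v) \<in> M" using assms by auto
  have d: "((\<lambda>v. mu F (u0, v) *\<^sub>R y) has_vector_derivative pdv (mu F) (u0, v) *\<^sub>R y) (at v)"
    if "smooth_on M F" for F y
  proof -
    have "((\<lambda>v. mu F (u0, v)) has_real_derivative pdv (mu F) (u0, v)) (at v)"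
      using slice_v_vector_derivative[OF open_M sm_mu[OF that] x]
      by (simp add: has_real_derivative_iff_has_vector_derivative)
    from has_vector_derivative_scaleR[OF this has_vector_derivative_const[of y]]
    show ?thesis by simp
  qed
  show ?thesis
    unfolding mhat_def mhat'_def
    by (intro has_vector_derivative_add has_vector_derivative_diff d sm_ci sm_ei)
qed

lemma mhat_perp_l:
  assumes "u0 \<in> I1" "v0 \<in> I2"
  shows "lform (mhat u0 v0 v) (l (u0, v0)) = 0" "lform (mhat' u0 v0 v) (l (u0, v0)) = 0"
proof -
  have x: "(u0, v0) \<in> M" using assms by simp
  show "lform (mhat u0 v0 v) (l (u0, v0)) = 0" "lform (mhat' u0 v0 v) (l (u0, v0)) = 0"
    by (simp_all add: mhat_def mhat'_def lform_simps gram[OF x])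
qed

lemma lform_mhat:
  assumes u: "u0 \<in> I1" "u \<in> I1" and v: "v0 \<in> I2" "v \<in> I2" and F: "F \<in> {c, c1, c2, e3, e4}"
  shows "lform (F (u, v0)) (mhat u0 v0 v) = mu F (u, v)"
    "lform (F (u, v0)) (mhat' u0 v0 v) = pdv (mu F) (u, v)"
proof -
  have main: "lform (F (u, v0)) (mhat u0 v0 v) = mu F (u, v)" if v: "v \<in> I2" for v
  proof -
    have lv: "pdv l (u, v) = pdv l (u0, v)" by (rule u_constant[OF sm_lv pdu_lv u(2,1) v])
    have x: "(u0, v) \<in> M" using u v by simp
    have adj: "lform (transport u0 v0 v y) (pdv l (u0, v)) = lform y (mhat u0 v0 v)" for y
      using l_lv[OF x] by (simp add: transport_def mhat_def lform_simps mu_def algebra_simps)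
    have "F (u, v) = transport u v0 v (F (u, v0))"
      using F transport_frame[OF u(2) assms(3)] by auto
    also have "\<dots> = transport u0 v0 v (F (u, v0))" by (rule transport_u_independent[OF u(2,1) assms(3) v])
    finally show ?thesis using adj by (simp add: mu_def lv)
  qed
  then show "lform (F (u, v0)) (mhat u0 v0 v) = mu F (u, v)" using v by simp
  have sF: "smooth_on M F" using F sm_ci sm_ei by auto
  have "((\<lambda>v. lform (F (u, v0)) (mhat u0 v0 v)) has_vector_derivative lform (F (u, v0)) (mhat' u0 v0 v)) (at v)"
    using lform.has_vector_derivative[OF has_vector_derivative_const mhat_derivative[OF u(1) v(2)], of "F (u, v0)" v0]
    by (simp add: lform_simps)
  moreover have "((\<lambda>v. mu F (u, v)) has_vector_derivative pdv (mu F) (u, v)) (at v)"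
    by (rule slice_v_vector_derivative[OF open_M sm_mu[OF sF]]) (use u v in simp)
  then have "((\<lambda>v. lform (F (u, v0)) (mhat u0 v0 v)) has_vector_derivative pdv (mu F) (u, v)) (at v)"
    by (rule has_vector_derivative_transform_within_open[where S = I2])
       (use main v I2 in \<open>auto simp: open_interval_def\<close>)
  ultimately show "lform (F (u, v0)) (mhat' u0 v0 v) = pdv (mu F) (u, v)"
    by (rule vector_derivative_unique_at)
qed

text \<open>If all transported derivatives lie in the span of two of them, then some spacelike vector of the
  orthogonal complement of \<open>f\<close> is perpendicular to all of them. As a combination of \<open>c\<close>, \<open>c1\<close>, \<open>c2\<close> with
  coefficients depending on \<open>u\<close> only it is parallel, and then even independent of \<open>v\<close>.\<close>

lemma v_independent_normal:
  assumes u0: "u0 \<in> I1" and v0: "v0 \<in> I2" and ab: "a \<in> I2" "b \<in> I2"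
    and span: "\<And>v. v \<in> I2 \<Longrightarrow> mhat u0 v0 v \<in> span {mhat u0 v0 a, mhat u0 v0 b}"
  shows "\<exists>n. smooth_on M n \<and> (\<forall>x\<in>M. lform (n x) (n x) > 0 \<and> n x \<in> lperp (f x) \<and> pdv n x = 0)"
proof -
  define A :: "(real \<times> real \<Rightarrow> R42) \<Rightarrow> real \<times> real \<Rightarrow> real"
    where "A = (\<lambda>F x. lform (F (fst x, v0)) (mhat u0 v0 a))"
  define B :: "(real \<times> real \<Rightarrow> R42) \<Rightarrow> real \<times> real \<Rightarrow> real"
    where "B = (\<lambda>F x. lform (F (fst x, v0)) (mhat u0 v0 b))"
  have bl: "bounded_linear (\<lambda>x::real \<times> real. (fst x, 0::real))"
    by (intro bounded_linear_Pair bounded_linear_fst bounded_linear_zero)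
  have pull: "smooth_on M (\<lambda>x. F (fst x, v0))" if "smooth_on M F" for F :: "real \<times> real \<Rightarrow> R42"
  proof -
    have "smooth_on M (\<lambda>x. F ((0, v0) + (fst x, 0)))"
      by (rule smooth_on_affine[OF open_M open_M bl _ that]) (use v0 in auto)
    then show ?thesis by simp
  qed
  have smAB: "smooth_on M (A F)" "smooth_on M (B F)" if "smooth_on M F" for F
    unfolding A_def B_def by (rule smooth_on_lform[OF open_M pull[OF that] smooth_on_const[OF open_M]])+
  have vAB: "pdv (A F) x = 0" "pdv (B F) x = 0" if "smooth_on M F" "x \<in> M" for F x
  proof -
    have "pdv G x = 0" if G: "smooth_on M G" "\<And>y. G y = h (fst y)" for G :: "real \<times> real \<Rightarrow> real" and h
    proof -
      have "((\<lambda>v. G (fst x, v)) has_vector_derivative pdv G x) (at (snd x))"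
        using slice_v_vector_derivative[OF open_M G(1), of "fst x" "snd x"] \<open>x \<in> M\<close> by simp
      then have "((\<lambda>v. h (fst x)) has_vector_derivative pdv G x) (at (snd x))" by (simp add: G(2))
      then show ?thesis using vector_derivative_unique_at has_vector_derivative_const by blast
    qed
    from this[OF smAB(1)[OF that(1)], of "\<lambda>u. lform (F (u, v0)) (mhat u0 v0 a)"]
      this[OF smAB(2)[OF that(1)], of "\<lambda>u. lform (F (u, v0)) (mhat u0 v0 b)"]
    show "pdv (A F) x = 0" "pdv (B F) x = 0" by (simp_all add: A_def B_def)
  qed
  \<comment> \<open>The cross product of the coefficient vectors of the two spanning elements.\<close>
  define p q s where "p = (\<lambda>x. A c1 x * B c2 x - A c2 x * B c1 x)"
    and "q = (\<lambda>x. A c2 x * B c x - A c x * B c2 x)" and "s = (\<lambda>x. A c x * B c1 x - A c1 x * B c x)"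
  have sm2: "smooth_on M (\<lambda>x. A F x * B G x - A G x * B F x)"
    and v2: "x \<in> M \<Longrightarrow> pdv (\<lambda>x. A F x * B G x - A G x * B F x) x = 0"
    if "smooth_on M F" "smooth_on M G" for F G x
    using smAB vAB that
    by (auto simp: smooth_on_diff smooth_on_mult dder_diff[OF open_M] dder_mult[OF open_M])
  have smpqs: "smooth_on M p" "smooth_on M q" "smooth_on M s"
    unfolding p_def q_def s_def by (intro sm2 sm_ci)+
  have vpqs: "pdv p x = 0" "pdv q x = 0" "pdv s x = 0" if "x \<in> M" for x
    unfolding p_def q_def s_def by (intro v2 sm_ci that)+
  define n where "n = (\<lambda>x. p x *\<^sub>R c x + q x *\<^sub>R c1 x + s x *\<^sub>R c2 x)"
  have pn: "parallel n"
    unfolding n_def by (intro parallel_add parallel_scale parallel_frame smpqs vpqs)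
  have mu_span: "\<exists>\<alpha> \<beta>. \<forall>F\<in>{c, c1, c2, e3, e4}. mu F x = \<alpha> * A F x + \<beta> * B F x" if x: "x \<in> M" for x
  proof -
    obtain u v where uv: "x = (u, v)" "u \<in> I1" "v \<in> I2" using x by auto
    obtain \<alpha> \<beta> where e: "mhat u0 v0 v = \<alpha> *\<^sub>R mhat u0 v0 a + \<beta> *\<^sub>R mhat u0 v0 b"
      using span[OF uv(3)] by (auto simp: in_span2)
    have "mu F x = \<alpha> * A F x + \<beta> * B F x" if "F \<in> {c, c1, c2, e3, e4}" for F
      using lform_mhat(1)[OF u0 uv(2) v0 uv(3) that] unfolding e uv(1) by (simp add: A_def B_def lform_simps)
    then show ?thesis by blast
  qed
  have nlv: "lform (n x) (pdv l x) = 0" if x: "x \<in> M" for x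
  proof -
    obtain \<alpha> \<beta> where "\<forall>F\<in>{c, c1, c2, e3, e4}. mu F x = \<alpha> * A F x + \<beta> * B F x" using mu_span[OF x] by blast
    then have e: "mu c x = \<alpha> * A c x + \<beta> * B c x" "mu c1 x = \<alpha> * A c1 x + \<beta> * B c1 x"
      "mu c2 x = \<alpha> * A c2 x + \<beta> * B c2 x" by auto
    have "lform (n x) (pdv l x) = p x * mu c x + q x * mu c1 x + s x * mu c2 x"
      by (simp add: n_def mu_def lform_simps)
    also have "\<dots> = 0" unfolding e p_def q_def s_def by algebra
    finally show ?thesis .
  qed
  have s0: "s x \<noteq> 0" if x: "x \<in> M" for x
  proof
    assume z: "s x = 0"
    obtain u v where uv: "x = (u, v)" "u \<in> I1" "v \<in> I2" using x by auto
    define F where "F = A c x *\<^sub>R c1 (u, v0) - A c1 x *\<^sub>R c (u, v0)"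
    have "lform F (mhat u0 v0 w) = 0" if w: "w \<in> I2" for w
    proof -
      have xw: "(u, w) \<in> M" using uv w by simp
      obtain \<alpha> \<beta> where "\<forall>F\<in>{c, c1, c2, e3, e4}. mu F (u, w) = \<alpha> * A F (u, w) + \<beta> * B F (u, w)"
        using mu_span[OF xw] by blast
      then have e: "mu c (u, w) = \<alpha> * A c x + \<beta> * B c x" "mu c1 (u, w) = \<alpha> * A c1 x + \<beta> * B c1 x"
        by (auto simp: A_def B_def uv(1))
      have "lform F (mhat u0 v0 w) = A c x * mu c1 (u, w) - A c1 x * mu c (u, w)"
        by (simp add: F_def lform_simps lform_mhat(1)[OF u0 uv(2) v0 w])
      also have "\<dots> = \<beta> * s x" unfolding e s_def by algebra
      finally show ?thesis using z by simp
    qed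
    then have "lform 0 (mhat u0 v0 a) + lform F (mhat' u0 v0 a) = 0"
      by (intro lform_vector_derivative_const[where I = I2 and F = "\<lambda>_. F", OF _ ab(1)
            has_vector_derivative_const mhat_derivative[OF u0 ab(1)]])
         (use I2 in \<open>auto simp: open_interval_def\<close>)
    then have "lform F (mhat' u0 v0 a) = 0" by (simp add: lform.zero_left)
    moreover have "A c x = mu c (u, a)" "A c1 x = mu c1 (u, a)"
      using lform_mhat(1)[OF u0 uv(2) v0 ab(1)] by (simp_all add: A_def uv(1))
    ultimately have "mu c (u, a) * pdv (mu c1) (u, a) - mu c1 (u, a) * pdv (mu c) (u, a) = 0"
      by (simp add: F_def lform_simps lform_mhat(2)[OF u0 uv(2) v0 ab(1)])
    moreover have "(u, a) \<in> M" using uv ab by simp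
    ultimately show False using regular_second[of "(u, a)"] by (simp add: mu_def)
  qed
  have "lform (n x) (n x) > 0" if x: "x \<in> M" for x
  proof -
    have "lform (n x) (n x) = s x * s x" by (simp add: n_def lform_simps gram[OF x])
    then show ?thesis using s0[OF x] by (auto simp: zero_less_mult_iff)
  qed
  moreover have "n x \<in> lperp (f x)" if x: "x \<in> M" for x
    unfolding f_span[OF x] in_lperp_span2 by (simp add: n_def lform_simps gram[OF x])
  moreover have "pdv n x = 0" if "x \<in> M" for x
    using parallelD(3)[OF pn that] nlv[OF that] by simp
  ultimately show ?thesis using parallelD(1)[OF pn] by blast
qed

end

section \<open>Lie applicability\<close>

lemma bounded_bilinear_matvec: "bounded_bilinear (\<lambda>(A::real^6^6) (y::R42). A *v y)"
proof -
  have "bilinear (\<lambda>(A::real^6^6) (y::R42). A *v y)"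
    unfolding bilinear_def
    by (auto intro!: linearI simp: matrix_vector_mult_add_rdistrib matrix_vector_right_distrib
        scaleR_matrix_vector_assoc[symmetric] matrix_vector_mult_scaleR)
  then show ?thesis by (simp add: bilinear_conv_bounded_bilinear)
qed

lemma wedge_apply: "wedge a b *v y = lform a y *\<^sub>R b - lform b y *\<^sub>R a"
proof -
  have "linear (\<lambda>y. lform a y *\<^sub>R b - lform b y *\<^sub>R a)"
    by (rule linearI) (simp_all add: lform_simps algebra_simps)
  from fun_cong[OF matrix_vector_mul(2)[OF this], of y] show ?thesis by (simp add: wedge_def)
qed

lemma wedge_space_properties:
  assumes V: "\<And>a b. a \<in> V \<Longrightarrow> b \<in> V \<Longrightarrow> lform a b = 0" and A: "A \<in> wedge_space V (lperp V)"
  shows "lform (A *v y) z = - lform (A *v z) y"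
    and "y \<in> V \<Longrightarrow> A *v y = 0"
    and "y \<in> lperp V \<Longrightarrow> z \<in> lperp V \<Longrightarrow> lform (A *v y) z = 0"
proof -
  have "lform (A *v y) z = - lform (A *v z) y \<and> (y \<in> V \<longrightarrow> A *v y = 0) \<and>
    (y \<in> lperp V \<longrightarrow> z \<in> lperp V \<longrightarrow> lform (A *v y) z = 0)"
    using A unfolding wedge_space_def
  proof (induction A rule: span_induct_alt)
    case base
    then show ?case by (simp add: matrix_vector_mult_0 lform_simps)
  next
    case (step k W B)
    then obtain a b where W: "W = wedge a b" "a \<in> V" "b \<in> lperp V" by blast
    have e: "(k *\<^sub>R W + B) *v w = k *\<^sub>R (lform a w *\<^sub>R b - lform b w *\<^sub>R a) + B *v w" for w
      by (simp add: matrix_vector_mult_add_rdistrib scaleR_matrix_vector_assoc[symmetric] W(1) wedge_apply)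
    have 1: "lform a w = 0" "lform b w = 0" if "w \<in> V" for w
      using W(2,3) V that by (auto simp: lperp_def lform_commute)
    have 2: "lform a w = 0" if "w \<in> lperp V" for w
      using W(2) that by (auto simp: lperp_def)
    show ?case
      unfolding e using step(2) 1 2
      by (auto simp: lform_simps algebra_simps)
  qed
  then show "lform (A *v y) z = - lform (A *v z) y"
    and "y \<in> V \<Longrightarrow> A *v y = 0"
    and "y \<in> lperp V \<Longrightarrow> z \<in> lperp V \<Longrightarrow> lform (A *v y) z = 0"
    by blast+
qed

text \<open>The coefficients of a closed form \<open>\<eta>1 du + \<eta>2 dv\<close> with values in the wedge of \<open>f\<close> and its
  orthogonal complement are recorded by the pairings of frame vectors.\<close>

locale applicable_surface = spherical_surface +
  fixes \<eta>1 \<eta>2 :: "real \<times> real \<Rightarrow> real^6^6"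
  assumes sm_\<eta>: "smooth_on (I1 \<times> I2) \<eta>1" "smooth_on (I1 \<times> I2) \<eta>2"
    and closed: "x \<in> I1 \<times> I2 \<Longrightarrow> pdu \<eta>2 x = pdv \<eta>1 x"
    and \<eta>_wedge: "x \<in> I1 \<times> I2 \<Longrightarrow> \<eta>1 x \<in> wedge_space (f x) (lperp (f x))"
      "x \<in> I1 \<times> I2 \<Longrightarrow> \<eta>2 x \<in> wedge_space (f x) (lperp (f x))"
begin

text \<open>The skew bilinear forms of the values of \<open>\<eta>\<close>. They vanish if one argument is in \<open>f\<close>, or both are
  perpendicular to \<open>f\<close>; the remaining components are named below.\<close>

definition N1 where "N1 F G = (\<lambda>x. lform (\<eta>1 x *v F x) (G x))"
definition N2 where "N2 F G = (\<lambda>x. lform (\<eta>2 x *v F x) (G x))"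

lemma sm_N: "smooth_on M F \<Longrightarrow> smooth_on M G \<Longrightarrow> smooth_on M (N1 F G)"
  "smooth_on M F \<Longrightarrow> smooth_on M G \<Longrightarrow> smooth_on M (N2 F G)"
  unfolding N1_def N2_def
  by (intro smooth_on_lform open_M smooth_on_bilinear[OF open_M bounded_bilinear_matvec] sm_\<eta>; assumption)+

lemma dder_N:
  fixes \<eta> :: "real \<times> real \<Rightarrow> real^6^6"
  assumes "smooth_on M \<eta>" "smooth_on M F" "smooth_on M G" "x \<in> M"
  shows "dder (\<lambda>x. lform (\<eta> x *v F x) (G x)) x X =
    lform (dder \<eta> x X *v F x) (G x) + lform (\<eta> x *v dder F x X) (G x) + lform (\<eta> x *v F x) (dder G x X)"
  by (simp add: dder_lform[OF open_M smooth_on_bilinear[OF open_M bounded_bilinear_matvec assms(1,2)] assms(3,4)]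
      dder_bilinear[OF open_M bounded_bilinear_matvec assms(1,2,4)] lform_simps)

text \<open>The equation \<open>d\<eta> = 0\<close> for the components with respect to moving vectors.\<close>

lemma closedness:
  assumes "smooth_on M F" "smooth_on M G" "x \<in> M"
  shows "pdu (N2 F G) x - lform (\<eta>2 x *v pdu F x) (G x) - lform (\<eta>2 x *v F x) (pdu G x)
    = pdv (N1 F G) x - lform (\<eta>1 x *v pdv F x) (G x) - lform (\<eta>1 x *v F x) (pdv G x)"
  unfolding N1_def N2_def dder_N[OF sm_\<eta>(1) assms] dder_N[OF sm_\<eta>(2) assms] closed[OF assms(3)]
  by simp

lemmas matvec_simps = bounded_bilinear.add_right[OF bounded_bilinear_matvec]
  bounded_bilinear.diff_right[OF bounded_bilinear_matvec]
  bounded_bilinear.minus_right[OF bounded_bilinear_matvec]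
  bounded_bilinear.scaleR_right[OF bounded_bilinear_matvec]
  bounded_bilinear.zero_right[OF bounded_bilinear_matvec]

lemma in_f: "x \<in> M \<Longrightarrow> c x \<in> f x" "x \<in> M \<Longrightarrow> c1 x \<in> f x"
  by (simp_all add: f_span span_base)

lemma in_perp: "x \<in> M \<Longrightarrow> c x \<in> lperp (f x)" "x \<in> M \<Longrightarrow> c1 x \<in> lperp (f x)"
  "x \<in> M \<Longrightarrow> c2 x \<in> lperp (f x)" "x \<in> M \<Longrightarrow> l x \<in> lperp (f x)"
  by (simp_all add: f_span in_lperp_span2 gram)

lemma \<eta>_facts:
  assumes x: "x \<in> M"
  shows "lform (\<eta>1 x *v y) z = - lform (\<eta>1 x *v z) y" "lform (\<eta>2 x *v y) z = - lform (\<eta>2 x *v z) y"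
    "\<eta>1 x *v c x = 0" "\<eta>1 x *v c1 x = 0" "\<eta>2 x *v c x = 0" "\<eta>2 x *v c1 x = 0"
    "y \<in> lperp (f x) \<Longrightarrow> z \<in> lperp (f x) \<Longrightarrow> lform (\<eta>1 x *v y) z = 0"
    "y \<in> lperp (f x) \<Longrightarrow> z \<in> lperp (f x) \<Longrightarrow> lform (\<eta>2 x *v y) z = 0"
  using wedge_space_properties[OF null_planes_D(3)[OF null[OF x]] \<eta>_wedge(1)[OF x]]
    wedge_space_properties[OF null_planes_D(3)[OF null[OF x]] \<eta>_wedge(2)[OF x]] in_f[OF x]
  by blast+

lemma \<eta>_zero:
  assumes x: "x \<in> M"
  shows "lform (\<eta>1 x *v y) (c x) = 0" "lform (\<eta>1 x *v y) (c1 x) = 0"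
    "lform (\<eta>2 x *v y) (c x) = 0" "lform (\<eta>2 x *v y) (c1 x) = 0"
    "lform (\<eta>1 x *v y) y = 0" "lform (\<eta>2 x *v y) y = 0"
    "lform (\<eta>1 x *v c2 x) (l x) = 0" "lform (\<eta>2 x *v c2 x) (l x) = 0"
    "lform (\<eta>1 x *v l x) (c2 x) = 0" "lform (\<eta>2 x *v l x) (c2 x) = 0"
  using \<eta>_facts(1)[OF x, of y "c x"] \<eta>_facts(1)[OF x, of y "c1 x"] \<eta>_facts(2)[OF x, of y "c x"]
    \<eta>_facts(2)[OF x, of y "c1 x"] \<eta>_facts(1)[OF x, of y y] \<eta>_facts(2)[OF x, of y y] \<eta>_facts(3-6)[OF x]
    \<eta>_facts(7,8)[OF x in_perp(3)[OF x] in_perp(4)[OF x]] \<eta>_facts(7,8)[OF x in_perp(4)[OF x] in_perp(3)[OF x]]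
  by (auto simp: lform_simps)

lemma pdv_frame:
  assumes x: "x \<in> M"
  shows "pdv c x = (- mu c x) *\<^sub>R l x" "pdv c1 x = (- mu c1 x) *\<^sub>R l x" "pdv c2 x = (- mu c2 x) *\<^sub>R l x"
    "pdv e3 x = (- mu e3 x) *\<^sub>R l x" "pdv e4 x = (- mu e4 x) *\<^sub>R l x"
  using parallelD(3)[OF parallel_frame(1) x] parallelD(3)[OF parallel_frame(2) x]
    parallelD(3)[OF parallel_frame(3) x] parallelD(3)[OF parallel_frame(4) x] parallelD(3)[OF parallel_frame(5) x]
  by (simp_all add: mu_def)

lemma pdv_l:
  assumes x: "x \<in> M"
  shows "pdv l x = mu e4 x *\<^sub>R c x + mu c x *\<^sub>R e4 x - mu e3 x *\<^sub>R c1 x - mu c1 x *\<^sub>R e3 x + mu c2 x *\<^sub>R c2 x"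
  using expand[OF x, of "pdv l x"] l_lv[OF x] by (simp add: mu_def lform_commute[of "pdv l x"])

text \<open>The components of \<open>\<eta>1\<close> and \<open>\<eta>2\<close> that closedness does not force to vanish.\<close>

definition X where "X = N1 e4 e3"
definition Y where "Y = N1 e4 c2"
definition Z where "Z = N1 e3 c2"
definition X' where "X' = N2 e4 e3"
definition P' where "P' = N2 e4 l"
definition R' where "R' = N2 e3 l"

lemmas N_defs = X_def Y_def Z_def X'_def P'_def R'_def

lemma sm_XYZ: "smooth_on M X" "smooth_on M Y" "smooth_on M Z" "smooth_on M X'" "smooth_on M P'" "smooth_on M R'"
  unfolding N_defs by (intro sm_N sm_ci sm_ei)+

lemma N_zero:
  assumes "\<And>y. y \<in> M \<Longrightarrow> N2 F G y = k" "x \<in> M"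
  shows "pdu (N2 F G) x = 0"
  by (rule dder_zero_on[OF open_M assms(2,1)])

lemma N1_zero:
  assumes "\<And>y. y \<in> M \<Longrightarrow> N1 F G y = k" "x \<in> M"
  shows "pdv (N1 F G) x = 0"
  by (rule dder_zero_on[OF open_M assms(2,1)])

lemma mu_c: "x \<in> M \<Longrightarrow> mu c x \<noteq> 0"
  using M_nonzero by (simp add: mu_def)

text \<open>Closedness paired with \<open>c\<close>, whose \<open>v\<close>-derivative is a non-zero multiple of \<open>l\<close>.\<close>

lemma eta1_l:
  assumes x: "x \<in> M"
  shows "N1 l e3 x = 0" "N1 l e4 x = 0" "N1 e3 l x = 0" "N1 e4 l x = 0"
proof -
  have z: "N1 c G y = 0" "N2 c G y = 0" if "y \<in> M" for G y
    using \<eta>_facts(3,5)[OF that] by (simp_all add: N1_def N2_def lform_simps)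
  have "N1 l G x = 0" if G: "smooth_on M G" for G
    using closedness[OF sm_ci(1) G x] N_zero[OF z(2) x, of G] N1_zero[OF z(1) x, of G] mu_c[OF x]
    by (simp add: frenet[OF x] pdv_frame[OF x] \<eta>_facts(3-6)[OF x] matvec_simps lform_simps N1_def)
  then show "N1 l e3 x = 0" "N1 l e4 x = 0" by simp_all
  then show "N1 e3 l x = 0" "N1 e4 l x = 0"
    using \<eta>_facts(1)[OF x, of "e3 x" "l x"] \<eta>_facts(1)[OF x, of "e4 x" "l x"] by (simp_all add: N1_def)
qed

lemma eta2_c2:
  assumes x: "x \<in> M"
  shows "N2 c2 e3 x = 0" "N2 c2 e4 x = 0" "N2 e3 c2 x = 0" "N2 e4 c2 x = 0"
proof -
  have z: "N1 c1 G y = 0" "N2 c1 G y = 0" if "y \<in> M" for G y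
    using \<eta>_facts(4,6)[OF that] by (simp_all add: N1_def N2_def lform_simps)
  have "N2 c2 G x = 0" if G: "smooth_on M G" "N1 l G x = 0" for G
    using closedness[OF sm_ci(2) G(1) x] N_zero[OF z(2) x, of G] N1_zero[OF z(1) x, of G] G(2)
    by (simp add: frenet[OF x] pdv_frame[OF x] \<eta>_facts(3-6)[OF x] matvec_simps lform_simps N1_def N2_def)
  then show "N2 c2 e3 x = 0" "N2 c2 e4 x = 0" using eta1_l[OF x] by simp_all
  then show "N2 e3 c2 x = 0" "N2 e4 c2 x = 0"
    using \<eta>_facts(2)[OF x, of "e3 x" "c2 x"] \<eta>_facts(2)[OF x, of "e4 x" "c2 x"] by (simp_all add: N2_def)
qed

lemma l_pair:
  assumes x: "x \<in> M"
  shows "lform (\<eta>1 x *v l x) (e3 x) = 0" "lform (\<eta>1 x *v l x) (e4 x) = 0"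
    "lform (\<eta>1 x *v e3 x) (l x) = 0" "lform (\<eta>1 x *v e4 x) (l x) = 0"
    "lform (\<eta>2 x *v c2 x) (e3 x) = 0" "lform (\<eta>2 x *v c2 x) (e4 x) = 0"
    "lform (\<eta>2 x *v e3 x) (c2 x) = 0" "lform (\<eta>2 x *v e4 x) (c2 x) = 0"
  using eta1_l[OF x] eta2_c2[OF x] by (simp_all add: N1_def N2_def)

lemma skew_XYZ:
  assumes x: "x \<in> M"
  shows "lform (\<eta>1 x *v e4 x) (e3 x) = X x" "lform (\<eta>1 x *v e3 x) (e4 x) = - X x"
    "lform (\<eta>1 x *v e4 x) (c2 x) = Y x" "lform (\<eta>1 x *v c2 x) (e4 x) = - Y x"
    "lform (\<eta>1 x *v e3 x) (c2 x) = Z x" "lform (\<eta>1 x *v c2 x) (e3 x) = - Z x"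
    "lform (\<eta>2 x *v e4 x) (e3 x) = X' x" "lform (\<eta>2 x *v e3 x) (e4 x) = - X' x"
    "lform (\<eta>2 x *v e4 x) (l x) = P' x" "lform (\<eta>2 x *v l x) (e4 x) = - P' x"
    "lform (\<eta>2 x *v e3 x) (l x) = R' x" "lform (\<eta>2 x *v l x) (e3 x) = - R' x"
  using \<eta>_facts(1)[OF x, of "e3 x" "e4 x"] \<eta>_facts(1)[OF x, of "c2 x" "e4 x"]
    \<eta>_facts(1)[OF x, of "c2 x" "e3 x"] \<eta>_facts(2)[OF x, of "e3 x" "e4 x"]
    \<eta>_facts(2)[OF x, of "l x" "e4 x"] \<eta>_facts(2)[OF x, of "l x" "e3 x"]
  unfolding N_defs N1_def N2_def by simp_all

lemma neg_pd:
  assumes "smooth_on M h" "\<And>y. y \<in> M \<Longrightarrow> N y = - h y" "x \<in> M"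
  shows "dder N x V = - dder h x V"
  using dder_cong[OF open_M assms(3), of "\<lambda>y. - h y" N V] dder_minus[OF open_M assms(1,3)]
    assms(2) smooth_on_minus[OF open_M assms(1)] by simp

lemmas eta_simps = frenet pdv_frame \<eta>_facts(3-6) \<eta>_zero l_pair skew_XYZ matvec_simps lform_simps

lemma pdv_Z:
  assumes x: "x \<in> M"
  shows "pdv Z x = 0"
proof -
  have "pdv (N1 c2 e3) x = - pdv Z x"
    by (rule neg_pd[OF sm_XYZ(3) _ x]) (simp add: N1_def skew_XYZ)
  moreover have "pdu (N2 c2 e3) x = 0" by (rule N_zero[OF eta2_c2(1) x])
  ultimately show ?thesis
    using closedness[OF sm_ci(3) sm_ei(2) x] by (simp add: eta_simps x)
qed

lemma pdv_Y:
  assumes x: "x \<in> M"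
  shows "pdv Y x = - X' x"
proof -
  have "pdv (N1 c2 e4) x = - pdv Y x"
    by (rule neg_pd[OF sm_XYZ(2) _ x]) (simp add: N1_def skew_XYZ)
  moreover have "pdu (N2 c2 e4) x = 0" by (rule N_zero[OF eta2_c2(2) x])
  ultimately show ?thesis
    using closedness[OF sm_ci(3) sm_ei(5) x] by (simp add: eta_simps x)
qed

lemma pdv_X:
  assumes x: "x \<in> M"
  shows "pdv X x = pdu X' x"
proof -
  have "pdv (N1 e3 e4) x = - pdv X x" "pdu (N2 e3 e4) x = - pdu X' x"
    by (rule neg_pd[OF sm_XYZ(1) _ x], simp add: N1_def skew_XYZ,
        rule neg_pd[OF sm_XYZ(4) _ x], simp add: N2_def skew_XYZ)
  then show ?thesis
    using closedness[OF sm_ei(2,5) x] by (simp add: eta_simps x)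
qed

lemma R'_eq:
  assumes x: "x \<in> M"
  shows "R' x = mu c1 x * Z x - mu c x * Y x"
proof -
  have z: "N2 c2 l y = 0" "N1 c2 l y = 0" if "y \<in> M" for y
    using \<eta>_zero[OF that] by (simp_all add: N1_def N2_def)
  have "pdu (N2 c2 l) x = 0" by (rule N_zero[OF z(1) x])
  moreover have "pdv (N1 c2 l) x = 0" by (rule N1_zero[OF z(2) x])
  ultimately show ?thesis
    using closedness[OF sm_ci(3,6) x] by (simp add: eta_simps x l_u pdv_l)
qed

lemma P'_eq:
  assumes x: "x \<in> M"
  shows "P' x = pdu R' x - mu c x * X x + mu c2 x * Z x"
proof -
  have "pdv (N1 e3 l) x = 0" by (rule N1_zero[OF eta1_l(3) x])
  then show ?thesis
    using closedness[OF sm_ei(2) sm_ci(6) x]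
    by (simp add: eta_simps x l_u pdv_l flip: R'_def)
qed

lemma pdu_P':
  assumes x: "x \<in> M"
  shows "pdu P' x = mu c1 x * X x - mu c2 x * Y x"
proof -
  have "pdv (N1 e4 l) x = 0" by (rule N1_zero[OF eta1_l(4) x])
  then show ?thesis
    using closedness[OF sm_ei(5) sm_ci(6) x]
    by (simp add: eta_simps x l_u pdv_l flip: P'_def)
qed

text \<open>Besides \<open>Z\<close>, the second function of \<open>u\<close> alone.\<close>

definition xi where "xi = (\<lambda>x. X x + pdu Y x)"

lemma sm_xi: "smooth_on M xi"
  unfolding xi_def by (intro smooth_on_add open_M smooth_on_dder sm_XYZ)

lemma pdv_xi:
  assumes x: "x \<in> M"
  shows "pdv xi x = 0"
proof -
  have "pdv xi x = pdv X x + pdv (pdu Y) x"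
    unfolding xi_def by (rule dder_add[OF open_M sm_XYZ(1) smooth_on_dder[OF sm_XYZ(2)] x])
  also have "pdv (pdu Y) x = pdu (pdv Y) x" by (rule mixed[OF sm_XYZ(2) x])
  also have "\<dots> = - pdu X' x" by (rule neg_pd[OF sm_XYZ(4) pdv_Y x])
  finally show ?thesis using pdv_X[OF x] by simp
qed

lemma pdu_mu_frame:
  assumes x: "x \<in> M"
  shows "pdu (mu c) x = mu c1 x" "pdu (mu c1) x = mu c2 x" "pdu (mu c2) x = mu e3 x - g x / 2 * mu c1 x"
  using pdu_mu[OF sm_ci(1) x] pdu_mu[OF sm_ci(2) x] pdu_mu[OF sm_ci(3) x]
  by (simp_all add: mu_def frenet[OF x] lform_simps)

lemma P'_formula:
  assumes x: "x \<in> M"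
  shows "P' x = 2 * Z x * mu c2 x + pdu Z x * mu c1 x - mu c1 x * Y x - mu c x * xi x"
proof -
  have s: "smooth_on M (\<lambda>y. mu c1 y * Z y)" "smooth_on M (\<lambda>y. mu c y * Y y)"
    by (intro smooth_on_mult open_M sm_mu sm_ci sm_XYZ)+
  have "pdu R' x = pdu (\<lambda>y. mu c1 y * Z y - mu c y * Y y) x"
    by (rule dder_cong[OF open_M x R'_eq sm_XYZ(6)])
  also have "\<dots> = mu c2 x * Z x + mu c1 x * pdu Z x - (mu c1 x * Y x + mu c x * pdu Y x)"
    by (simp add: dder_diff[OF open_M s x] dder_mult[OF open_M sm_mu[OF sm_ci(2)] sm_XYZ(3) x]
        dder_mult[OF open_M sm_mu[OF sm_ci(1)] sm_XYZ(2) x] pdu_mu_frame[OF x])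
  finally show ?thesis
    using P'_eq[OF x] by (simp add: xi_def algebra_simps)
qed

text \<open>Comparing the derivative of \<open>P'\<close> with \<open>pdu_P'\<close>: the component \<open>Y\<close> cancels.\<close>

lemma third_order_equation:
  assumes x: "x \<in> M"
  shows "2 * Z x * mu e3 x + 3 * pdu Z x * mu c2 x + (pdu (pdu Z) x - 2 * xi x - g x * Z x) * mu c1 x
    - pdu xi x * mu c x = 0"
proof -
  note s = sm_mu[OF sm_ci(1)] sm_mu[OF sm_ci(2)] sm_mu[OF sm_ci(3)] sm_XYZ sm_xi
    smooth_on_dder[OF sm_XYZ(3), of "(1, 0)"]
  note sm' = smooth_on_mult[OF open_M] smooth_on_diff[OF open_M] smooth_on_add[OF open_M] smooth_on_const[OF open_M]
  have "pdu P' x = pdu (\<lambda>x. 2 * Z x * mu c2 x + pdu Z x * mu c1 x - mu c1 x * Y x - mu c x * xi x) x"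
    by (rule dder_cong[OF open_M x P'_formula sm_XYZ(5)])
  also have "\<dots> = 2 * pdu Z x * mu c2 x + 2 * Z x * (mu e3 x - g x / 2 * mu c1 x)
      + (pdu (pdu Z) x * mu c1 x + pdu Z x * mu c2 x)
      - (mu c2 x * Y x + mu c1 x * pdu Y x) - (mu c1 x * xi x + mu c x * pdu xi x)"
    by (simp add: dder_diff[OF open_M _ _ x] dder_add[OF open_M _ _ x] dder_mult[OF open_M _ _ x]
        sm' s pdu_mu_frame[OF x])
  finally show ?thesis
    using pdu_P'[OF x] by (simp add: xi_def algebra_simps)
qed

text \<open>If \<open>Z\<close> vanishes, the equation is \<open>2 xi N' + xi' N = 0\<close>. Where \<open>xi\<close> is not zero, this determines the ratio of
  \<open>N'\<close> and \<open>N\<close> independently of \<open>v\<close>, contrary to the immersion of the second curvature spheres.\<close>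

lemma xi_zero:
  assumes Z: "\<And>x. x \<in> M \<Longrightarrow> Z x = 0" and x: "x \<in> M"
  shows "xi x = 0"
proof (rule ccontr)
  assume ne: "xi x \<noteq> 0"
  obtain u v where uv: "x = (u, v)" "u \<in> I1" "v \<in> I2" using x by auto
  have zu: "pdu Z y = 0" if "y \<in> M" for y by (rule dder_zero_on[OF open_M that]) (rule Z)
  have zuu: "pdu (pdu Z) y = 0" if "y \<in> M" for y by (rule dder_zero_on[OF open_M that]) (rule zu)
  have eq: "2 * xi y * mu c1 y + pdu xi y * mu c y = 0" if "y \<in> M" for y
    using third_order_equation[OF that] Z[OF that] zu[OF that] zuu[OF that] by simp
  have s: "smooth_on M xi" "smooth_on M (pdu xi)" "smooth_on M (mu c)" "smooth_on M (mu c1)"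
    by (intro sm_xi smooth_on_dder sm_mu sm_ci)+
  have pv: "pdv (pdu xi) x = 0"
    using mixed[OF sm_xi x] dder_zero_on[OF open_M x, of "pdv xi" 0 "(1, 0)"] pdv_xi by simp
  have "pdv (\<lambda>y. 2 * xi y * mu c1 y + pdu xi y * mu c y) x = 0"
    by (rule dder_zero_on[OF open_M x]) (rule eq)
  then have "2 * xi x * pdv (mu c1) x + pdu xi x * pdv (mu c) x = 0"
    by (simp add: dder_add[OF open_M _ _ x] dder_mult[OF open_M _ _ x] s smooth_on_mult[OF open_M]
        smooth_on_const[OF open_M] pdv_xi[OF x] pv)
  then have "2 * xi x * (mu c x * pdv (mu c1) x - mu c1 x * pdv (mu c) x) = 0"
    using eq[OF x] by algebra
  then show False using ne regular_second[OF x] by (simp add: mu_def)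
qed

subsection \<open>The quadratic differential\<close>

text \<open>If \<open>Z\<close> vanishes identically, then so does \<open>xi\<close>, and \<open>\<eta>\<close> is determined by \<open>Y\<close> alone.\<close>

lemma eta_values:
  assumes x: "x \<in> M" and Z: "\<And>x. x \<in> M \<Longrightarrow> Z x = 0"
  shows "\<eta>1 x *v l x = 0" "\<eta>2 x *v c2 x = 0" "\<eta>1 x *v c2 x = (- Y x) *\<^sub>R c x"
    "\<eta>2 x *v l x = (mu c1 x * Y x) *\<^sub>R c x - (mu c x * Y x) *\<^sub>R c1 x"
proof -
  have xi: "xi x = 0" by (rule xi_zero[OF Z x])
  have zu: "pdu Z x = 0" by (rule dder_zero_on[OF open_M x]) (rule Z)
  have PR: "P' x = - mu c1 x * Y x" "R' x = - mu c x * Y x"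
    using P'_formula[OF x] R'_eq[OF x] Z[OF x] zu xi by simp_all
  have lperp_zero: "lform (\<eta>1 x *v l x) (l x) = 0" "lform (\<eta>2 x *v l x) (l x) = 0"
    "lform (\<eta>1 x *v c2 x) (c2 x) = 0" "lform (\<eta>2 x *v c2 x) (c2 x) = 0"
    by (rule \<eta>_zero[OF x])+
  show "\<eta>1 x *v l x = 0"
    by (subst expand[OF x]) (simp add: eta_simps x lperp_zero)
  show "\<eta>2 x *v c2 x = 0"
    by (subst expand[OF x]) (simp add: eta_simps x lperp_zero)
  show "\<eta>1 x *v c2 x = (- Y x) *\<^sub>R c x"
    by (subst expand[OF x]) (simp add: eta_simps x lperp_zero Z[OF x])
  show "\<eta>2 x *v l x = (mu c1 x * Y x) *\<^sub>R c x - (mu c x * Y x) *\<^sub>R c1 x"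
    by (subst expand[OF x]) (simp add: eta_simps x lperp_zero PR)
qed

end

text \<open>The trace in the arbitrary basis chosen by \<open>trace_on\<close> agrees with that in the basis \<open>a, b\<close>.\<close>

lemma trace_on_plane:
  assumes ab: "indep2 a b" and T: "\<And>s t. T (s *\<^sub>R a + t *\<^sub>R b) = s *\<^sub>R (p *\<^sub>R a + q *\<^sub>R b) + t *\<^sub>R (p' *\<^sub>R a + q' *\<^sub>R b)"
  shows "trace_on (span {a, b}) T = p + q'"
proof -
  define E where "E = (SOME E. independent E \<and> span E = span {a, b})"
  have i: "independent {a, b}" "a \<noteq> b" using ab by (auto simp: indep2_iff)
  then have "\<exists>E. independent E \<and> span E = span {a, b}" by blast
  then have E: "independent E" "span E = span {a, b}" unfolding E_def by (metis (mono_tags, lifting) someI_ex)+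
  have "card E = dim (span E)" using E(1) by (simp add: dim_span_eq_card_independent del: dim_span)
  also have "\<dots> = card {a, b}" using i(1) E(2) by (simp add: dim_span_eq_card_independent del: dim_span)
  finally have "card E = 2" using i(2) by simp
  then obtain d e where de: "E = {d, e}" "d \<noteq> e" by (auto simp: card_2_iff)
  have "d \<in> E" "e \<in> E" using de by simp_all
  then have "d \<in> span {a, b}" "e \<in> span {a, b}" unfolding E(2)[symmetric] by (simp_all add: span_base)
  then obtain d1 d2 f1 f2 where d: "d = d1 *\<^sub>R a + d2 *\<^sub>R b" and e: "e = f1 *\<^sub>R a + f2 *\<^sub>R b"
    by (auto simp: in_span2)
  have ide: "indep2 d e" using E(1) de by (simp add: indep2_iff)
  have gen: "s *\<^sub>R d + t *\<^sub>R e = (s * d1 + t * f1) *\<^sub>R a + (s * d2 + t * f2) *\<^sub>R b" for s t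
    by (simp add: d e algebra_simps)
  define D where "D = d1 * f2 - d2 * f1"
  have D: "D \<noteq> 0"
  proof
    assume "D = 0"
    then have "d1 * f2 = d2 * f1" by (simp add: D_def)
    then have "f1 *\<^sub>R d + (- d1) *\<^sub>R e = 0" "f2 *\<^sub>R d + (- d2) *\<^sub>R e = 0"
      unfolding gen by (simp_all add: mult.commute)
    then have "- d1 = 0" "- d2 = 0" using ide unfolding indep2_def by blast+
    then have "d = 0" by (simp add: d)
    then show False using ide[unfolded indep2_def, rule_format, of 1 0] by simp
  qed
  have rep: "representation E (s *\<^sub>R d + t *\<^sub>R e) d = s" "representation E (s *\<^sub>R d + t *\<^sub>R e) e = t" for s t
  proof -
    have "d \<in> span E" "e \<in> span E" using de by (auto simp: span_base)
    then have "representation E (s *\<^sub>R d + t *\<^sub>R e) = (\<lambda>x. s * representation E d x + t * representation E e x)"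
      using E(1) by (simp add: representation_add representation_scale span_scale)
    moreover have "representation E d = (\<lambda>v. if v = d then 1 else 0)" "representation E e = (\<lambda>v. if v = e then 1 else 0)"
      using representation_basis[OF E(1)] de by auto
    ultimately show "representation E (s *\<^sub>R d + t *\<^sub>R e) d = s" "representation E (s *\<^sub>R d + t *\<^sub>R e) e = t"
      using de(2) by simp_all
  qed
  have comb: "s *\<^sub>R a + t *\<^sub>R b = ((s * f2 - t * f1) / D) *\<^sub>R d + ((t * d1 - s * d2) / D) *\<^sub>R e" for s t
  proof -
    have "((s * f2 - t * f1) / D) * d1 + ((t * d1 - s * d2) / D) * f1 = s"
      "((s * f2 - t * f1) / D) * d2 + ((t * d1 - s * d2) / D) * f2 = t"
      using D by (simp_all add: field_simps) (simp_all add: D_def algebra_simps)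
    then show ?thesis unfolding gen by simp
  qed
  have Td: "T d = (d1 * p + d2 * p') *\<^sub>R a + (d1 * q + d2 * q') *\<^sub>R b"
    and Te: "T e = (f1 * p + f2 * p') *\<^sub>R a + (f1 * q + f2 * q') *\<^sub>R b"
    unfolding d e T by (simp_all add: algebra_simps)
  have "representation E (T d) d = ((d1 * p + d2 * p') * f2 - (d1 * q + d2 * q') * f1) / D"
    "representation E (T e) e = ((f1 * q + f2 * q') * d1 - (f1 * p + f2 * p') * d2) / D"
    unfolding Td Te comb rep by simp_all
  then have "(\<Sum>x\<in>E. representation E (T x) x)
      = ((d1 * p + d2 * p') * f2 - (d1 * q + d2 * q') * f1) / D + ((f1 * q + f2 * q') * d1 - (f1 * p + f2 * p') * d2) / D"
    using de by simp
  also have "\<dots> = p + q'" using D by (simp add: field_simps) (simp add: D_def algebra_simps)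
  finally show ?thesis unfolding trace_on_def E_def[symmetric] Let_def .
qed

text \<open>The diagonal entries \<open>p\<close> and \<open>q'\<close> of the endomorphism of \<open>f\<close> cancel.\<close>

lemma (in applicable_surface) quad_diff_zero:
  assumes Z: "\<And>x. x \<in> M \<Longrightarrow> Z x = 0" and x: "x \<in> M"
    and lin: "linear (\<eta> x)" and \<eta>: "\<eta> x (1, 0) = \<eta>1 x" "\<eta> x (0, 1) = \<eta>2 x"
  shows "quad_diff M f \<eta> x V W = 0"
proof -
  obtain v1 v2 w1 w2 where VW: "V = (v1, v2)" "W = (w1, w2)" by (cases V; cases W)
  have "V = v1 *\<^sub>R (1, 0) + v2 *\<^sub>R (0, 1)" by (simp add: VW)
  then have \<eta>V: "\<eta> x V = v1 *\<^sub>R \<eta>1 x + v2 *\<^sub>R \<eta>2 x"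
    using lin by (simp add: linear_add linear_scale \<eta> del: scaleR_Pair)
  have mv: "\<eta> x V *v y = v1 *\<^sub>R (\<eta>1 x *v y) + v2 *\<^sub>R (\<eta>2 x *v y)" for y
    unfolding \<eta>V by (simp add: matrix_vector_mult_add_rdistrib scaleR_matrix_vector_assoc[symmetric])
  have dc: "dder c x W = w1 *\<^sub>R c1 x - (w2 * mu c x) *\<^sub>R l x"
    and dc1: "dder c1 x W = w1 *\<^sub>R c2 x - (w2 * mu c1 x) *\<^sub>R l x"
    using dder_eq_pd[OF open_M sm_ci(1) x, of W] dder_eq_pd[OF open_M sm_ci(2) x, of W]
    by (simp_all add: VW frenet[OF x] pdv_frame[OF x])
  note val = eta_values[OF x Z]
  define p q p' q' where "p = - w2 * mu c x * (v2 * (mu c1 x * Y x))"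
    and "q = w2 * mu c x * (v2 * (mu c x * Y x))"
    and "p' = - w1 * v1 * Y x - w2 * mu c1 x * (v2 * (mu c1 x * Y x))"
    and "q' = w2 * mu c1 x * (v2 * (mu c x * Y x))"
  have Tc: "\<eta> x V *v dder c x W = p *\<^sub>R c x + q *\<^sub>R c1 x"
    "\<eta> x V *v dder c1 x W = p' *\<^sub>R c x + q' *\<^sub>R c1 x"
    unfolding mv dc dc1 p_def q_def p'_def q'_def
    by (simp_all add: matvec_simps \<eta>_facts(3-6)[OF x] val algebra_simps)
  have kill: "\<eta> x V *v c x = 0" "\<eta> x V *v c1 x = 0"
    unfolding mv by (simp_all add: \<eta>_facts(3-6)[OF x])
  define T where "T = (\<lambda>w. THE z. \<exists>\<sigma>\<in>sections M f. \<sigma> x = w \<and> z = \<eta> x V *v dder \<sigma> x W)"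
  have T: "T (s *\<^sub>R c x + t *\<^sub>R c1 x) = s *\<^sub>R (p *\<^sub>R c x + q *\<^sub>R c1 x) + t *\<^sub>R (p' *\<^sub>R c x + q' *\<^sub>R c1 x)" for s t
  proof -
    have val: "\<eta> x V *v dder \<sigma> x W = s *\<^sub>R (p *\<^sub>R c x + q *\<^sub>R c1 x) + t *\<^sub>R (p' *\<^sub>R c x + q' *\<^sub>R c1 x)"
      if \<sigma>: "\<sigma> \<in> sections M f" "\<sigma> x = s *\<^sub>R c x + t *\<^sub>R c1 x" for \<sigma>
    proof -
      define a b where "a = (\<lambda>y. lform (\<sigma> y) (e4 y))" and "b = (\<lambda>y. - lform (\<sigma> y) (e3 y))"
      have s\<sigma>: "smooth_on M \<sigma>" using \<sigma>(1) by (simp add: sections_def)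
      have sab: "smooth_on M a" "smooth_on M b"
        unfolding a_def b_def by (intro smooth_on_lform smooth_on_minus open_M s\<sigma> sm_ei)+
      have eq: "\<sigma> y = a y *\<^sub>R c y + b y *\<^sub>R c1 y" if y: "y \<in> M" for y
      proof -
        have "\<sigma> y \<in> span {c y, c1 y}" using \<sigma>(1) y f_span[OF y] by (auto simp: sections_def)
        then obtain s t where st: "\<sigma> y = s *\<^sub>R c y + t *\<^sub>R c1 y" by (auto simp: in_span2)
        have "a y = s" "b y = t" by (simp_all add: a_def b_def st lform_simps gram[OF y])
        then show ?thesis using st by simp
      qed
      have abx: "a x = s" "b x = t" by (simp_all add: a_def b_def \<sigma>(2) lform_simps gram[OF x])
      have "dder \<sigma> x W = dder (\<lambda>y. a y *\<^sub>R c y + b y *\<^sub>R c1 y) x W"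
        by (rule dder_cong[OF open_M x eq s\<sigma>])
      also have "\<dots> = dder a x W *\<^sub>R c x + s *\<^sub>R dder c x W + (dder b x W *\<^sub>R c1 x + t *\<^sub>R dder c1 x W)"
        by (simp add: dder_add[OF open_M _ _ x] dder_scaleR[OF open_M _ _ x] smooth_on_scaleR sab abx)
      finally show ?thesis by (simp add: matvec_simps kill Tc)
    qed
    have ex: "(\<lambda>y. s *\<^sub>R c y + t *\<^sub>R c1 y) \<in> sections M f"
      unfolding sections_def
      by (auto simp: f_span in_span2 intro!: smooth_on_add smooth_on_scaleR smooth_on_const)
    show ?thesis
      unfolding T_def
      by (rule the_equality) (use val ex in auto)
  qed
  from trace_on_plane[OF frame_indep[OF x], of T, OF T]
  have "trace_on (f x) T = p + q'" by (simp add: f_span[OF x])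
  then show ?thesis by (simp add: quad_diff_def T_def p_def q'_def)
qed

section \<open>The curvature lines as constrained elastic curves\<close>

context applicable_surface
begin

lemma profile_invariants:
  assumes u: "u \<in> I1" and v: "v \<in> I2" "w \<in> I2"
  shows "Z (u, v) = Z (u, w)" "pdu Z (u, v) = pdu Z (u, w)" "pdu (pdu Z) (u, v) = pdu (pdu Z) (u, w)"
    "xi (u, v) = xi (u, w)" "pdu xi (u, v) = pdu xi (u, w)" "g (u, v) = g (u, w)"
proof -
  have d: "smooth_on M (pdu F)" "pdv (pdu F) x = 0" if F: "smooth_on M F" "\<And>x. x \<in> M \<Longrightarrow> pdv F x = 0" and x: "x \<in> M"
    for F :: "real \<times> real \<Rightarrow> real" and x
    using smooth_on_dder[OF F(1)] mixed[OF F(1) x] dder_zero_on[OF open_M x, of "pdv F" 0 "(1, 0)"] F(2) by simp_all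
  have x: "(u, v) \<in> M" using u v by simp
  note Z1 = d[OF sm_XYZ(3) pdv_Z]
  have sZ: "smooth_on M (pdu Z)" "smooth_on M (pdu (pdu Z))" "smooth_on M (pdu xi)"
    by (intro smooth_on_dder sm_XYZ sm_xi)+
  show "Z (u, v) = Z (u, w)" by (rule v_constant[OF sm_XYZ(3) pdv_Z u v])
  show "pdu Z (u, v) = pdu Z (u, w)" by (rule v_constant[OF sZ(1) Z1(2) u v])
  show "pdu (pdu Z) (u, v) = pdu (pdu Z) (u, w)" by (rule v_constant[OF sZ(2) d(2)[OF sZ(1) Z1(2)] u v])
  show "xi (u, v) = xi (u, w)" by (rule v_constant[OF sm_xi pdv_xi u v])
  show "pdu xi (u, v) = pdu xi (u, w)" by (rule v_constant[OF sZ(3) d(2)[OF sm_xi pdv_xi] u v])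
  show "g (u, v) = g (u, w)" by (rule v_constant[OF sm_ei(1) pdv_invariants(1) u v])
qed

text \<open>A \<open>u\<close>-line with the functions \<open>Z\<close> and \<open>xi\<close>, which are the same for all \<open>u\<close>-lines.\<close>

lemma profile:
  assumes v0: "v0 \<in> I2" and u0: "u0 \<in> I1"
  shows "applicable_profile I1 (\<lambda>u. c (u, v0)) (\<lambda>u. c1 (u, v0)) (\<lambda>u. c2 (u, v0)) (\<lambda>u. e3 (u, v0))
    (\<lambda>u. e4 (u, v0)) (l (u0, v0)) (\<lambda>u. g (u, v0)) (\<lambda>u. r (u, v0))
    (\<lambda>u. Z (u, v0)) (\<lambda>u. pdu Z (u, v0)) (\<lambda>u. pdu (pdu Z) (u, v0)) (\<lambda>u. xi (u, v0)) (\<lambda>u. pdu xi (u, v0))"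
proof
  have oI: "open I1" using I1 by (simp add: open_interval_def)
  have inM: "(u, v0) \<in> M" if "u \<in> I1" for u using that v0 by simp
  note slice = smooth_on_slice_u[OF open_M oI inM]
  note dslice = slice_u_vector_derivative[OF open_M _ inM]
  show "open_interval I1" by (rule I1)
  show "smooth_on I1 (\<lambda>u. c (u, v0))" "smooth_on I1 (\<lambda>u. c1 (u, v0))" "smooth_on I1 (\<lambda>u. c2 (u, v0))"
    by (rule slice; simp)+
  have sZ: "smooth_on M (pdu Z)" "smooth_on M (pdu (pdu Z))" "smooth_on M (pdu xi)"
    by (intro smooth_on_dder sm_XYZ sm_xi)+
  have dr: "((\<lambda>u. h (u, v0)) has_real_derivative pdu h (u, v0)) (at u)" if "smooth_on M h" "u \<in> I1" for h u
    using dslice[OF that] by (simp add: has_real_derivative_iff_has_vector_derivative)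
  fix u assume u: "u \<in> I1"
  have lu: "l (u0, v0) = l (u, v0)" by (rule u_constant[OF sm(3) l_u u0 u v0])
  show "lie_frame (c (u, v0)) (c1 (u, v0)) (c2 (u, v0)) (e3 (u, v0)) (e4 (u, v0)) (l (u0, v0))"
    unfolding lu by (rule frame[OF inM[OF u]])
  note fr = frenet[OF inM[OF u]]
  show "((\<lambda>u. c (u, v0)) has_vector_derivative c1 (u, v0)) (at u)"
    using dslice[OF sm_ci(1) u] unfolding fr .
  show "((\<lambda>u. c1 (u, v0)) has_vector_derivative c2 (u, v0)) (at u)"
    using dslice[OF sm_ci(2) u] unfolding fr .
  show "((\<lambda>u. c2 (u, v0)) has_vector_derivative e3 (u, v0) - (g (u, v0) / 2) *\<^sub>R c1 (u, v0)) (at u)"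
    using dslice[OF sm_ci(3) u] unfolding fr .
  show "((\<lambda>u. e3 (u, v0)) has_vector_derivative
      e4 (u, v0) - (g (u, v0) / 2) *\<^sub>R c2 (u, v0) - r (u, v0) *\<^sub>R c (u, v0)) (at u)"
    using dslice[OF sm_ei(2) u] unfolding fr .
  show "((\<lambda>u. Z (u, v0)) has_real_derivative pdu Z (u, v0)) (at u)" by (rule dr[OF sm_XYZ(3) u])
  show "((\<lambda>u. pdu Z (u, v0)) has_real_derivative pdu (pdu Z) (u, v0)) (at u)" by (rule dr[OF sZ(1) u])
  show "((\<lambda>u. xi (u, v0)) has_real_derivative pdu xi (u, v0)) (at u)" by (rule dr[OF sm_xi u])
  show "(\<lambda>u. pdu (pdu Z) (u, v0)) differentiable at u" "(\<lambda>u. pdu xi (u, v0)) differentiable at u"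
    "(\<lambda>u. g (u, v0)) differentiable at u"
    using dr[OF sZ(2) u] dr[OF sZ(3) u] dr[OF sm_ei(1) u] by (auto simp: real_differentiable_def)
qed

lemma curvature_line_elastic:
  assumes v0: "v0 \<in> I2" and u0: "u0 \<in> I1"
    and Z: "\<exists>x\<in>M. Z x \<noteq> 0"
    and normal: "\<not> (\<exists>n. smooth_on M n \<and> (\<forall>x\<in>M. lform (n x) (n x) > 0 \<and> n x \<in> lperp (f x) \<and> pdv n x = 0))"
  shows "\<exists>p q \<ff> \<tt> k. space_form_vectors (span {l (u0, v0)}) p q \<and>
    projects_to I1 (span {l (u0, v0)}) p q (\<lambda>u. f (u, v0)) \<ff> \<tt> k \<and> constrained_elastic_on I1 p q \<ff> k"
proof -
  interpret P: applicable_profile I1 "\<lambda>u. c (u, v0)" "\<lambda>u. c1 (u, v0)" "\<lambda>u. c2 (u, v0)" "\<lambda>u. e3 (u, v0)"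
    "\<lambda>u. e4 (u, v0)" "l (u0, v0)" "\<lambda>u. g (u, v0)" "\<lambda>u. r (u, v0)"
    "\<lambda>u. Z (u, v0)" "\<lambda>u. pdu Z (u, v0)" "\<lambda>u. pdu (pdu Z) (u, v0)" "\<lambda>u. xi (u, v0)" "\<lambda>u. pdu xi (u, v0)"
    by (rule profile[OF v0 u0])
  have oI2: "open I2" using I2 by (simp add: open_interval_def)
  note mh = lform_mhat[OF u0 _ v0]
  have \<Omega>: "lform (P.\<Omega> u) (mhat u0 v0 v) = 0" if u: "u \<in> I1" and v: "v \<in> I2" for u v
  proof -
    have "lform (P.\<Omega> u) (mhat u0 v0 v) = 2 * Z (u, v0) * mu e3 (u, v) + 3 * pdu Z (u, v0) * mu c2 (u, v)
      + (pdu (pdu Z) (u, v0) - 2 * xi (u, v0) - g (u, v0) * Z (u, v0)) * mu c1 (u, v)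
      - pdu xi (u, v0) * mu c (u, v)"
      unfolding P.\<Omega>_def by (simp add: lform_simps mh(1)[OF u v])
    also have "\<dots> = 0"
      using third_order_equation[of "(u, v)"] u v profile_invariants[OF u v0 v] by simp
    finally show ?thesis .
  qed
  have mW: "mhat u0 v0 v \<in> P.W" if v: "v \<in> I2" for v
    using \<Omega>[OF _ v] mhat_perp_l(1)[OF u0 v0] by (simp add: P.W_def)
  have hW: "mhat' u0 v0 v \<in> P.W" if v: "v \<in> I2" for v
  proof -
    have "lform (P.\<Omega> u) (mhat' u0 v0 v) = 0" if u: "u \<in> I1" for u
      using lform_vector_derivative_const[OF oI2 v has_vector_derivative_const mhat_derivative[OF u0 v], of "P.\<Omega> u" v0 0]
        \<Omega>[OF u] by (simp add: lform_simps)
    then show ?thesis using mhat_perp_l(2)[OF u0 v0] by (simp add: P.W_def)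
  qed
  obtain u1 v1 where uv1: "u1 \<in> I1" "v1 \<in> I2" "Z (u1, v1) \<noteq> 0" using Z by auto
  have Z1: "Z (u1, v0) \<noteq> 0" using uv1 profile_invariants(1)[OF uv1(1,2) v0] by simp
  have nspan: "\<not> (\<exists>a\<in>mhat u0 v0 ` I2. \<exists>b\<in>mhat u0 v0 ` I2. \<forall>v\<in>I2. mhat u0 v0 v \<in> span {a, b})"
    using v_independent_normal[OF u0 v0] normal by blast
  have "\<exists>p q \<ff> \<tt> k. space_form_vectors (span {l (u0, v0)}) p q \<and>
    projects_to I1 (span {l (u0, v0)}) p q (\<lambda>u. span {c (u, v0), c1 (u, v0)}) \<ff> \<tt> k \<and> constrained_elastic_on I1 p q \<ff> k"
  proof (rule P.elastic_profile[OF I2 mW hW mhat_derivative[OF u0] _ _ nspan uv1(1) Z1])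
    fix u v assume u: "u \<in> I1" and v: "v \<in> I2"
    then have x: "(u, v) \<in> M" by simp
    show "lform (c (u, v0)) (mhat u0 v0 v) \<noteq> 0" using mh(1)[OF u v] mu_c[OF x] by simp
    show "lform (c (u, v0)) (mhat u0 v0 v) * lform (c1 (u, v0)) (mhat' u0 v0 v)
        - lform (c1 (u, v0)) (mhat u0 v0 v) * lform (c (u, v0)) (mhat' u0 v0 v) \<noteq> 0"
      using mh[OF u v] regular_second[OF x] by (simp add: mu_def)
  qed
  moreover have "projects_to I1 L p q (\<lambda>u. span {c (u, v0), c1 (u, v0)}) \<ff> \<tt> k
      \<longleftrightarrow> projects_to I1 L p q (\<lambda>u. f (u, v0)) \<ff> \<tt> k" for L p q \<ff> \<tt> k
    using f_span v0 by (simp add: projects_to_def)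
  ultimately show ?thesis by simp
qed

end

lemma (in spherical_surface) curvature_line_legendre:
  assumes v0: "v0 \<in> I2"
  shows "legendre_on I1 (\<lambda>u. f (u, v0))"
proof -
  have oI: "open I1" using I1 by (simp add: open_interval_def)
  have inM: "(u, v0) \<in> M" if "u \<in> I1" for u using that v0 by simp
  note slice = smooth_on_slice_u[OF open_M oI inM]
  have sl: "smooth_on I1 (\<lambda>u. c (u, v0))" "smooth_on I1 (\<lambda>u. c1 (u, v0))" by (rule slice; simp)+
  have d: "dder (\<lambda>u. c (u, v0)) u X = X *\<^sub>R c1 (u, v0)" "dder (\<lambda>u. c1 (u, v0)) u X = X *\<^sub>R c2 (u, v0)"
    if "u \<in> I1" for u X
    using slice_u_vector_derivative[OF open_M sm_ci(1) inM[OF that]]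
      slice_u_vector_derivative[OF open_M sm_ci(2) inM[OF that]]
    unfolding has_vector_derivative_def frenet[OF inM[OF that]] by (auto intro: dder_eqI)
  have span: "f (u, v0) = span {c (u, v0), c1 (u, v0)}" if "u \<in> I1" for u by (rule f_span[OF inM[OF that]])
  have perp: "c (u, v0) \<in> lperp (f (u, v0))" "c1 (u, v0) \<in> lperp (f (u, v0))" "c2 (u, v0) \<in> lperp (f (u, v0))"
    if "u \<in> I1" for u
    unfolding span[OF that] in_lperp_span2 by (simp_all add: gram[OF inM[OF that]])
  show ?thesis
    unfolding legendre_on_def
  proof (intro conjI ballI)
    show "subbundle_on I1 2 (\<lambda>u. f (u, v0))"
      unfolding subbundle_on_def
    proof (intro conjI ballI)
      fix u assume u: "u \<in> I1"
      show "subspace (f (u, v0))" "dim (f (u, v0)) = 2" using null_planes_D[OF null[OF inM[OF u]]] by simp_all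
      define F where "F = (\<lambda>i::nat. if i = 0 then (\<lambda>u. c (u, v0)) else (\<lambda>u. c1 (u, v0)))"
      have "(\<lambda>i. F i y) ` {..<2} = {c (y, v0), c1 (y, v0)}" for y
        by (auto simp: F_def image_iff numeral_2_eq_2 less_Suc_eq)
      then show "\<exists>U F. open U \<and> u \<in> U \<and> U \<subseteq> I1 \<and> (\<forall>i<2. smooth_on U (F i)) \<and>
          (\<forall>y\<in>U. f (y, v0) = span ((\<lambda>i. F i y) ` {..<2::nat}))"
        by (intro exI[of _ I1] exI[of _ F]) (auto simp: oI u span F_def sl)
    qed
    fix u assume u: "u \<in> I1"
    show "f (u, v0) \<in> null_planes" by (rule null[OF inM[OF u]])
    show "first_derived I1 (\<lambda>u. f (u, v0)) u \<subseteq> lperp (f (u, v0))"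
    proof
      fix y assume "y \<in> first_derived I1 (\<lambda>u. f (u, v0)) u"
      then consider \<sigma> where "\<sigma> \<in> sections I1 (\<lambda>u. f (u, v0))" "y = \<sigma> u"
        | \<sigma> X where "\<sigma> \<in> sections I1 (\<lambda>u. f (u, v0))" "y = dder \<sigma> u X"
        unfolding first_derived_def by blast
      then show "y \<in> lperp (f (u, v0))"
      proof cases
        case 1
        then have "y \<in> f (u, v0)" using u by (simp add: sections_def)
        then show ?thesis using null_planes_D(3)[OF null[OF inM[OF u]]] by (auto simp: lperp_def)
      next
        case 2
        have \<sigma>: "smooth_on I1 \<sigma>" "\<And>w. w \<in> I1 \<Longrightarrow> \<sigma> w \<in> span {c (w, v0), c1 (w, v0)}"
          using 2(1) span by (auto simp: sections_def)
        have D: "c (u, v0)$5 * c1 (u, v0)$6 - c (u, v0)$6 * c1 (u, v0)$5 \<noteq> 0"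
          by (rule null_plane_det[OF null[OF inM[OF u]] _ _ frame_indep[OF inM[OF u]]]) (simp_all add: span[OF u] span_base)
        obtain \<alpha> \<beta> \<gamma> \<delta> where "dder \<sigma> u X = \<alpha> *\<^sub>R c (u, v0) + \<beta> *\<^sub>R c1 (u, v0)
            + \<gamma> *\<^sub>R dder (\<lambda>u. c (u, v0)) u X + \<delta> *\<^sub>R dder (\<lambda>u. c1 (u, v0)) u X"
          by (rule bundle_section_derivative[OF oI u \<sigma>(1) sl \<sigma>(2) D])
        then have "y = \<alpha> *\<^sub>R c (u, v0) + \<beta> *\<^sub>R c1 (u, v0) + (\<gamma> * X) *\<^sub>R c1 (u, v0) + (\<delta> * X) *\<^sub>R c2 (u, v0)"
          using 2(2) by (simp add: d[OF u])
        then show ?thesis using perp[OF u] by (simp add: lperp_def lform_simps)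
      qed
    qed
  next
    show "immersed_on I1 (\<lambda>u. f (u, v0))"
      unfolding immersed_on_def
    proof (intro ballI allI impI)
      fix u X assume u: "u \<in> I1" and X: "\<forall>\<sigma>\<in>sections I1 (\<lambda>u. f (u, v0)). dder \<sigma> u X \<in> f (u, v0)"
      have "(\<lambda>u. c1 (u, v0)) \<in> sections I1 (\<lambda>u. f (u, v0))"
        using sl by (simp add: sections_def span span_base)
      then have "X *\<^sub>R c2 (u, v0) \<in> f (u, v0)" using X d(2)[OF u, of X] by metis
      then have "lform (X *\<^sub>R c2 (u, v0)) (c2 (u, v0)) = 0" using perp(3)[OF u] by (auto simp: lperp_def)
      then show "X = 0" by (simp add: lform_simps gram[OF inM[OF u]])
    qed
  qed
qed

section \<open>Normalised sections\<close>

lemma sections_memD: "\<sigma> \<in> sections M V \<Longrightarrow> x \<in> M \<Longrightarrow> \<sigma> x \<in> V x"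
  by (simp add: sections_def)

lemma spacelike_span:
  assumes "lform n n > 0"
  shows "spacelike (span {n})"
  unfolding spacelike_def
proof (intro ballI impI)
  fix y assume "y \<in> span {n}" "y \<noteq> 0"
  then obtain k where k: "y = k *\<^sub>R n" "k \<noteq> 0" by (auto simp: span_singleton)
  then have "lform y y = k\<^sup>2 * lform n n" by (simp add: lform_simps power2_eq_square)
  then show "lform y y > 0" using assms k(2) by simp
qed

text \<open>The section of the first curvature sphere congruence whose second derivative along the
  curvature lines is a unit vector.\<close>

lemma normalised_curvature_sphere:
  fixes f s1 :: "real \<times> real \<Rightarrow> R42 set"
  assumes M: "open M" "convex M" and f: "legendre_on M f"
    and s1: "subbundle_on M 1 s1" "\<And>x. x \<in> M \<Longrightarrow> s1 x \<subseteq> f x" "immersed_on M s1"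
    and curv: "\<And>\<sigma>. \<sigma> \<in> sections M s1 \<Longrightarrow> pdu \<sigma> \<in> sections M f"
  shows "\<exists>c. smooth_on M c \<and> (\<forall>x\<in>M. c x \<noteq> 0 \<and> s1 x = span {c x} \<and> lform (pdu (pdu c) x) (pdu (pdu c) x) = 1)"
proof -
  obtain \<sigma> where \<sigma>: "smooth_on M \<sigma>" "\<And>x. x \<in> M \<Longrightarrow> \<sigma> x \<in> s1 x" "\<And>x. x \<in> M \<Longrightarrow> norm (\<sigma> x) = 1"
    using line_bundle_section[OF s1(1) M] by blast
  define \<sigma>1 \<sigma>2 where "\<sigma>1 = pdu \<sigma>" and "\<sigma>2 = pdu \<sigma>1"
  have sm: "smooth_on M \<sigma>1" "smooth_on M \<sigma>2"
    unfolding \<sigma>1_def \<sigma>2_def by (intro smooth_on_dder \<sigma>(1))+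
  have \<sigma>0: "\<sigma> x \<noteq> 0" if "x \<in> M" for x using \<sigma>(3)[OF that] by auto
  have sec: "\<sigma> \<in> sections M s1" "\<sigma>1 \<in> sections M f"
    using \<sigma> curv[of \<sigma>] by (simp_all add: sections_def \<sigma>1_def)
  have s1_span: "s1 x = span {\<sigma> x}" if "x \<in> M" for x
    using s1(1) that \<sigma>(2)[OF that] \<sigma>0[OF that] by (intro line_eq_span) (auto simp: subbundle_on_def)
  have null: "f x \<in> null_planes" if "x \<in> M" for x using f that by (simp add: legendre_on_def)
  note nD = null_planes_D[OF null]
  have perp: "dder \<rho> x X \<in> lperp (f x)" if "\<rho> \<in> sections M f" "x \<in> M" for \<rho> x X
    using f that unfolding legendre_on_def first_derived_def by blast
  have inf: "\<sigma> x \<in> f x" "\<sigma>1 x \<in> f x" "\<sigma>2 x \<in> lperp (f x)" if "x \<in> M" for x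
    using \<sigma>(2)[OF that] s1(2)[OF that] sec(2) that perp[OF sec(2) that] by (auto simp: sections_def \<sigma>2_def)
  have ind: "indep2 (\<sigma> x) (\<sigma>1 x)" if x: "x \<in> M" for x
    unfolding indep2_def
  proof (intro allI impI)
    fix s t assume st: "s *\<^sub>R \<sigma> x + t *\<^sub>R \<sigma>1 x = 0"
    have "t = 0"
    proof (rule ccontr)
      assume t: "t \<noteq> 0"
      have "t *\<^sub>R \<sigma>1 x = (- s) *\<^sub>R \<sigma> x" using st by (simp add: eq_neg_iff_add_eq_0 add.commute)
      then have "t *\<^sub>R \<sigma>1 x \<in> span {\<sigma> x}" by (simp add: span_scale span_base span_neg)
      from span_scale[OF this, of "inverse t"] have "dder \<sigma> x (1, 0) \<in> span {\<sigma> x}"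
        using t by (simp add: \<sigma>1_def)
      from immersed_line_bundle[OF M(1) x s1(3) \<sigma>(1) \<sigma>0 s1_span this]
      show False by (simp add: zero_prod_def)
    qed
    then show "s = 0 \<and> t = 0" using st \<sigma>0[OF x] by simp
  qed
  have f_span: "f x = span {\<sigma> x, \<sigma>1 x}" if "x \<in> M" for x
    by (rule plane_eq_span[OF nD(1,2)[OF that] inf(1,2)[OF that] ind[OF that]])
  define q where "q = (\<lambda>x. lform (\<sigma>2 x) (\<sigma>2 x))"
  have q: "q x > 0" if x: "x \<in> M" for x
  proof (rule ccontr)
    assume "\<not> q x > 0"
    then have s2: "\<sigma>2 x \<in> f x"
      using null_plane_perp_pos[OF null[OF x] inf(3)[OF x]] by (simp add: q_def)
    have "dder \<rho> x (1, 0) \<in> f x" if \<rho>: "\<rho> \<in> sections M f" for \<rho>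
    proof -
      have r: "smooth_on M \<rho>" "\<And>y. y \<in> M \<Longrightarrow> \<rho> y \<in> span {\<sigma> y, \<sigma>1 y}"
        using \<rho> f_span by (auto simp: sections_def)
      obtain \<alpha> \<beta> \<gamma> \<delta> where "pdu \<rho> x = \<alpha> *\<^sub>R \<sigma> x + \<beta> *\<^sub>R \<sigma>1 x + \<gamma> *\<^sub>R pdu \<sigma> x + \<delta> *\<^sub>R pdu \<sigma>1 x"
        by (rule bundle_section_derivative[OF M(1) x r(1) \<sigma>(1) sm(1) r(2)
              null_plane_det[OF null[OF x] inf(1,2)[OF x] ind[OF x]]])
      then have "pdu \<rho> x = \<alpha> *\<^sub>R \<sigma> x + \<beta> *\<^sub>R \<sigma>1 x + \<gamma> *\<^sub>R \<sigma>1 x + \<delta> *\<^sub>R \<sigma>2 x"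
        by (simp add: \<sigma>1_def \<sigma>2_def)
      then show ?thesis using nD(1)[OF x] inf(1,2)[OF x] s2 by (simp add: subspace_add subspace_scale)
    qed
    then have "(1, 0) = (0 :: real \<times> real)"
      using f x unfolding legendre_on_def immersed_on_def by blast
    then show False by (simp add: zero_prod_def)
  qed
  have gram: "lform (\<sigma> x) (\<sigma> x) = 0" "lform (\<sigma> x) (\<sigma>1 x) = 0" "lform (\<sigma>1 x) (\<sigma> x) = 0"
    "lform (\<sigma>1 x) (\<sigma>1 x) = 0" "lform (\<sigma> x) (\<sigma>2 x) = 0" "lform (\<sigma>2 x) (\<sigma> x) = 0"
    "lform (\<sigma>1 x) (\<sigma>2 x) = 0" "lform (\<sigma>2 x) (\<sigma>1 x) = 0" if "x \<in> M" for x
    using nD(3)[OF that] inf[OF that] by (auto simp: lperp_def lform_commute[of "\<sigma>2 x"])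
  define h where "h = (\<lambda>x. inverse (sqrt (q x)))"
  have smq: "smooth_on M q"
    unfolding q_def by (rule smooth_on_lform[OF M(1) sm(2,2)])
  have smh: "smooth_on M h"
    unfolding h_def by (rule smooth_on_inverse[OF M(1) smooth_on_sqrt[OF M(1) smq q]]) (use q in force)+
  have h: "h x \<noteq> 0" "h x * h x * q x = 1" if "x \<in> M" for x
  proof -
    have s: "sqrt (q x) \<noteq> 0" "sqrt (q x) * sqrt (q x) = q x" using q[OF that] by simp_all
    have "inverse (sqrt (q x)) * inverse (sqrt (q x)) * (sqrt (q x) * sqrt (q x)) = 1"
      using s(1) by (simp add: field_simps)
    then show "h x \<noteq> 0" "h x * h x * q x = 1" using s by (simp_all add: h_def)
  qed
  define c where "c = (\<lambda>x. h x *\<^sub>R \<sigma> x)"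
  have smc: "smooth_on M c" unfolding c_def by (rule smooth_on_scaleR[OF M(1) smh \<sigma>(1)])
  have c1: "pdu c x = pdu h x *\<^sub>R \<sigma> x + h x *\<^sub>R \<sigma>1 x" if "x \<in> M" for x
    unfolding c_def \<sigma>1_def by (rule dder_scaleR[OF M(1) smh \<sigma>(1) that])
  have c2: "pdu (pdu c) x = pdu (pdu h) x *\<^sub>R \<sigma> x + (2 * pdu h x) *\<^sub>R \<sigma>1 x + h x *\<^sub>R \<sigma>2 x"
    if x: "x \<in> M" for x
  proof -
    have s: "smooth_on M (pdu h)" by (rule smooth_on_dder[OF smh])
    have 1: "pdu (pdu c) x = pdu (\<lambda>x. pdu h x *\<^sub>R \<sigma> x + h x *\<^sub>R \<sigma>1 x) x"
      by (rule dder_cong[OF M(1) x c1 smooth_on_dder[OF smc]])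
    have 2: "pdu \<sigma> x = \<sigma>1 x" "pdu \<sigma>1 x = \<sigma>2 x" by (simp_all add: \<sigma>1_def \<sigma>2_def)
    have "pdu (pdu c) x = pdu (pdu h) x *\<^sub>R \<sigma> x + pdu h x *\<^sub>R \<sigma>1 x + (pdu h x *\<^sub>R \<sigma>1 x + h x *\<^sub>R \<sigma>2 x)"
      unfolding 1 dder_add[OF M(1) smooth_on_scaleR[OF M(1) s \<sigma>(1)] smooth_on_scaleR[OF M(1) smh sm(1)] x]
        dder_scaleR[OF M(1) s \<sigma>(1) x] dder_scaleR[OF M(1) smh sm(1) x] 2 ..
    then show ?thesis by (simp only: mult_2 scaleR_add_left add.assoc)
  qed
  have "lform (pdu (pdu c) x) (pdu (pdu c) x) = 1" if x: "x \<in> M" for x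
  proof -
    have "lform (pdu (pdu c) x) (pdu (pdu c) x) = h x * h x * q x"
      unfolding c2[OF x] by (simp add: lform_simps gram[OF x] q_def)
    then show ?thesis using h[OF x] by simp
  qed
  moreover have "s1 x = span {c x}" "c x \<noteq> 0" if "x \<in> M" for x
    using h[OF that] \<sigma>0[OF that] span_singleton_scale[of "h x" "\<sigma> x"] s1_span[OF that] by (simp_all add: c_def)
  ultimately show ?thesis using smc by blast
qed

text \<open>A spacelike line bundle that is constant along the first coordinate has a unit section that
  does not depend on this coordinate.\<close>

lemma normalised_sphere_vector:
  assumes I1: "open_interval I1" and I2: "open_interval I2"
    and L: "subbundle_on (I1 \<times> I2) 1 L" "\<And>x. x \<in> I1 \<times> I2 \<Longrightarrow> spacelike (L x)"
    and const: "\<And>u u' v. u \<in> I1 \<Longrightarrow> u' \<in> I1 \<Longrightarrow> v \<in> I2 \<Longrightarrow> L (u, v) = L (u', v)"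
  shows "\<exists>l. smooth_on (I1 \<times> I2) l \<and> (\<forall>x\<in>I1 \<times> I2. l x \<in> L x \<and> lform (l x) (l x) = 1 \<and> pdu l x = 0)"
proof -
  let ?M = "I1 \<times> I2"
  have M: "open ?M" "convex ?M"
    using I1 I2 by (simp_all add: open_interval_def open_Times convex_Times is_interval_convex)
  obtain n where n: "smooth_on ?M n" "\<And>x. x \<in> ?M \<Longrightarrow> n x \<in> L x" "\<And>x. x \<in> ?M \<Longrightarrow> norm (n x) = 1"
    using line_bundle_section[OF L(1) M] by blast
  define q where "q = (\<lambda>x. lform (n x) (n x))"
  have q: "q x > 0" if "x \<in> ?M" for x
    using L(2)[OF that] n(2,3)[OF that] unfolding spacelike_def q_def by force
  have smq: "smooth_on ?M q" unfolding q_def by (rule smooth_on_lform[OF M(1) n(1,1)])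
  define l where "l = (\<lambda>x. inverse (sqrt (q x)) *\<^sub>R n x)"
  have sml: "smooth_on ?M l"
    unfolding l_def
    by (rule smooth_on_scaleR[OF M(1) smooth_on_inverse[OF M(1) smooth_on_sqrt[OF M(1) smq q]] n(1)]) (use q in force)+
  have lL: "l x \<in> L x" if "x \<in> ?M" for x
  proof -
    have "subspace (L x)" using L(1) that unfolding subbundle_on_def by blast
    then show ?thesis using n(2)[OF that] by (simp add: l_def subspace_scale)
  qed
  have ll: "lform (l x) (l x) = 1" if "x \<in> ?M" for x
  proof -
    have s: "sqrt (q x) \<noteq> 0" "sqrt (q x) * sqrt (q x) = q x" using q[OF that] by simp_all
    have "lform (l x) (l x) = inverse (sqrt (q x)) * (inverse (sqrt (q x)) * q x)"
      by (simp add: l_def lform_simps q_def)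
    also have "\<dots> = inverse (sqrt (q x)) * (inverse (sqrt (q x)) * (sqrt (q x) * sqrt (q x)))" using s(2) by simp
    also have "\<dots> = 1" using s(1) by (simp add: field_simps)
    finally show ?thesis .
  qed
  have indep: "l (u, v) = l (u', v)" if u: "u \<in> I1" "u' \<in> I1" and v: "v \<in> I2" for u u' v
  proof -
    have k: "\<exists>k. l (w, v) = k *\<^sub>R l (u', v) \<and> k * k = 1" if w: "w \<in> I1" for w
    proof -
      have x: "(w, v) \<in> ?M" "(u', v) \<in> ?M" using w u v by auto
      have "l (u', v) \<noteq> 0" using ll[OF x(2)] by (auto simp: lform_simps)
      then have "L (w, v) = span {l (u', v)}"
        unfolding const[OF w u(2) v] using L(1) x(2) lL[OF x(2)] by (intro line_eq_span) (auto simp: subbundle_on_def)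
      then obtain k where k: "l (w, v) = k *\<^sub>R l (u', v)" using lL[OF x(1)] by (auto simp: span_singleton)
      have "k * k = 1" using ll[OF x(1)] ll[OF x(2)] unfolding k by (simp add: lform_simps)
      with k show ?thesis by blast
    qed
    define F where "F = (\<lambda>w. lform (l (w, v)) (l (u', v)))"
    have x': "(u', v) \<in> ?M" using u v by simp
    have oI: "open I1" using I1 by (simp add: open_interval_def)
    have "smooth_on I1 (\<lambda>w. l (w, v))"
      by (rule smooth_on_slice_u[OF M(1) oI _ sml]) (use v in simp)
    then have "smooth_on I1 F" unfolding F_def by (intro smooth_on_lform smooth_on_const oI)
    then have cF: "continuous_on I1 F" by (rule smooth_on_imp_continuous_on)
    have Fk: "l (w, v) = F w *\<^sub>R l (u', v) \<and> F w * F w = 1" if w: "w \<in> I1" for w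
      using k[OF w] ll[OF x'] by (auto simp: F_def lform_simps)
    have F0: "F w \<noteq> 0" if "w \<in> I1" for w using Fk[OF that] by auto
    obtain s where s: "s = 1 \<or> s = -1" "\<And>w. w \<in> I1 \<Longrightarrow> s * F w > 0"
      using open_interval_sign[OF I1 cF F0] by blast
    have "F u' = 1" using ll[OF x'] by (simp add: F_def)
    then have "s = 1" using s(1) s(2)[OF u(2)] by auto
    then have "F u > 0" using s(2)[OF u(1)] by simp
    moreover have "(F u - 1) * (F u + 1) = 0" using Fk[OF u(1)] by (simp add: algebra_simps)
    ultimately have "F u = 1" by auto
    then show ?thesis using Fk[OF u(1)] by simp
  qed
  have "pdu l x = 0" if x: "x \<in> ?M" for x
  proof -
    obtain u v where uv: "x = (u, v)" "u \<in> I1" "v \<in> I2" using x by auto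
    have "((\<lambda>w. l (w, v)) has_vector_derivative 0) (at u)"
      by (rule has_vector_derivative_transform_within_open[OF has_vector_derivative_const _ uv(2), of "l (u, v)"])
         (use I1 indep[OF uv(2) _ uv(3)] in \<open>auto simp: open_interval_def\<close>)
    moreover have "((\<lambda>w. l (w, v)) has_vector_derivative pdu l x) (at u)"
      using slice_u_vector_derivative[OF M(1) sml, of u v] x uv(1) by simp
    ultimately show ?thesis using vector_derivative_unique_at by blast
  qed
  then show ?thesis using sml lL ll by blast
qed

text \<open>The \<open>u\<close>-lines are curves tangent to \<open>T\<close>.\<close>

lemma spherical_curvature_lines_u:
  fixes I1 I2 :: "real set"
  assumes I1: "open_interval I1" and T: "\<And>x. x \<in> I1 \<times> I2 \<Longrightarrow> (1, 0) \<in> T x"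
    and const: "constant_along_leaves (I1 \<times> I2) T L"
    and u: "u \<in> I1" "u' \<in> I1" "v \<in> I2"
  shows "L (u, v) = L (u', v)"
proof -
  let ?\<gamma> = "\<lambda>t::real. (t, v)"
  have oI: "open I1" using I1 by (simp add: open_interval_def)
  have bl: "bounded_linear (\<lambda>t::real. (t, 0::real))"
    by (intro bounded_linear_Pair bounded_linear_ident bounded_linear_zero)
  have "smooth_on I1 (\<lambda>t. (0, v) + (t, 0))" by (rule smooth_on_linear[OF oI bl])
  then have sm: "smooth_on I1 ?\<gamma>" by simp
  have vd: "vector_derivative ?\<gamma> (at t) = (1, 0)" for t
    by (rule vector_derivative_at) (auto intro!: derivative_eq_intros simp: has_vector_derivative_def)
  have im: "?\<gamma> ` I1 \<subseteq> I1 \<times> I2" using u by auto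
  have tangent: "vector_derivative ?\<gamma> (at t) \<in> T (?\<gamma> t)" if "t \<in> I1" for t
    unfolding vd by (rule T) (use that u in simp)
  have "\<forall>s\<in>I1. \<forall>t\<in>I1. L (?\<gamma> s) = L (?\<gamma> t)"
    by (rule const[unfolded constant_along_leaves_def, THEN spec, THEN spec, THEN mp])
      (intro conjI ballI I1 sm im tangent)
  then show ?thesis using u(1,2) by (elim ballE) auto
qed

lemma spherical_curvature_lines_v:
  fixes f :: "real \<times> real \<Rightarrow> R42 set"
  assumes M: "open M" and T: "\<And>x. x \<in> M \<Longrightarrow> T x = span {(0, 1)}"
    and n: "smooth_on M n" "\<And>x. x \<in> M \<Longrightarrow> lform (n x) (n x) > 0" "\<And>x. x \<in> M \<Longrightarrow> n x \<in> lperp (f x)"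
      "\<And>x. x \<in> M \<Longrightarrow> pdv n x = 0"
  shows "spherical_curvature_lines M f T"
  unfolding spherical_curvature_lines_def
proof (intro exI[of _ "\<lambda>x. span {n x}"] conjI ballI)
  have n0: "n x \<noteq> 0" if "x \<in> M" for x using n(2)[OF that] by (auto simp: lform_simps)
  show "subbundle_on M 1 (\<lambda>x. span {n x})"
    unfolding subbundle_on_def
  proof (intro conjI ballI)
    fix x assume x: "x \<in> M"
    show "dim (span {n x}) = 1" using n0[OF x] by simp
    show "\<exists>U F. open U \<and> x \<in> U \<and> U \<subseteq> M \<and> (\<forall>i<1. smooth_on U (F i)) \<and>
        (\<forall>y\<in>U. span {n y} = span ((\<lambda>i. F i y) ` {..<1::nat}))"
      by (intro exI[of _ M] exI[of _ "\<lambda>_. n"]) (auto simp: M x n(1) lessThan_Suc)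
  qed simp
  fix x assume x: "x \<in> M"
  show "span {n x} \<subseteq> lperp (f x)"
    using n(3)[OF x] by (auto simp: span_singleton lperp_def lform_simps)
  show "spacelike (span {n x})"
    by (rule spacelike_span[OF n(2)[OF x]])
next
  show "constant_along_leaves M T (\<lambda>x. span {n x})"
    unfolding constant_along_leaves_def
  proof (intro allI impI, elim conjE, intro ballI)
    fix J \<gamma> s t
    assume J: "open_interval J" and \<gamma>: "smooth_on J \<gamma>" "\<gamma> ` J \<subseteq> M"
      "\<forall>t\<in>J. vector_derivative \<gamma> (at t) \<in> T (\<gamma> t)" and st: "s \<in> J" "t \<in> J"
    have oJ: "open J" using J by (simp add: open_interval_def)
    have "((\<lambda>t. n (\<gamma> t)) has_vector_derivative 0) (at t)" if t: "t \<in> J" for t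
    proof -
      have x: "\<gamma> t \<in> M" using \<gamma>(2) t by blast
      have "(\<gamma> has_vector_derivative vector_derivative \<gamma> (at t)) (at t)"
        using smooth_on_imp_has_derivative[OF oJ \<gamma>(1) t] by (metis differentiableI vector_derivative_works)
      moreover obtain k where "vector_derivative \<gamma> (at t) = k *\<^sub>R (0, 1)"
        using \<gamma>(3) t T[OF x] by (force simp: span_singleton)
      ultimately have d: "(\<gamma> has_derivative (\<lambda>h. h *\<^sub>R k *\<^sub>R (0, 1))) (at t)"
        by (simp add: has_vector_derivative_def)
      have "((\<lambda>t. n (\<gamma> t)) has_derivative (\<lambda>h. dder n (\<gamma> t) (h *\<^sub>R k *\<^sub>R (0, 1)))) (at t)"
        using diff_chain_at[OF d smooth_on_imp_has_derivative[OF M n(1) x]] by (simp add: o_def)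
      moreover have "dder n (\<gamma> t) (h *\<^sub>R k *\<^sub>R (0, 1)) = 0" for h
        using dder_eq_pd[OF M n(1) x, of "h *\<^sub>R k *\<^sub>R (0, 1)"] n(4)[OF x] by simp
      ultimately show ?thesis by (simp add: has_vector_derivative_def)
    qed
    from open_interval_constant[OF J this st] show "span {n (\<gamma> s)} = span {n (\<gamma> t)}" by simp
  qed
qed

theorem theorem6p4:
  fixes I1 I2 :: "real set"
    and f s1 s2 :: "real \<times> real \<Rightarrow> R42 set"
    and T1 T2 :: "real \<times> real \<Rightarrow> (real \<times> real) set"
  assumes I1: "open_interval I1" and I2: "open_interval I2"
    and legendre: "legendre_on (I1 \<times> I2) f"
    and umbilic_free: "curvature_spheres_on (I1 \<times> I2) f s1 s2 T1 T2"
    and curvature_line_coordinates: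
      "(\<lambda>_. (1, 0)) \<in> sections (I1 \<times> I2) T1" "(\<lambda>_. (0, 1)) \<in> sections (I1 \<times> I2) T2"
    and regular: "immersed_on (I1 \<times> I2) s1" "immersed_on (I1 \<times> I2) s2"
    and applicable: "lie_applicable_on (I1 \<times> I2) f"
    and u_lines_spherical: "spherical_curvature_lines (I1 \<times> I2) f T1"
    and v_lines_not_spherical: "\<not> spherical_curvature_lines (I1 \<times> I2) f T2"
  shows "\<exists>L0 C. subspace L0 \<and> dim L0 = 1 \<and> spacelike L0 \<and>
           legendre_on I1 C \<and> (\<forall>u\<in>I1. C u \<subseteq> lperp L0) \<and>
           (\<exists>p q. space_form_vectors L0 p q \<and>
              (\<exists>\<ff> \<tt> k. projects_to I1 L0 p q C \<ff> \<tt> k \<and> constrained_elastic_on I1 p q \<ff> k)) \<and>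
           (\<forall>v\<in>I2. \<exists>B. lie_sphere_transformation B \<and>
              (\<forall>u\<in>I1. f (u, v) = (\<lambda>y. B *v y) ` C u))"
proof -
  let ?M = "I1 \<times> I2"
  have M: "open ?M" "convex ?M"
    using I1 I2 by (simp_all add: open_interval_def open_Times convex_Times is_interval_convex)
  note cs = umbilic_free[unfolded curvature_spheres_on_def]
  have s12: "subbundle_on ?M 1 s1" "subbundle_on ?M 1 s2" "subbundle_on ?M 1 T2"
    and fibres: "\<forall>x\<in>?M. s1 x \<subseteq> f x \<and> s2 x \<subseteq> f x \<and> s1 x \<inter> s2 x = {0}"
    and curv: "\<forall>\<sigma>\<in>sections ?M s1. \<forall>X\<in>sections ?M T1. (\<lambda>x. dder \<sigma> x (X x)) \<in> sections ?M f"
      "\<forall>\<sigma>\<in>sections ?M s2. \<forall>X\<in>sections ?M T2. (\<lambda>x. dder \<sigma> x (X x)) \<in> sections ?M f"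
    using cs by - ((elim conjE, assumption)+)
  have sf: "s1 x \<subseteq> f x" "s2 x \<subseteq> f x" "s1 x \<inter> s2 x = {0}" if "x \<in> ?M" for x
    using bspec[OF fibres that] by simp_all
  have curv1: "pdu \<sigma> \<in> sections ?M f" if "\<sigma> \<in> sections ?M s1" for \<sigma>
    by (rule curv(1)[rule_format, OF that curvature_line_coordinates(1)])
  have curv2: "pdv \<sigma> \<in> sections ?M f" if "\<sigma> \<in> sections ?M s2" for \<sigma>
    by (rule curv(2)[rule_format, OF that curvature_line_coordinates(2)])
  have "\<exists>c. smooth_on ?M c \<and> (\<forall>x\<in>?M. c x \<noteq> 0 \<and> s1 x = span {c x} \<and> lform (pdu (pdu c) x) (pdu (pdu c) x) = 1)"
    by (rule normalised_curvature_sphere[OF M legendre s12(1) sf(1) regular(1) curv1])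
  then obtain c where c: "smooth_on ?M c" "\<forall>x\<in>?M. c x \<noteq> 0 \<and> s1 x = span {c x} \<and> lform (pdu (pdu c) x) (pdu (pdu c) x) = 1"
    by (elim exE conjE)
  obtain t where t: "smooth_on ?M t" "\<And>x. x \<in> ?M \<Longrightarrow> t x \<in> s2 x" "\<And>x. x \<in> ?M \<Longrightarrow> norm (t x) = 1"
    using line_bundle_section[OF s12(2) M] by blast
  have t0: "t x \<noteq> 0" if "x \<in> ?M" for x using t(3)[OF that] by auto
  have t_span: "s2 x = span {t x}" if "x \<in> ?M" for x
    using s12(2) that t(2)[OF that] t0[OF that] by (intro line_eq_span) (auto simp: subbundle_on_def)
  have c0: "c x \<noteq> 0" and c_span: "s1 x = span {c x}" if "x \<in> ?M" for x using c(2) that by blast+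
  have sec: "c \<in> sections ?M s1" "t \<in> sections ?M s2"
    using c(1) c_span t by (auto simp: sections_def span_base)
  obtain L where L: "subbundle_on ?M 1 L" "\<And>x. x \<in> ?M \<Longrightarrow> L x \<subseteq> lperp (f x)" "\<And>x. x \<in> ?M \<Longrightarrow> spacelike (L x)"
    "constant_along_leaves ?M T1 L"
    using u_lines_spherical unfolding spherical_curvature_lines_def by blast
  have T1: "(1, 0) \<in> T1 x" if "x \<in> ?M" for x using sections_memD[OF curvature_line_coordinates(1) that] .
  have T2: "T2 x = span {(0, 1)}" if "x \<in> ?M" for x
  proof (rule line_eq_span)
    show "subspace (T2 x)" "dim (T2 x) = 1" using s12(3) that unfolding subbundle_on_def by blast+
    show "(0, 1) \<in> T2 x" using sections_memD[OF curvature_line_coordinates(2) that] .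
  qed (simp add: zero_prod_def)
  have "\<exists>l. smooth_on ?M l \<and> (\<forall>x\<in>?M. l x \<in> L x \<and> lform (l x) (l x) = 1 \<and> pdu l x = 0)"
    by (rule normalised_sphere_vector[OF I1 I2 L(1,3) spherical_curvature_lines_u[OF I1 T1 L(4)]])
  then obtain l where l: "smooth_on ?M l" "\<forall>x\<in>?M. l x \<in> L x \<and> lform (l x) (l x) = 1 \<and> pdu l x = 0"
    by (elim exE conjE)
  obtain \<eta> where \<eta>: "one_form_on ?M (\<lambda>x. wedge_space (f x) (lperp (f x))) \<eta>"
    "\<forall>x\<in>?M. \<forall>X Y. ext_deriv \<eta> x X Y = 0 \<and> bracket_wedge \<eta> x X Y = 0"
    "\<exists>x\<in>?M. \<exists>X Y. quad_diff ?M f \<eta> x X Y \<noteq> 0"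
    using applicable unfolding lie_applicable_on_def by (elim exE conjE)
  interpret S: applicable_surface I1 I2 f c t l "\<lambda>x. \<eta> x (1, 0)" "\<lambda>x. \<eta> x (0, 1)"
  proof
    show "open_interval I1" "open_interval I2" by (rule I1, rule I2)
    show "smooth_on ?M c" "smooth_on ?M t" "smooth_on ?M l" by (rule c(1), rule t(1), rule l(1))
    show "smooth_on ?M (\<lambda>x. \<eta> x (1, 0))" "smooth_on ?M (\<lambda>x. \<eta> x (0, 1))"
      using \<eta>(1) by (simp_all add: one_form_on_def)
    fix x assume x: "x \<in> ?M"
    show null: "f x \<in> null_planes" using legendre x unfolding legendre_on_def by blast
    show "c x \<in> f x" using sf(1)[OF x] c_span[OF x] by (auto simp: span_base)
    show "pdu c x \<in> f x" by (rule sections_memD[OF curv1[OF sec(1)] x])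
    show "t x \<in> f x" using sf(2)[OF x] t(2)[OF x] by blast
    show "pdv t x \<in> f x" by (rule sections_memD[OF curv2[OF sec(2)] x])
    show "indep2 (c x) (t x)"
      unfolding indep2_def
    proof (intro allI impI)
      fix p q assume pq: "p *\<^sub>R c x + q *\<^sub>R t x = 0"
      then have e: "p *\<^sub>R c x = (- q) *\<^sub>R t x" by (simp add: eq_neg_iff_add_eq_0)
      have "p *\<^sub>R c x \<in> s1 x" by (simp add: c_span[OF x] span_scale span_base)
      moreover have "p *\<^sub>R c x \<in> s2 x" unfolding e by (simp add: t_span[OF x] span_scale span_base span_neg)
      ultimately have "p *\<^sub>R c x = 0" using sf(3)[OF x] by blast
      then show "p = 0 \<and> q = 0" using pq c0[OF x] t0[OF x] by simp
    qed
    show "lform (pdu (pdu c) x) (pdu (pdu c) x) = 1" using c(2) x by blast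
    show "lform (l x) (l x) = 1" "pdu l x = 0" using l(2) x by blast+
    show "l x \<in> lperp (f x)" using l(2) L(2) x by blast
    show "X = 0" if "dder c x X \<in> span {c x}" for X
      by (rule immersed_line_bundle[OF M(1) x regular(1) c(1) c0 c_span that])
    show "X = 0" if "dder t x X \<in> span {t x}" for X
      by (rule immersed_line_bundle[OF M(1) x regular(2) t(1) t0 t_span that])
    show "dder \<rho> x X \<in> lperp (f x)" if "\<rho> \<in> sections ?M f" for \<rho> X
      using legendre x that unfolding legendre_on_def first_derived_def by blast
    show "pdu (\<lambda>x. \<eta> x (0, 1)) x = pdv (\<lambda>x. \<eta> x (1, 0)) x"
    proof -
      have "ext_deriv \<eta> x (1, 0) (0, 1) = 0" using \<eta>(2) x by blast
      then show ?thesis by (simp add: ext_deriv_def)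
    qed
    show "\<eta> x (1, 0) \<in> wedge_space (f x) (lperp (f x))" "\<eta> x (0, 1) \<in> wedge_space (f x) (lperp (f x))"
      using \<eta>(1) x unfolding one_form_on_def by blast+
  qed
  obtain u0 v0 where uv: "u0 \<in> I1" "v0 \<in> I2" using I1 I2 by (auto simp: open_interval_def)
  have Z: "\<exists>x\<in>?M. S.Z x \<noteq> 0"
  proof (rule ccontr)
    assume "\<not> ?thesis"
    then have Z0: "S.Z x = 0" if "x \<in> ?M" for x using that by blast
    have "quad_diff ?M f \<eta> x X Y = 0" if x: "x \<in> ?M" for x X Y
    proof (rule S.quad_diff_zero[OF Z0 x])
      show "linear (\<eta> x)" using \<eta>(1) x unfolding one_form_on_def by blast
    qed simp_all
    then show False using \<eta>(3) by blast
  qed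
  have normal: "\<not> (\<exists>n. smooth_on ?M n \<and> (\<forall>x\<in>?M. lform (n x) (n x) > 0 \<and> n x \<in> lperp (f x) \<and> pdv n x = 0))"
  proof
    assume "\<exists>n. smooth_on ?M n \<and> (\<forall>x\<in>?M. lform (n x) (n x) > 0 \<and> n x \<in> lperp (f x) \<and> pdv n x = 0)"
    then obtain n where n: "smooth_on ?M n"
      and nn: "\<forall>x\<in>?M. lform (n x) (n x) > 0 \<and> n x \<in> lperp (f x) \<and> pdv n x = 0"
      by (elim exE conjE)
    have "lform (n x) (n x) > 0" "n x \<in> lperp (f x)" "pdv n x = 0" if "x \<in> ?M" for x
      using bspec[OF nn that] by simp_all
    from spherical_curvature_lines_v[OF M(1) T2 n this] have "spherical_curvature_lines ?M f T2" .
    then show False using v_lines_not_spherical by contradiction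
  qed
  define L0 where "L0 = span {l (u0, v0)}"
  have x0: "(u0, v0) \<in> ?M" using uv by simp
  have l1: "lform (l (u0, v0)) (l (u0, v0)) = 1" using l(2) x0 by blast
  then have "l (u0, v0) \<noteq> 0" by (auto simp: lform_simps)
  then have "subspace L0 \<and> dim L0 = 1" by (simp add: L0_def)
  moreover have "spacelike L0"
    unfolding L0_def by (rule spacelike_span) (simp add: l1)
  moreover have "legendre_on I1 (\<lambda>u. f (u, v0))" by (rule S.curvature_line_legendre[OF uv(2)])
  moreover have "\<forall>u\<in>I1. f (u, v0) \<subseteq> lperp L0"
  proof (intro ballI subsetI)
    fix u y assume u: "u \<in> I1" and y: "y \<in> f (u, v0)"
    have x: "(u, v0) \<in> ?M" using u uv by simp
    have "l (u0, v0) = l (u, v0)" by (rule S.u_constant[OF l(1) S.l_u uv(1) u uv(2)])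
    then have "lform (l (u0, v0)) y = 0"
      using S.l_perp[OF x] y by (simp add: lperp_def lform_commute)
    then show "y \<in> lperp L0" by (auto simp: lperp_def L0_def span_singleton lform_simps)
  qed
  moreover have "\<exists>p q. space_form_vectors L0 p q \<and>
      (\<exists>\<ff> \<tt> k. projects_to I1 L0 p q (\<lambda>u. f (u, v0)) \<ff> \<tt> k \<and> constrained_elastic_on I1 p q \<ff> k)"
    using S.curvature_line_elastic[OF uv(2,1) Z normal] unfolding L0_def by blast
  moreover have "\<forall>v\<in>I2. \<exists>B. lie_sphere_transformation B \<and> (\<forall>u\<in>I1. f (u, v) = (\<lambda>y. B *v y) ` f (u, v0))"
    using S.congruent_curvature_lines[OF uv(2)] by blast
  ultimately show ?thesis
    by (intro exI[of _ L0] exI[of _ "\<lambda>u. f (u, v0)"]) blast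
qed

end
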